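(* If a transverse link $L\subset (S^3,\xi_{std})$ is represented by a quasipositive braid, then $\psi(L)\neq0$. Moreover, $\psi(L)$ is a primitive non-torsion element of $Kh(L)$.
   Context: **Transverse links and braids.** $\xi_{std}=\ker(dz-y\,dx+x\,dy)$ is the standard contact structure on $S^3$. A transverse link is a link everywhere transverse to $\xi_{std}$. Closed braids around the $z$-axis represent transverse links. Braids on $b$ strings are words in $\sigma_1^{\pm1},\dots,\sigma_{b-1}^{\pm1}$; $\sigma_i$ gives a positive crossing between strings $i$ and $i+1$, and $\sigma_i^{-1}$ a negative one. A braid is quasipositive if its braid word is a product of conjugates of the form $w\sigma_iw^{-1}$, where $w$ is an arbitrary element of the braid group. An element $x$ of an abelian group $A$ is primitive if it is not of the form $ky$ with $y\in A$ and $k\in\mathbb{Z}$, $|k|\ne1$. **Khovanov complex (coefficients in $\mathbb{Z}$).** Let $L$ be an oriented link diagram with $n=n_++n_-$ crossings ($n_\pm$ positive/negative ones). Each crossing has a 0-resolution and a 1-resolution: the 0-resolution joins the two regions swept out when the overcrossing strand is rotated counterclockwise; in particular the oriented resolution of a positive crossing is its 0-resolution and the oriented resolution of a negative crossing is its 1-resolution. For $v\in\{0,1\}^n$ let $L_v$ be the corresponding complete resolution, a union of planar circles. Let $U$ be the free $\mathbb{Z}$-module with basis ${\bf u}_-,{\bf u}_+$, graded by $p({\bf u}_\pm)=\pm1$. If $L_v$ has $k$ circles put $CKh(L_v)=U^{\otimes k}$ (one factor per circle), and $CKh(L)=\bigoplus_v CKh(L_v)$. Homological grading: $\mathrm{gr}=|v|-n_-$,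 with $|v|$ the number of 1's in $v$; quantum grading: $q=p+\mathrm{gr}+n_+-n_-$. The differential on $CKh(L_v)$ is $d=\sum_e(-1)^{s(e)}d_e$ over edges $e$ of the cube $[0,1]^n$ with initial vertex $v$ (one coordinate changes from 0 to 1), where $d_e$ is $m$ on the factors of two circles that merge, or $\Delta$ on the factor of a circle that splits (identity on other factors): $m({\bf u}_+\otimes{\bf u}_+)={\bf u}_+$, $m({\bf u}_+\otimes{\bf u}_-)=m({\bf u}_-\otimes{\bf u}_+)={\bf u}_-$, $m({\bf u}_-\otimes{\bf u}_-)=0$; $\Delta({\bf u}_+)={\bf u}_+\otimes{\bf u}_-+{\bf u}_-\otimes{\bf u}_+$, $\Delta({\bf u}_-)={\bf u}_-\otimes{\bf u}_-$. The signs are chosen so that $d^2=0$ (all choices give isomorphic complexes). $Kh(L)$ is the bigraded homology. **The element $\psi(L)$.** For a closed braid diagram $L$ on $b$ strings let $L_o$ be the oriented resolution (0-resolution at positive crossings, 1-resolution at negative crossings), which consists of $b$ parallel circles. Put $\tilde\psi(L)={\bf u}_-\otimes\cdots\otimes{\bf u}_-\in U^{\otimes b}=CKh(L_o)$. It is a cycle, and $\psi(L)\in Kh(L)$ is its homology class. Up to sign and the canonical (up to sign) isomorphisms of Khovanov homology induced by isotopies, $\psi(L)$ depends only on the transverse link represented by the closed braid, so for a transverse link it may be computed from any closed braid representing it. *)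

theory Defs
  imports "HOL-Algebra.Free_Abelian_Groups"
begin

section \<open>Braid words and the braid group\<close>

text \<open>The letter \<^term>\<open>(i, True)\<close> is the generator \<open>\<sigma>\<^sub>i\<close> (a positive crossing of the strings
  \<open>i\<close> and \<open>i + 1\<close>), and \<^term>\<open>(i, False)\<close> is its inverse.  Strings are numbered from 1.\<close>

type_synonym braid_word = "(nat \<times> bool) list"

definition braid_words :: "nat \<Rightarrow> braid_word set" where
  "braid_words b = {w. \<forall>(i, s) \<in> set w. 1 \<le> i \<and> i < b}"

definition inverse_word :: "braid_word \<Rightarrow> braid_word" where
  "inverse_word w = rev (map (\<lambda>(i, s). (i, \<not> s)) w)"

text \<open>Artin's presentation: two words represent the same element of the braid group on \<open>b\<close>
  strings iff they are related by the equivalence relation generated by the following moves.\<close>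

inductive braid_move :: "nat \<Rightarrow> braid_word \<Rightarrow> braid_word \<Rightarrow> bool" for b where
  cancel: "\<lbrakk>u \<in> braid_words b; v \<in> braid_words b; 1 \<le> i; i < b\<rbrakk>
     \<Longrightarrow> braid_move b (u @ [(i, s), (i, \<not> s)] @ v) (u @ v)"
| far_commute: "\<lbrakk>u \<in> braid_words b; v \<in> braid_words b; 1 \<le> i; i + 2 \<le> j; j < b\<rbrakk>
     \<Longrightarrow> braid_move b (u @ [(i, True), (j, True)] @ v) (u @ [(j, True), (i, True)] @ v)"
| braid_relation: "\<lbrakk>u \<in> braid_words b; v \<in> braid_words b; 1 \<le> i; i + 1 < b\<rbrakk>
     \<Longrightarrow> braid_move b (u @ [(i, True), (i + 1, True), (i, True)] @ v)
                      (u @ [(i + 1, True), (i, True), (i + 1, True)] @ v)"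

definition same_braid :: "nat \<Rightarrow> braid_word \<Rightarrow> braid_word \<Rightarrow> bool" where
  "same_braid b w w' \<longleftrightarrow> w \<in> braid_words b \<and> w' \<in> braid_words b \<and> equivclp (braid_move b) w w'"

definition quasipositive :: "nat \<Rightarrow> braid_word \<Rightarrow> bool" where
  "quasipositive b w \<longleftrightarrow>
     (\<exists>cs. (\<forall>(u, i) \<in> set cs. u \<in> braid_words b \<and> 1 \<le> i \<and> i < b) \<and>
           same_braid b w (concat (map (\<lambda>(u, i). u @ [(i, True)] @ inverse_word u) cs)))"


section \<open>Transverse links\<close>

text \<open>A closed braid is given by its number of strings and a braid word.  Every transverse link in
  the standard contact 3-sphere is transversely isotopic to a closed braid (Bennequin), and two
  closed braids are transversely isotopic iff they are related by conjugation, positive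
  stabilization and positive destabilization in the braid groups (Orevkov--Shevchishin, Wrinkle).
  A transverse link, up to transverse isotopy, is accordingly the class of all closed braids
  representing it.\<close>

type_synonym closed_braid = "nat \<times> braid_word"

definition closed_braids :: "closed_braid set" where
  "closed_braids = {(b, w). 1 \<le> b \<and> w \<in> braid_words b}"

inductive markov_move :: "closed_braid \<Rightarrow> closed_braid \<Rightarrow> bool" where
  same_braid: "same_braid b w w' \<Longrightarrow> markov_move (b, w) (b, w')"
| conjugation: "\<lbrakk>w \<in> braid_words b; u \<in> braid_words b\<rbrakk>
     \<Longrightarrow> markov_move (b, w) (b, u @ w @ inverse_word u)"
| positive_stabilization: "\<lbrakk>1 \<le> b; w \<in> braid_words b\<rbrakk>
     \<Longrightarrow> markov_move (b, w) (b + 1, w @ [(b, True)])"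

definition transverse_isotopy :: "(closed_braid \<times> closed_braid) set" where
  "transverse_isotopy =
     {(D, D'). D \<in> closed_braids \<and> D' \<in> closed_braids \<and> equivclp markov_move D D'}"

lemma equiv_transverse_isotopy: "equiv closed_braids transverse_isotopy"
proof (rule equivI)
  show "transverse_isotopy \<subseteq> closed_braids \<times> closed_braids"
    by (auto simp: transverse_isotopy_def)
  show "refl_on closed_braids transverse_isotopy"
    by (auto simp: refl_on_def transverse_isotopy_def)
  show "sym transverse_isotopy"
    by (auto simp: sym_def transverse_isotopy_def intro: equivclp_sym)
  show "trans transverse_isotopy"
    by (auto simp: trans_def transverse_isotopy_def intro: equivclp_trans)
qed

definition transverse_links :: "closed_braid set set" where
  "transverse_links = closed_braids // transverse_isotopy"


section \<open>Resolutions of a closed braid diagram\<close>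

text \<open>The crossings of the closure of \<open>w\<close> are the positions \<open>t < length w\<close>.  The pair \<open>(p, t)\<close> is
  the arc in string position \<open>p\<close> directly before crossing \<open>t\<close>; the arcs at level \<open>length w\<close> come
  after the last crossing and are closed up with those at level 0.  A vertex of the cube is the
  set \<open>v\<close> of the crossings that receive the 1-resolution.\<close>

type_synonym arc = "nat \<times> nat"

definition arcs :: "nat \<Rightarrow> braid_word \<Rightarrow> arc set" where
  "arcs b w = {1..b} \<times> {0..length w}"

text \<open>The oriented (vertical) resolution is the 0-resolution of a positive crossing and the
  1-resolution of a negative crossing.\<close>

definition oriented_at :: "braid_word \<Rightarrow> nat set \<Rightarrow> nat \<Rightarrow> bool" where
  "oriented_at w v t \<longleftrightarrow> (t \<notin> v \<longleftrightarrow> snd (w ! t))"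

inductive joined :: "nat \<Rightarrow> braid_word \<Rightarrow> nat set \<Rightarrow> arc \<Rightarrow> arc \<Rightarrow> bool" for b w v where
  closure: "p \<in> {1..b} \<Longrightarrow> joined b w v (p, length w) (p, 0)"
| straight: "\<lbrakk>t < length w; p \<in> {1..b}; p \<notin> {fst (w ! t), fst (w ! t) + 1} \<or> oriented_at w v t\<rbrakk>
     \<Longrightarrow> joined b w v (p, t) (p, t + 1)"
| turn_before: "\<lbrakk>t < length w; \<not> oriented_at w v t; i = fst (w ! t)\<rbrakk>
     \<Longrightarrow> joined b w v (i, t) (i + 1, t)"
| turn_after: "\<lbrakk>t < length w; \<not> oriented_at w v t; i = fst (w ! t)\<rbrakk>
     \<Longrightarrow> joined b w v (i, t + 1) (i + 1, t + 1)"

definition circle_of :: "nat \<Rightarrow> braid_word \<Rightarrow> nat set \<Rightarrow> arc \<Rightarrow> arc set" where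
  "circle_of b w v a = {a' \<in> arcs b w. equivclp (joined b w v) a a'}"

definition circles :: "nat \<Rightarrow> braid_word \<Rightarrow> nat set \<Rightarrow> arc set set" where
  "circles b w v = circle_of b w v ` arcs b w"


section \<open>The Khovanov complex\<close>

datatype gen = u_minus | u_plus

fun mult_gen :: "gen \<times> gen \<Rightarrow> gen \<Rightarrow>\<^sub>0 int" where
  "mult_gen (u_plus, u_plus) = frag_of u_plus"
| "mult_gen (u_plus, u_minus) = frag_of u_minus"
| "mult_gen (u_minus, u_plus) = frag_of u_minus"
| "mult_gen (u_minus, u_minus) = 0"

fun comult_gen :: "gen \<Rightarrow> (gen \<times> gen) \<Rightarrow>\<^sub>0 int" where
  "comult_gen u_plus = frag_of (u_plus, u_minus) + frag_of (u_minus, u_plus)"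
| "comult_gen u_minus = frag_of (u_minus, u_minus)"

text \<open>A basis element of \<open>CKh\<close>: a vertex \<open>v\<close> together with a pure tensor of generators, one for
  each circle of the resolution at \<open>v\<close>.\<close>

type_synonym state = "nat set \<times> (arc set \<Rightarrow> gen)"

definition states :: "nat \<Rightarrow> braid_word \<Rightarrow> state set" where
  "states b w = (SIGMA v : Pow {..<length w}. circles b w v \<rightarrow>\<^sub>E UNIV)"

definition CKh :: "nat \<Rightarrow> braid_word \<Rightarrow> (state \<Rightarrow>\<^sub>0 int) monoid" where
  "CKh b w = free_Abelian_group (states b w)"

text \<open>The edge of the cube that starts at \<open>v\<close> and changes the coordinate \<open>t \<notin> v\<close>.  The arcs
  \<open>(i, t)\<close> and \<open>(i + 1, t + 1)\<close> lie on the two different strands of either resolution of the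
  crossing, so the circles through them are exactly the circles taking part in the merge or split;
  every other circle is literally the same set of arcs in both resolutions.\<close>

definition edge_map :: "nat \<Rightarrow> braid_word \<Rightarrow> nat \<Rightarrow> state \<Rightarrow> state \<Rightarrow>\<^sub>0 int" where
  "edge_map b w t = (\<lambda>(v, f).
     let i = fst (w ! t);
         v' = insert t v;
         A = circle_of b w v (i, t);  B = circle_of b w v (i + 1, t + 1);
         A' = circle_of b w v' (i, t);  B' = circle_of b w v' (i + 1, t + 1);
         g = restrict f (circles b w v')
     in if A \<noteq> B
        then frag_extend (\<lambda>x. frag_of (v', g(A' := x))) (mult_gen (f A, f B))
        else frag_extend (\<lambda>(x, y). frag_of (v', g(A' := x, B' := y))) (comult_gen (f A)))"

definition Kh_differential :: "nat \<Rightarrow> braid_word \<Rightarrow> (state \<Rightarrow>\<^sub>0 int) \<Rightarrow> state \<Rightarrow>\<^sub>0 int" where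
  "Kh_differential b w = frag_extend (\<lambda>(v, f).
     \<Sum>t \<in> {..<length w} - v. frag_cmul ((-1) ^ card {s \<in> v. s < t}) (edge_map b w t (v, f)))"

definition Kh_cycles :: "nat \<Rightarrow> braid_word \<Rightarrow> (state \<Rightarrow>\<^sub>0 int) set" where
  "Kh_cycles b w = kernel (CKh b w) (CKh b w) (Kh_differential b w)"

definition Kh_boundaries :: "nat \<Rightarrow> braid_word \<Rightarrow> (state \<Rightarrow>\<^sub>0 int) set" where
  "Kh_boundaries b w = Kh_differential b w ` carrier (CKh b w)"

text \<open>The total homology group, that is, the direct sum of all bigraded pieces.\<close>

definition Kh :: "nat \<Rightarrow> braid_word \<Rightarrow> (state \<Rightarrow>\<^sub>0 int) set monoid" where
  "Kh b w = (CKh b w)\<lparr>carrier := Kh_cycles b w\<rparr> Mod Kh_boundaries b w"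


section \<open>The element \<open>\<psi>\<close>\<close>

definition oriented_vertex :: "braid_word \<Rightarrow> nat set" where
  "oriented_vertex w = {t. t < length w \<and> \<not> snd (w ! t)}"

definition psi_chain :: "nat \<Rightarrow> braid_word \<Rightarrow> state \<Rightarrow>\<^sub>0 int" where
  "psi_chain b w =
     frag_of (oriented_vertex w, \<lambda>C \<in> circles b w (oriented_vertex w). u_minus)"

definition psi :: "nat \<Rightarrow> braid_word \<Rightarrow> (state \<Rightarrow>\<^sub>0 int) set" where
  "psi b w = Kh_boundaries b w #>\<^bsub>CKh b w\<^esub> psi_chain b w"


section \<open>Primitive and non-torsion elements of an abelian group\<close>

definition primitive_element :: "('a, 'm) monoid_scheme \<Rightarrow> 'a \<Rightarrow> bool" where
  "primitive_element A x \<longleftrightarrow>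
     x \<in> carrier A \<and> \<not> (\<exists>y \<in> carrier A. \<exists>k::int. \<bar>k\<bar> \<noteq> 1 \<and> x = y [^]\<^bsub>A\<^esub> k)"

definition non_torsion :: "('a, 'm) monoid_scheme \<Rightarrow> 'a \<Rightarrow> bool" where
  "non_torsion A x \<longleftrightarrow> x \<in> carrier A \<and> (\<forall>k::int. k \<noteq> 0 \<longrightarrow> x [^]\<^bsub>A\<^esub> k \<noteq> \<one>\<^bsub>A\<^esub>)"

end

theory Submission
  imports Defs "HOL-Library.Multiset" "HOL-Library.Function_Algebras"
begin

text \<open>Call a closed braid detected if some integral cocycle of the dual Khovanov complex takes the
  value 1 on \<open>psi_chain\<close>; this makes \<open>psi\<close> primitive and non-torsion.  The closure of the empty
  word is detected.  Inserting a positive letter keeps a closed braid detected, because the oriented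
  resolution of the new crossing is a quotient complex to which the chain restricts correctly.  Hence
  quasipositive braids are detected as soon as detection is invariant under the braid relations, and
  invariance under conjugation and (de)stabilization carries it over to the whole transverse class.
  Invariance is proved by pulling cocycles back along the usual homotopy equivalences.

  Instead of tensor products of circles, the complex at a resolution is \<open>\<int>[X\<^bsub>a\<^esub>]\<close> modulo
  \<open>X\<^bsub>a\<^esub>\<^sup>2 = 0\<close> and \<open>X\<^bsub>a\<^esub> = X\<^bsub>c\<^esub>\<close> for points \<open>a\<close>, \<open>c\<close> of the same circle, with \<open>u_plus = 1\<close> and
  \<open>u_minus = X\<^bsub>a\<^esub>\<close>.  A merge is then the identity on polynomials and a split at the strands of \<open>a\<close>
  and \<open>c\<close> is multiplication by \<open>X\<^bsub>a\<^esub> + X\<^bsub>c\<^esub>\<close>, so that cochains are functions of monomials in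
  the points of the diagram.\<close>

section \<open>Surgery on circles\<close>

text \<open>Cocycles are used because one number settles every claim: if an integral homomorphism
  \<open>h\<close> on homology has value 1 on psi, then psi = k y gives 1 = k h(y), and k psi = 0
  gives k = 0. Invariance only requires moving cocycles and following this value; no homotopies are
  constructed.

  Two obstacles shape the proof. A surgery has to merge two circles or split one, which is a global
  property of planar diagrams. It is obtained by directing odd and even strings oppositely: circles
  become cycles of a permutation, and a surgery multiplies it by a transposition. Secondly, circles
  change with every move, so the tensor factors of two diagrams have no common names. In the
  polynomial model two diagrams are compared through sample points that both contain, and comparison
  maps are mere substitutions of points; circles as sets return only in the final comparison with
  the definitions.

  The coboundary is a recursion on the first letter, so local moves are proved at the front of a
  word, and rotation of the word carries them to every other place.\<close>

type_synonym 'a functional = "'a multiset \<Rightarrow> int"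

text \<open>Circles are the classes of a partial equivalence relation. Its domain is the set of
  points of the diagram, so diagrams with different sets of points live over one type.\<close>

definition per :: "('a \<Rightarrow> 'a \<Rightarrow> bool) \<Rightarrow> bool" where
  "per E \<longleftrightarrow> symp E \<and> transp E"

lemma per_sym: "per E \<Longrightarrow> E a c \<Longrightarrow> E c a"
  by (auto simp: per_def dest: sympD)

lemma per_trans: "per E \<Longrightarrow> E a c \<Longrightarrow> E c d \<Longrightarrow> E a d"
  by (auto simp: per_def dest: transpD)

definition join :: "('a \<Rightarrow> 'a \<Rightarrow> bool) \<Rightarrow> 'a \<Rightarrow> 'a \<Rightarrow> 'a \<Rightarrow> 'a \<Rightarrow> bool" where
  "join E x y = (\<lambda>a c. E a c \<or> E a x \<and> E y c \<or> E a y \<and> E x c)"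

definition merges :: "('a \<Rightarrow> 'a \<Rightarrow> bool) \<Rightarrow> ('a \<Rightarrow> 'a \<Rightarrow> bool) \<Rightarrow> 'a \<Rightarrow> 'a \<Rightarrow> bool" where
  "merges E E' x y \<longleftrightarrow> per E \<and> E x x \<and> E y y \<and> \<not> E x y \<and> E' = join E x y"

text \<open>The two directions of one surgery, with \<open>x\<close> and \<open>y\<close> on the two
  strands involved. A circle turning into a single circle is not provided for; an orientation
  argument excludes it for the diagrams considered here.\<close>

definition edge :: "('a \<Rightarrow> 'a \<Rightarrow> bool) \<Rightarrow> ('a \<Rightarrow> 'a \<Rightarrow> bool) \<Rightarrow> 'a \<Rightarrow> 'a \<Rightarrow> bool" where
  "edge E E' x y \<longleftrightarrow> merges E E' x y \<or> merges E' E x y"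

lemma per_join: "per E \<Longrightarrow> per (join E x y)"
proof -
  assume p: "per E"
  note sym = per_sym [OF p] and trans = per_trans [OF p]
  have "symp (join E x y)"
    unfolding join_def by (rule sympI) (use sym in metis)
  moreover have "transp (join E x y)"
  proof (rule transpI)
    fix a c d assume "join E x y a c" "join E x y c d"
    then have "E a c \<or> E a x \<and> E y c \<or> E a y \<and> E x c"
      and "E c d \<or> E c x \<and> E y d \<or> E c y \<and> E x d"
      by (simp_all add: join_def)
    then show "join E x y a d"
      unfolding join_def
      by (elim disjE conjE) (meson sym trans)+
  qed
  ultimately show ?thesis by (simp add: per_def)
qed

lemma merges_per: "merges E E' x y \<Longrightarrow> per E \<and> per E'"
  by (auto simp: merges_def per_join)

lemma edge_per: "edge E E' x y \<Longrightarrow> per E \<and> per E'"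
  by (auto simp: edge_def dest: merges_per)

lemma edge_sym: "edge E E' x y \<longleftrightarrow> edge E' E x y"
  by (auto simp: edge_def)

lemma merges_mono: "merges E E' x y \<Longrightarrow> E a c \<Longrightarrow> E' a c"
  by (simp add: merges_def join_def)

lemma merges_new: "merges E E' x y \<Longrightarrow> E' x y"
  by (simp add: merges_def join_def)

lemma merges_cases:
  assumes "merges E E' x y" "E' a c" "\<not> E a c"
  shows "E a x \<and> E c y \<or> E a y \<and> E c x"
proof -
  have "per E" "E a x \<and> E y c \<or> E a y \<and> E x c"
    using assms by (auto simp: merges_def join_def)
  then show ?thesis using per_sym by metis
qed

lemma merges_dom: "merges E E' x y \<Longrightarrow> E' a a \<longleftrightarrow> E a a"
proof -
  assume m: "merges E E' x y"
  then have "per E" by (simp add: merges_def)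
  then show ?thesis
    using m per_sym [of E] per_trans [of E] unfolding merges_def join_def by metis
qed

lemma join_cong:
  assumes "per E" "E x x'" "E y y'"
  shows "join E x y = join E x' y'"
proof -
  note sym = per_sym [OF assms(1)] and trans = per_trans [OF assms(1)]
  have "E a x \<longleftrightarrow> E a x'" "E x a \<longleftrightarrow> E x' a" "E a y \<longleftrightarrow> E a y'" "E y a \<longleftrightarrow> E y' a" for a
    using assms(2,3) sym trans by metis+
  then show ?thesis by (simp add: join_def)
qed

lemma join_commute: "join E x y = join E y x"
  unfolding join_def fun_eq_iff by blast

text \<open>A pair that becomes joined has one point on each of the two fused circles, so it can
  replace the original attaching points.\<close>

lemma merges_other:
  assumes "merges E E' x y" "E' a c" "\<not> E a c"
  shows "merges E E' a c"
proof -
  note m = merges_cases [OF assms]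
  have p: "per E" and E': "E' = join E x y" using assms by (auto simp: merges_def)
  have "E' = join E a c"
    using m
  proof
    assume "E a x \<and> E c y"
    then show ?thesis using join_cong [OF p, of a x c y] E' by simp
  next
    assume "E a y \<and> E c x"
    then show ?thesis using join_cong [OF p, of a y c x] E' join_commute [of E x y] by simp
  qed
  moreover have "E a a" "E c c" using m per_sym [OF p] per_trans [OF p] by metis+
  ultimately show ?thesis using assms p by (simp add: merges_def)
qed

text \<open>The transpose of multiplication by \<open>X_a\<close>. All maps of the complex appear in
  transposed form, acting on cochains.\<close>

definition mark :: "'a \<Rightarrow> 'a functional \<Rightarrow> 'a functional" where
  "mark a \<Phi> = (\<lambda>M. \<Phi> (add_mset a M))"

lemma mark_apply: "mark a \<Phi> M = \<Phi> (add_mset a M)"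
  by (simp add: mark_def)

lemma mark_add [simp]: "mark a (\<Phi> + \<Psi>) = mark a \<Phi> + mark a \<Psi>"
  by (simp add: mark_def fun_eq_iff)

lemma mark_diff [simp]: "mark a (\<Phi> - \<Psi>) = mark a \<Phi> - mark a \<Psi>"
  by (simp add: mark_def fun_eq_iff)

lemma mark_minus [simp]: "mark a (- \<Phi>) = - mark a \<Phi>"
  by (simp add: mark_def fun_eq_iff)

lemma mark_zero [simp]: "mark a 0 = 0"
  by (simp add: mark_def fun_eq_iff)

lemma mark_commute: "mark a (mark c \<Phi>) = mark c (mark a \<Phi>)"
  by (simp add: mark_def fun_eq_iff add_mset_commute)

text \<open>These are the functionals vanishing on the ideal of relations. The last clause adds
  \<open>X_a = 0\<close> for points outside the diagram, so that a functional is determined by its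
  values on points of the diagram.\<close>

definition compat :: "('a \<Rightarrow> 'a \<Rightarrow> bool) \<Rightarrow> 'a functional \<Rightarrow> bool" where
  "compat E \<Phi> \<longleftrightarrow> (\<forall>a c. E a c \<longrightarrow> mark a \<Phi> = mark c \<Phi>) \<and> (\<forall>a. mark a (mark a \<Phi>) = 0)
     \<and> (\<forall>a. \<not> E a a \<longrightarrow> mark a \<Phi> = 0)"

lemma compat_eq: "compat E \<Phi> \<Longrightarrow> E a c \<Longrightarrow> mark a \<Phi> = mark c \<Phi>"
  by (simp add: compat_def)

lemma compat_square: "compat E \<Phi> \<Longrightarrow> E a c \<Longrightarrow> mark a (mark c \<Phi>) = 0"
  using compat_def by metis

lemma compat_outside: "compat E \<Phi> \<Longrightarrow> \<not> E a a \<Longrightarrow> mark a \<Phi> = 0"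
  by (simp add: compat_def)

lemma compat_zero [simp]: "compat E 0"
  by (simp add: compat_def)

lemma compat_add: "compat E \<Phi> \<Longrightarrow> compat E \<Psi> \<Longrightarrow> compat E (\<Phi> + \<Psi>)"
  by (simp add: compat_def)

lemma compat_minus: "compat E \<Phi> \<Longrightarrow> compat E (- \<Phi>)"
  by (simp add: compat_def)

lemma compat_diff: "compat E \<Phi> \<Longrightarrow> compat E \<Psi> \<Longrightarrow> compat E (\<Phi> - \<Psi>)"
  by (simp add: compat_def)

lemma compat_mark: "compat E \<Phi> \<Longrightarrow> compat E (mark x \<Phi>)"
  unfolding compat_def by (auto simp: mark_commute [of _ x])

lemma compat_finer:
  assumes "merges E E' x y" "compat E' \<Phi>"
  shows "compat E \<Phi>"
  using assms(2) merges_mono [OF assms(1)] merges_dom [OF assms(1)] unfolding compat_def by blast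

section \<open>Saddle maps on functionals\<close>

definition saddle :: "('a \<Rightarrow> 'a \<Rightarrow> bool) \<Rightarrow> ('a \<Rightarrow> 'a \<Rightarrow> bool) \<Rightarrow> 'a functional \<Rightarrow> 'a functional" where
  "saddle E E' \<Phi> = (if E \<le> E' then \<Phi>
     else let xy = (SOME xy. merges E' E (fst xy) (snd xy)) in mark (fst xy) \<Phi> + mark (snd xy) \<Phi>)"

lemma saddle_merge:
  assumes "edge E E' x y" "E' a c" "\<not> E a c"
  shows "saddle E E' \<Phi> = \<Phi>"
proof -
  have "merges E E' x y" using assms merges_mono [of E' E x y a c] by (auto simp: edge_def)
  then have "E \<le> E'" by (auto simp: merges_mono)
  then show ?thesis by (simp add: saddle_def)
qed

text \<open>This makes the choice by \<open>SOME\<close> in \<open>saddle\<close> harmless: each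
  pair consists of one point from each of the two fused circles, and a compatible functional does
  not distinguish points of one circle. So a saddle depends on the two systems of circles
  alone.\<close>

lemma marks_independent:
  assumes "compat E' \<Phi>" "merges E' E x y" "merges E' E a c"
  shows "mark x \<Phi> + mark y \<Phi> = mark a \<Phi> + mark c \<Phi>"
proof -
  have "E a c" "\<not> E' a c" using assms(3) by (auto simp: merges_def join_def)
  from merges_cases [OF assms(2) this] show ?thesis
    using compat_eq [OF assms(1)] by auto
qed

lemma saddle_split:
  assumes "edge E E' x y" "E a c" "\<not> E' a c" "compat E' \<Phi>"
  shows "saddle E E' \<Phi> = mark a \<Phi> + mark c \<Phi>"
proof -
  have "merges E' E x y" using assms merges_mono [of E E' x y a c] by (auto simp: edge_def)
  then have m: "merges E' E a c" using assms(2,3) by (rule merges_other)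
  have n: "\<not> E \<le> E'" using assms(2,3) by (auto simp: le_fun_def)
  define xy where "xy = (SOME xy. merges E' E (fst xy) (snd xy))"
  have "merges E' E (fst xy) (snd xy)"
    unfolding xy_def by (rule someI [of _ "(a, c)"]) (simp add: m)
  from marks_independent [OF assms(4) this m] show ?thesis
    using n by (simp add: saddle_def xy_def Let_def)
qed

lemma edge_cases:
  assumes "edge E E' x y"
  obtains (merge) "\<not> E x y" "E' x y" "merges E E' x y"
    | (split) "E x y" "\<not> E' x y" "merges E' E x y"
  using assms merges_new [of E E' x y] merges_new [of E' E x y] unfolding edge_def
  by (auto simp: merges_def)

lemma edge_xor: "edge E E' x y \<Longrightarrow> E x y \<longleftrightarrow> \<not> E' x y"
  by (erule edge_cases) auto

lemma saddle_eq:
  assumes "edge E E' x y" "compat E' \<Phi>"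
  shows "saddle E E' \<Phi> = (if E x y then mark x \<Phi> + mark y \<Phi> else \<Phi>)"
  using saddle_merge [OF assms(1), of x y] saddle_split [OF assms(1), of x y] edge_xor [OF assms(1)]
    assms(2) by auto

lemma saddle_zero [simp]: "saddle E E' 0 = 0"
  by (simp add: saddle_def Let_def)

lemma saddle_add: "saddle E E' (\<Phi> + \<Psi>) = saddle E E' \<Phi> + saddle E E' \<Psi>"
  by (simp add: saddle_def Let_def)

lemma saddle_minus: "saddle E E' (- \<Phi>) = - saddle E E' \<Phi>"
  by (simp add: saddle_def Let_def)

lemma saddle_diff: "saddle E E' (\<Phi> - \<Psi>) = saddle E E' \<Phi> - saddle E E' \<Psi>"
  by (simp add: saddle_def Let_def)

lemma saddle_mark: "saddle E E' (mark a \<Phi>) = mark a (saddle E E' \<Phi>)"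
  by (simp add: saddle_def Let_def mark_commute)

text \<open>In the split case \<open>x\<close> and \<open>y\<close> lie on one circle of
  \<open>E\<close>. Multiplication by \<open>X_x + X_y\<close> respects this, since
  \<open>X_x (X_x + X_y) = X_x X_y = X_y (X_x + X_y)\<close> when squares vanish.\<close>

lemma compat_saddle:
  assumes "edge E E' x y" "compat E' \<Phi>"
  shows "compat E (saddle E E' \<Phi>)"
  using assms(1)
proof (cases rule: edge_cases)
  case merge
  then show ?thesis using saddle_eq [OF assms] compat_finer [OF merge(3) assms(2)] by simp
next
  case split
  define \<Psi> where "\<Psi> = mark x \<Phi> + mark y \<Phi>"
  have s: "saddle E E' \<Phi> = \<Psi>"
    using split assms by (simp add: saddle_eq \<Psi>_def)
  have c: "compat E' \<Psi>"
    unfolding \<Psi>_def by (intro compat_add compat_mark assms)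
  have x: "mark x \<Psi> = mark y \<Psi>"
    using assms(2) mark_commute [of x y \<Phi>] by (simp add: compat_def \<Psi>_def)
  show ?thesis
    unfolding s compat_def
  proof (intro conjI allI impI)
    fix a d assume "E a d"
    show "mark a \<Psi> = mark d \<Psi>"
    proof (cases "E' a d")
      case True
      then show ?thesis by (rule compat_eq [OF c])
    next
      case False
      from merges_cases [OF split(3) \<open>E a d\<close> False] show ?thesis
        using compat_eq [OF c, of a] compat_eq [OF c, of d] x by auto
    qed
  next
    show "mark a (mark a \<Psi>) = 0" for a using c by (simp add: compat_def)
  next
    show "mark a \<Psi> = 0" if "\<not> E a a" for a
      using compat_outside [OF c] merges_dom [OF split(3)] that by simp
  qed
qed

text \<open>If neither surgery changes its type when the other one is done first, both sides apply
  the same marks, and marks commute. Otherwise both composites split and then merge, or both merge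
  and then split. Then it remains to compare the sums of marks at \<open>x, y\<close> and at
  \<open>x', y'\<close>, which agree because the two pairs lie on the same circles of
  \<open>E11\<close>.\<close>

lemma saddle_commute:
  assumes "edge E00 E10 x y" "edge E01 E11 x y" "edge E00 E01 x' y'" "edge E10 E11 x' y'"
    and c: "compat E11 \<Phi>"
  shows "saddle E00 E10 (saddle E10 E11 \<Phi>) = saddle E00 E01 (saddle E01 E11 \<Phi>)"
proof -
  have c10: "compat E10 (saddle E10 E11 \<Phi>)" and c01: "compat E01 (saddle E01 E11 \<Phi>)"
    using compat_saddle [OF assms(4,5)] compat_saddle [OF assms(2,5)] by auto
  note outer = saddle_eq [OF assms(1) c10] saddle_eq [OF assms(3) c01]
    and inner = saddle_eq [OF assms(2) c] saddle_eq [OF assms(4) c]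
  have p: "per E00" "per E10" "per E01" "per E11" 
    using edge_per [OF assms(1)] edge_per [OF assms(2)] by auto
  note xs = edge_xor [OF assms(1)] edge_xor [OF assms(2)] edge_xor [OF assms(3)] edge_xor [OF assms(4)]
  have le: "E a d \<Longrightarrow> E' a d" if "edge E E' u v" "\<not> E p q" "E' p q" for E E' :: "'a \<Rightarrow> 'a \<Rightarrow> bool" and u v p q a d
    using that merges_mono [of E E' u v] merges_mono [of E' E u v] by (auto simp: edge_def)
  have ge: "E' a d \<Longrightarrow> E a d" if "edge E E' u v" "E p q" "\<not> E' p q" for E E' :: "'a \<Rightarrow> 'a \<Rightarrow> bool" and u v p q a d
    using that merges_mono [of E E' u v] merges_mono [of E' E u v] by (auto simp: edge_def)
  \<comment> \<open>Dependence of one type on the other surgery is a symmetric condition. Each of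
    the four cases follows from monotonicity: merges keep connections (\<open>le\<close>), splits
    create none (\<open>ge\<close>).\<close>
  have same: "E00 x y = E01 x y \<longleftrightarrow> E00 x' y' = E10 x' y'"
  proof (cases "E00 x y"; cases "E01 x y")
    assume "E00 x y" "E01 x y"
    with xs ge [OF assms(1), of x y x' y'] ge [OF assms(2), of x y x' y'] show ?thesis by blast
  next
    assume "\<not> E00 x y" "\<not> E01 x y"
    with xs le [OF assms(1), of x y x' y'] le [OF assms(2), of x y x' y'] show ?thesis by blast
  next
    assume "E00 x y" "\<not> E01 x y"
    with xs ge [OF assms(3), of x y x' y'] le [OF assms(4), of x y x' y'] show ?thesis by blast
  next
    assume "\<not> E00 x y" "E01 x y"
    with xs le [OF assms(3), of x y x' y'] ge [OF assms(4), of x y x' y'] show ?thesis by blast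
  qed
  show ?thesis
  proof (cases "E00 x y = E01 x y")
    case True
    then show ?thesis using same unfolding outer unfolding inner by (auto simp: mark_commute add_ac)
  next
    case False
    show ?thesis
    proof (cases "E00 x y")
      case True
      with False xs same have v: "E00 x y" "\<not> E01 x y" "\<not> E10 x y" "E11 x y" by auto
      have v': "E00 x' y'" "\<not> E10 x' y'" "E11 x' y'" "\<not> E01 x' y'"
        using ge [OF assms(3) v(1,2), of x' y'] same xs False by blast+
      have "merges E01 E00 x' y'" using assms(3) v' by (auto elim: edge_cases)
      from merges_cases [OF this v(1,2)] have "E11 x x' \<and> E11 y y' \<or> E11 x y' \<and> E11 y x'"
        using le [OF assms(2) v(2,4)] by blast
      then have "mark x \<Phi> + mark y \<Phi> = mark x' \<Phi> + mark y' \<Phi>"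
        using compat_eq [OF c] by auto
      then show ?thesis unfolding outer unfolding inner using v v' by simp
    next
      case False
      with \<open>E00 x y \<noteq> E01 x y\<close> xs have v: "\<not> E00 x y" "E01 x y" "E10 x y" "\<not> E11 x y" by auto
      have v': "\<not> E00 x' y'" "E10 x' y'" "\<not> E11 x' y'" "E01 x' y'"
        using le [OF assms(3) v(1,2), of x' y'] same xs v False by blast+
      have "merges E11 E01 x y" using assms(2) v by (auto elim: edge_cases)
      from merges_cases [OF this v'(4,3)]
      have "mark x \<Phi> + mark y \<Phi> = mark x' \<Phi> + mark y' \<Phi>"
        using compat_eq [OF c] by auto
      then show ?thesis unfolding outer unfolding inner using v v' by simp
    qed
  qed
qed


section \<open>Cubes of functionals\<close>

lemmas pointwise = plus_fun_apply zero_fun_apply uminus_apply minus_apply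

text \<open>Functionals are themselves functions, and the equations below are meant to be used on them
  as a whole.\<close>

declare pointwise [simp del]

text \<open>A flat letter is \<open>None\<close> for the vertical, oriented smoothing and
  \<open>Some i\<close> for the one that turns back on the strings \<open>i\<close> and
  \<open>i + 1\<close>. A negative letter exchanges the two resolutions.\<close>

definition zero_res :: "nat \<times> bool \<Rightarrow> nat option" where
  "zero_res c = (if snd c then None else Some (fst c))"

definition one_res :: "nat \<times> bool \<Rightarrow> nat option" where
  "one_res c = (if snd c then Some (fst c) else None)"

lemma zero_neq_one [simp]: "zero_res c \<noteq> one_res c" "one_res c \<noteq> zero_res c"
  by (auto simp: zero_res_def one_res_def)

type_synonym flat = "nat option list"

definition vertex :: "braid_word \<Rightarrow> flat \<Rightarrow> bool" where
  "vertex w z \<longleftrightarrow> list_all2 (\<lambda>c r. r = zero_res c \<or> r = one_res c) w z"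

lemma vertex_Nil [simp]: "vertex [] z \<longleftrightarrow> z = []"
  by (simp add: vertex_def)

lemma vertex_Cons: "vertex (c # w) z \<longleftrightarrow> (\<exists>r z'. z = r # z' \<and> (r = zero_res c \<or> r = one_res c) \<and> vertex w z')"
  by (auto simp: vertex_def list_all2_Cons1)

lemma vertex_Cons_Cons [simp]:
  "vertex (c # w) (r # z) \<longleftrightarrow> (r = zero_res c \<or> r = one_res c) \<and> vertex w z"
  by (simp add: vertex_def)

lemma vertex_length: "vertex w z \<Longrightarrow> length z = length w"
  by (simp add: vertex_def list_all2_lengthD)

text \<open>The transposed cube differential, with the cube read as the mapping cone of its first
  letter. The minus sign behind a 1-resolved letter accumulates to the usual sign, the parity of the
  1-resolutions in front of the letter that is switched.\<close>

fun delta :: "(flat \<Rightarrow> 'a \<Rightarrow> 'a \<Rightarrow> bool) \<Rightarrow> braid_word \<Rightarrow> (flat \<Rightarrow> 'a functional) \<Rightarrow> flat \<Rightarrow> 'a functional" where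
  "delta E (c # w) \<Phi> (r # z) =
     (if r = zero_res c
      then saddle (E (zero_res c # z)) (E (one_res c # z)) (\<Phi> (one_res c # z))
        + delta (\<lambda>z. E (r # z)) w (\<lambda>z. \<Phi> (r # z)) z
      else - delta (\<lambda>z. E (r # z)) w (\<lambda>z. \<Phi> (r # z)) z)"
| "delta E w \<Phi> z = 0"

text \<open>One pair of attaching points per letter, valid at all vertices. Parallel edges thus have
  the same attaching points, which is the form that \<open>saddle_commute\<close> requires.\<close>

fun cubical :: "(flat \<Rightarrow> 'a \<Rightarrow> 'a \<Rightarrow> bool) \<Rightarrow> braid_word \<Rightarrow> ('a \<times> 'a) list \<Rightarrow> bool" where
  "cubical E [] ps \<longleftrightarrow> ps = []"
| "cubical E (c # w) [] \<longleftrightarrow> False"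
| "cubical E (c # w) (p # ps) \<longleftrightarrow>
     (\<forall>z. vertex w z \<longrightarrow> edge (E (zero_res c # z)) (E (one_res c # z)) (fst p) (snd p))
     \<and> (\<forall>r \<in> {zero_res c, one_res c}. cubical (\<lambda>z. E (r # z)) w ps)"

lemma cubical_ConsE:
  assumes "cubical E (c # w) ps"
  obtains x y qs where "ps = (x, y) # qs"
    "\<And>z. vertex w z \<Longrightarrow> edge (E (zero_res c # z)) (E (one_res c # z)) x y"
    "\<And>r. r = zero_res c \<or> r = one_res c \<Longrightarrow> cubical (\<lambda>z. E (r # z)) w qs"
  using assms by (cases ps) (auto intro: that)

lemma delta_zero: "delta E w (\<lambda>z. 0) z = 0"
  by (induction E w "\<lambda>z::flat. 0::'a functional" z rule: delta.induct) auto

lemma delta_add: "delta E w (\<lambda>z. \<Phi> z + \<Psi> z) z = delta E w \<Phi> z + delta E w \<Psi> z"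
proof (induction w arbitrary: E \<Phi> \<Psi> z)
  case (Cons c w)
  show ?case by (cases z) (auto simp: Cons saddle_add algebra_simps)
qed simp

lemma delta_minus: "delta E w (\<lambda>z. - \<Phi> z) z = - delta E w \<Phi> z"
proof (induction w arbitrary: E \<Phi> z)
  case (Cons c w)
  show ?case by (cases z) (auto simp: Cons saddle_minus algebra_simps)
qed simp

lemma delta_diff: "delta E w (\<lambda>z. \<Phi> z - \<Psi> z) z = delta E w \<Phi> z - delta E w \<Psi> z"
  using delta_add [of E w \<Phi> "\<lambda>z. - \<Psi> z" z] by (simp add: delta_minus)

lemma delta_mark: "delta E w (\<lambda>z. mark a (\<Phi> z)) z = mark a (delta E w \<Phi> z)"
proof (induction w arbitrary: E \<Phi> z)
  case (Cons c w)
  show ?case by (cases z) (auto simp: Cons saddle_mark)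
qed simp

definition compat_family :: "(flat \<Rightarrow> 'a \<Rightarrow> 'a \<Rightarrow> bool) \<Rightarrow> braid_word \<Rightarrow> (flat \<Rightarrow> 'a functional) \<Rightarrow> bool" where
  "compat_family E w \<Phi> \<longleftrightarrow> (\<forall>z. vertex w z \<longrightarrow> compat (E z) (\<Phi> z))"

lemma compat_familyD: "compat_family E w \<Phi> \<Longrightarrow> vertex w z \<Longrightarrow> compat (E z) (\<Phi> z)"
  by (simp add: compat_family_def)

lemma compat_family_Cons:
  "compat_family E (c # w) \<Phi> \<longleftrightarrow>
     (\<forall>r \<in> {zero_res c, one_res c}. compat_family (\<lambda>z. E (r # z)) w (\<lambda>z. \<Phi> (r # z)))"
  by (auto simp: compat_family_def vertex_Cons)

lemma compat_delta:
  assumes "cubical E w ps" "compat_family E w \<Phi>" "vertex w z"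
  shows "compat (E z) (delta E w \<Phi> z)"
  using assms
proof (induction w arbitrary: E \<Phi> z ps)
  case (Cons c w)
  from Cons.prems(3) obtain r z' where z: "z = r # z'" "r = zero_res c \<or> r = one_res c" "vertex w z'"
    by (auto simp: vertex_Cons)
  from Cons.prems(1) obtain x y qs where
    "\<And>z. vertex w z \<Longrightarrow> edge (E (zero_res c # z)) (E (one_res c # z)) x y"
    and q: "\<And>r. r = zero_res c \<or> r = one_res c \<Longrightarrow> cubical (\<lambda>z. E (r # z)) w qs"
    by (erule_tac cubical_ConsE) blast
  then have "compat (E (zero_res c # z')) (saddle (E (zero_res c # z')) (E (one_res c # z')) (\<Phi> (one_res c # z')))"
    using Cons.prems(2) z by (intro compat_saddle) (auto simp: compat_family_def)
  moreover have "compat (E (r # z')) (delta (\<lambda>z. E (r # z)) w (\<lambda>z. \<Phi> (r # z)) z')"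
    using Cons.IH [OF q [OF z(2)] _ z(3)] Cons.prems(2) z by (auto simp: compat_family_Cons)
  ultimately show ?case using z by (auto intro: compat_add compat_minus)
qed simp

text \<open>Changing one letter outside \<open>w\<close> is a further direction of the cube. The
  squares it forms with the letters of \<open>w\<close> commute by \<open>saddle_commute\<close>, so
  the saddle is a cochain map.\<close>

lemma delta_saddle:
  assumes "cubical F w ps" "cubical G w ps" "\<And>z. vertex w z \<Longrightarrow> edge (F z) (G z) x y"
    and "compat_family G w \<Phi>" "vertex w z"
  shows "delta F w (\<lambda>z. saddle (F z) (G z) (\<Phi> z)) z = saddle (F z) (G z) (delta G w \<Phi> z)"
  using assms
proof (induction w arbitrary: F G \<Phi> z ps)
  case (Cons c w)
  from Cons.prems(5) obtain r z' where z: "z = r # z'" "r = zero_res c \<or> r = one_res c" "vertex w z'"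
    by (auto simp: vertex_Cons)
  from Cons.prems(1) obtain p q qs where F: "ps = (p, q) # qs"
    "\<And>z. vertex w z \<Longrightarrow> edge (F (zero_res c # z)) (F (one_res c # z)) p q"
    "\<And>r. r = zero_res c \<or> r = one_res c \<Longrightarrow> cubical (\<lambda>z. F (r # z)) w qs"
    by (erule_tac cubical_ConsE) blast
  have G: "\<And>z. vertex w z \<Longrightarrow> edge (G (zero_res c # z)) (G (one_res c # z)) p q"
    "\<And>r. r = zero_res c \<or> r = one_res c \<Longrightarrow> cubical (\<lambda>z. G (r # z)) w qs"
    using Cons.prems(2) F(1) by auto
  have IH: "delta (\<lambda>z. F (r # z)) w (\<lambda>z. saddle (F (r # z)) (G (r # z)) (\<Phi> (r # z))) z'
      = saddle (F (r # z')) (G (r # z')) (delta (\<lambda>z. G (r # z)) w (\<lambda>z. \<Phi> (r # z)) z')"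
    using Cons.prems(3,4) z
    by (intro Cons.IH [OF F(3) [OF z(2)] G(2) [OF z(2)] _ _ z(3)]) (auto simp: compat_family_Cons)
  have "saddle (F (zero_res c # z')) (F (one_res c # z')) (saddle (F (one_res c # z')) (G (one_res c # z')) (\<Phi> (one_res c # z')))
      = saddle (F (zero_res c # z')) (G (zero_res c # z')) (saddle (G (zero_res c # z')) (G (one_res c # z')) (\<Phi> (one_res c # z')))"
    using Cons.prems(3,4) z
    by (intro saddle_commute [OF F(2) G(1) Cons.prems(3) Cons.prems(3)]) (auto simp: compat_family_def)
  with IH show ?case using z by (auto simp: saddle_add saddle_minus)
qed simp

text \<open>\<open>Q\<close> is a set of sample points that meets every circle of \<open>G\<close>,
  and on \<open>Q\<close> the relation \<open>G\<close> is the pullback of \<open>F\<close> along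
  \<open>f\<close>. Circles of \<open>F\<close> that \<open>f\<close> misses are allowed: they are
  the closed circles that a move removes.\<close>

definition models :: "'a set \<Rightarrow> ('a \<Rightarrow> 'b) \<Rightarrow> ('b \<Rightarrow> 'b \<Rightarrow> bool) \<Rightarrow> ('a \<Rightarrow> 'a \<Rightarrow> bool) \<Rightarrow> bool" where
  "models Q f F G \<longleftrightarrow> per F \<and> per G \<and> (\<forall>a\<in>Q. \<forall>c\<in>Q. G a c \<longleftrightarrow> F (f a) (f c))
     \<and> (\<forall>a. G a a \<longrightarrow> (\<exists>q\<in>Q. G a q))"

definition agrees :: "'a set \<Rightarrow> ('a \<Rightarrow> 'b) \<Rightarrow> 'b functional \<Rightarrow> 'a functional \<Rightarrow> bool" where
  "agrees Q f \<Phi> \<Psi> \<longleftrightarrow> (\<forall>M. set_mset M \<subseteq> Q \<longrightarrow> \<Psi> M = \<Phi> (image_mset f M))"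

lemma compat_image_mset:
  assumes "compat E \<Phi>" "\<And>a. a \<in># M \<Longrightarrow> E a (g a)"
  shows "\<Phi> M = \<Phi> (image_mset g M)"
  using assms
proof (induction M arbitrary: \<Phi>)
  case (add a M)
  have "\<Phi> (add_mset a M) = mark (g a) \<Phi> M"
    using compat_eq [OF add.prems(1), of a "g a"] add.prems(2) by (simp flip: mark_apply)
  also have "\<dots> = mark (g a) \<Phi> (image_mset g M)"
    using add.prems by (intro add.IH compat_mark) auto
  finally show ?case by (simp add: mark_apply)
qed simp

lemma compat_outside_mset:
  assumes "compat E \<Phi>" "a \<in># M" "\<not> E a a"
  shows "\<Phi> M = 0"
proof -
  obtain M' where "M = add_mset a M'" using assms(2) by (metis multi_member_split)
  then show ?thesis using compat_outside [OF assms(1,3)] by (simp add: pointwise flip: mark_apply)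
qed

text \<open>Each point of the diagram can be slid along its circle into \<open>Q\<close>, and a
  point outside the diagram makes both values zero.\<close>

lemma functional_determined:
  assumes "per G" "\<And>a. G a a \<Longrightarrow> \<exists>q\<in>Q. G a q" "compat G \<Phi>" "compat G \<Psi>"
    and "\<And>M. set_mset M \<subseteq> Q \<Longrightarrow> \<Phi> M = \<Psi> M"
  shows "\<Phi> = \<Psi>"
proof
  fix M
  show "\<Phi> M = \<Psi> M"
  proof (cases "\<forall>a \<in># M. G a a")
    case True
    define g where "g a = (SOME q. q \<in> Q \<and> G a q)" for a
    have g: "g a \<in> Q \<and> G a (g a)" if "a \<in># M" for a
      unfolding g_def by (rule someI_ex) (use True that assms(2) in blast)
    then have "\<Phi> M = \<Phi> (image_mset g M)" "\<Psi> M = \<Psi> (image_mset g M)"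
      using compat_image_mset assms(3,4) by metis+
    moreover have "set_mset (image_mset g M) \<subseteq> Q" using g by auto
    ultimately show ?thesis using assms(5) by metis
  next
    case False
    then obtain a where "a \<in># M" "\<not> G a a" by blast
    then show ?thesis using compat_outside_mset [OF assms(3)] compat_outside_mset [OF assms(4)] by simp
  qed
qed

lemma models_determined:
  assumes "models Q f F G" "compat G \<Phi>" "compat G \<Psi>" "agrees Q f \<Theta> \<Phi>" "agrees Q f \<Theta> \<Psi>"
  shows "\<Phi> = \<Psi>"
  by (rule functional_determined [of G Q])
    (use assms in \<open>auto simp: models_def agrees_def\<close>)

text \<open>The transpose of a substitution of variables: every point is replaced by a sample point
  of its circle and then mapped by \<open>f\<close>. Points of \<open>Q\<close> represent
  themselves, so that the result agrees literally with the given functional on monomials in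
  \<open>Q\<close>.\<close>

definition transfer :: "('a \<Rightarrow> 'a \<Rightarrow> bool) \<Rightarrow> 'a set \<Rightarrow> ('a \<Rightarrow> 'b) \<Rightarrow> 'b functional \<Rightarrow> 'a functional" where
  "transfer G Q f \<Phi> = (\<lambda>M. if \<forall>a \<in># M. G a a
     then \<Phi> (image_mset (\<lambda>a. f (if a \<in> Q then a else SOME q. q \<in> Q \<and> G a q)) M) else 0)"

lemma compat_transfer:
  assumes m: "models Q f F G" and "compat F \<Phi>"
  shows "compat G (transfer G Q f \<Phi>)"
proof -
  define g where "g a = (if a \<in> Q then a else SOME q. q \<in> Q \<and> G a q)" for a
  have p: "per F" "per G" using m by (auto simp: models_def)
  have g: "g a \<in> Q" "G a (g a)" if "G a a" for a
  proof -
    have "\<exists>q. q \<in> Q \<and> G a q" using m that by (auto simp: models_def)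
    from someI_ex [OF this] show "g a \<in> Q" "G a (g a)" using that by (auto simp: g_def)
  qed
  have F: "F (f (g a)) (f (g c))" if "G a c" for a c
  proof -
    have ac: "G a a" "G c c" using per_sym [OF p(2) that] per_trans [OF p(2)] that by blast+
    have "G (g a) (g c)"
      using per_trans [OF p(2) per_trans [OF p(2) per_sym [OF p(2) g(2) [OF ac(1)]] that] g(2) [OF ac(2)]] .
    then show ?thesis using m g(1) [OF ac(1)] g(1) [OF ac(2)] by (simp add: models_def)
  qed
  have mk: "mark a (transfer G Q f \<Phi>) = (if G a a then transfer G Q f (mark (f (g a)) \<Phi>) else 0)" for a \<Phi>
    by (auto simp: mark_def transfer_def g_def fun_eq_iff pointwise)
  show ?thesis
    unfolding compat_def
  proof (intro conjI allI impI)
    fix a c assume ac: "G a c"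
    have "G a a" "G c c" using per_sym [OF p(2) ac] per_trans [OF p(2)] ac by blast+
    then show "mark a (transfer G Q f \<Phi>) = mark c (transfer G Q f \<Phi>)"
      using compat_eq [OF assms(2) F [OF ac]] by (simp add: mk)
  next
    show "mark a (mark a (transfer G Q f \<Phi>)) = 0" for a
      using compat_square [OF assms(2) F, of a a] by (auto simp: mk) (simp add: transfer_def fun_eq_iff pointwise)
  qed (simp add: mk)
qed

lemma agrees_transfer:
  assumes "models Q f F G" "compat F \<Phi>"
  shows "agrees Q f \<Phi> (transfer G Q f \<Phi>)"
  unfolding agrees_def
proof (intro allI impI)
  fix M assume M: "set_mset M \<subseteq> Q"
  show "transfer G Q f \<Phi> M = \<Phi> (image_mset f M)"
  proof (cases "\<forall>a \<in># M. G a a")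
    case True
    have "image_mset (\<lambda>a. f (if a \<in> Q then a else SOME q. q \<in> Q \<and> G a q)) M = image_mset f M"
      using M by (intro image_mset_cong) auto
    with True show ?thesis by (simp add: transfer_def)
  next
    case False
    then obtain a where "a \<in># M" "\<not> G a a" by blast
    then have "\<not> F (f a) (f a)" "f a \<in># image_mset f M"
      using assms(1) M by (auto simp: models_def)
    then have "\<Phi> (image_mset f M) = 0" using compat_outside_mset [OF assms(2)] by blast
    with False show ?thesis by (auto simp: transfer_def)
  qed
qed

lemma transfer_unique:
  assumes "models Q f F G" "compat F \<Phi>" "compat G \<Psi>" "agrees Q f \<Phi> \<Psi>"
  shows "transfer G Q f \<Phi> = \<Psi>"
  by (rule models_determined [OF assms(1) compat_transfer [OF assms(1,2)] assms(3)
        agrees_transfer [OF assms(1,2)] assms(4)])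

lemma transfer_zero [simp]: "transfer G Q f 0 = 0"
  by (simp add: transfer_def fun_eq_iff pointwise)

lemma transfer_add: "transfer G Q f (\<Phi> + \<Psi>) = transfer G Q f \<Phi> + transfer G Q f \<Psi>"
  by (simp add: transfer_def fun_eq_iff pointwise)

lemma transfer_minus: "transfer G Q f (- \<Phi>) = - transfer G Q f \<Phi>"
  by (simp add: transfer_def fun_eq_iff pointwise)

lemma transfer_diff: "transfer G Q f (\<Phi> - \<Psi>) = transfer G Q f \<Phi> - transfer G Q f \<Psi>"
  by (simp add: transfer_def fun_eq_iff pointwise)

lemma agrees_add: "agrees Q f \<Phi> \<Psi> \<Longrightarrow> agrees Q f \<Phi>' \<Psi>' \<Longrightarrow> agrees Q f (\<Phi> + \<Phi>') (\<Psi> + \<Psi>')"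
  by (simp add: agrees_def pointwise)

lemma agrees_minus: "agrees Q f \<Phi> \<Psi> \<Longrightarrow> agrees Q f (- \<Phi>) (- \<Psi>)"
  by (simp add: agrees_def pointwise)

lemma agrees_mark: "agrees Q f \<Phi> \<Psi> \<Longrightarrow> a \<in> Q \<Longrightarrow> agrees Q f (mark (f a) \<Phi>) (mark a \<Psi>)"
  by (simp add: agrees_def mark_def)

text \<open>Sample points \<open>u\<close> and \<open>v\<close> are chosen on the circles of the
  attaching points of \<open>G\<close>. Their images show the same change of connection in
  \<open>F\<close>, so both surgeries are merges or both are splits, and in a split the marks
  correspond.\<close>

lemma agrees_saddle:
  assumes e: "edge F1 F2 x y" "edge G1 G2 x' y'"
    and m: "models Q f F1 G1" "models Q f F2 G2"
    and c: "compat F2 \<Phi>" "compat G2 \<Psi>" "agrees Q f \<Phi> \<Psi>"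
  shows "agrees Q f (saddle F1 F2 \<Phi>) (saddle G1 G2 \<Psi>)"
proof -
  have p: "per G1" "per G2" using e edge_per by metis+
  note sym = per_sym [OF p(1)] per_sym [OF p(2)] and trans = per_trans [OF p(1)] per_trans [OF p(2)]
  from e(2) show ?thesis
  proof (cases rule: edge_cases)
    case merge
    from merge(3) have "G1 x' x'" "G1 y' y'" by (auto simp: merges_def)
    then obtain u v where uv: "u \<in> Q" "v \<in> Q" "G1 x' u" "G1 y' v"
      using m(1) unfolding models_def by metis
    then have "G2 x' u" "G2 y' v" using merges_mono [OF merge(3)] by auto
    then have "G2 u v" "\<not> G1 u v" using merge(1,2) uv sym trans by metis+
    then have "F2 (f u) (f v)" "\<not> F1 (f u) (f v)" using m uv by (auto simp: models_def)
    then show ?thesis using saddle_merge [OF e(1)] saddle_merge [OF e(2) merge(2,1)] c(3) by metis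
  next
    case split
    from split(3) have "G2 x' x'" "G2 y' y'" by (auto simp: merges_def)
    then obtain u v where uv: "u \<in> Q" "v \<in> Q" "G2 x' u" "G2 y' v"
      using m(2) unfolding models_def by metis
    then have "G1 x' u" "G1 y' v" using merges_mono [OF split(3)] by auto
    then have s: "G1 u v" "\<not> G2 u v" using split(1,2) uv sym trans by metis+
    then have "F1 (f u) (f v)" "\<not> F2 (f u) (f v)" using m uv by (auto simp: models_def)
    then have "saddle F1 F2 \<Phi> = mark (f u) \<Phi> + mark (f v) \<Phi>"
      using saddle_split [OF e(1)] c(1) by metis
    moreover have "saddle G1 G2 \<Psi> = mark u \<Psi> + mark v \<Psi>"
      using saddle_split [OF e(2) s c(2)] .
    ultimately show ?thesis using uv c(3) by (simp add: agrees_add agrees_mark)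
  qed
qed

lemma saddle_transfer:
  assumes e: "edge F1 F2 x y" "edge G1 G2 x' y'"
    and m: "models Q f F1 G1" "models Q f F2 G2" and c: "compat F2 \<Phi>"
  shows "saddle G1 G2 (transfer G2 Q f \<Phi>) = transfer G1 Q f (saddle F1 F2 \<Phi>)"
  by (rule sym, rule transfer_unique [OF m(1)])
    (use assms in \<open>auto intro: compat_saddle compat_transfer agrees_saddle agrees_transfer\<close>)

lemma agrees_delta:
  assumes "cubical F w ps" "cubical G w qs" "\<And>z. vertex w z \<Longrightarrow> models Q f (F z) (G z)"
    and "compat_family F w \<Phi>" "compat_family G w \<Psi>"
    and "\<And>z. vertex w z \<Longrightarrow> agrees Q f (\<Phi> z) (\<Psi> z)" and "vertex w z"
  shows "agrees Q f (delta F w \<Phi> z) (delta G w \<Psi> z)"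
  using assms
proof (induction w arbitrary: F G \<Phi> \<Psi> z ps qs)
  case Nil
  then show ?case by (simp add: agrees_def pointwise)
next
  case (Cons c w)
  from Cons.prems(7) obtain r z' where z: "z = r # z'" "r = zero_res c \<or> r = one_res c" "vertex w z'"
    by (auto simp: vertex_Cons)
  from Cons.prems(1) obtain p q ps' where F:
    "\<And>z. vertex w z \<Longrightarrow> edge (F (zero_res c # z)) (F (one_res c # z)) p q"
    "\<And>r. r = zero_res c \<or> r = one_res c \<Longrightarrow> cubical (\<lambda>z. F (r # z)) w ps'"
    by (erule_tac cubical_ConsE) blast
  from Cons.prems(2) obtain p' q' qs' where G:
    "\<And>z. vertex w z \<Longrightarrow> edge (G (zero_res c # z)) (G (one_res c # z)) p' q'"
    "\<And>r. r = zero_res c \<or> r = one_res c \<Longrightarrow> cubical (\<lambda>z. G (r # z)) w qs'"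
    by (erule_tac cubical_ConsE) blast
  have "agrees Q f (saddle (F (zero_res c # z')) (F (one_res c # z')) (\<Phi> (one_res c # z')))
      (saddle (G (zero_res c # z')) (G (one_res c # z')) (\<Psi> (one_res c # z')))"
    using Cons.prems(3-6) z
    by (intro agrees_saddle [OF F(1) G(1)]) (auto simp: compat_family_def)
  moreover have "agrees Q f (delta (\<lambda>z. F (r # z)) w (\<lambda>z. \<Phi> (r # z)) z')
      (delta (\<lambda>z. G (r # z)) w (\<lambda>z. \<Psi> (r # z)) z')"
    using Cons.prems(3-6) z
    by (intro Cons.IH [OF F(2) [OF z(2)] G(2) [OF z(2)]]) (auto simp: compat_family_Cons)
  ultimately show ?case using z by (auto intro: agrees_add agrees_minus)
qed

text \<open>Both sides are compatible and agree with the same functional on monomials in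
  \<open>Q\<close>, hence are equal. In this way a planar isotopy yields a cochain map once its
  effect on connections between sample points is known.\<close>

lemma delta_transfer:
  assumes "cubical F w ps" "cubical G w qs" "\<And>z. vertex w z \<Longrightarrow> models Q f (F z) (G z)"
    and "compat_family F w \<Phi>" and "vertex w z"
  shows "delta G w (\<lambda>z. transfer (G z) Q f (\<Phi> z)) z = transfer (G z) Q f (delta F w \<Phi> z)"
proof -
  have "compat_family G w (\<lambda>z. transfer (G z) Q f (\<Phi> z))"
    using assms(3,4) by (auto simp: compat_family_def intro: compat_transfer)
  then show ?thesis
    using assms
    by (intro sym [OF transfer_unique [OF assms(3) [OF assms(5)]]] compat_delta agrees_delta)
      (auto intro: agrees_transfer compat_familyD)
qed

text \<open>Tensoring a functional with the one on a separate circle \<open>C\<close> that reads off the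
  coefficient of \<open>u_minus\<close>.\<close>

definition add_circle :: "'a set \<Rightarrow> 'a functional \<Rightarrow> 'a functional" where
  "add_circle C \<Phi> = (\<lambda>M. if size (filter_mset (\<lambda>a. a \<in> C) M) = 1
     then \<Phi> (filter_mset (\<lambda>a. a \<notin> C) M) else 0)"

text \<open>\<open>C\<close> is a whole circle of \<open>F\<close>, and away from \<open>C\<close>
  the two relations coincide. There are two uses: in \<open>G\<close> the points of \<open>C\<close>
  are absent, or they are absorbed into another circle.\<close>

definition extra_circle :: "'a set \<Rightarrow> ('a \<Rightarrow> 'a \<Rightarrow> bool) \<Rightarrow> ('a \<Rightarrow> 'a \<Rightarrow> bool) \<Rightarrow> bool" where
  "extra_circle C F G \<longleftrightarrow> (\<forall>a\<in>C. \<forall>c. F a c \<longleftrightarrow> c \<in> C)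
     \<and> (\<forall>a c. a \<notin> C \<longrightarrow> c \<notin> C \<longrightarrow> (F a c \<longleftrightarrow> G a c))"

lemma mark_add_circle: "a \<notin> C \<Longrightarrow> mark a (add_circle C \<Phi>) = add_circle C (mark a \<Phi>)"
  by (simp add: mark_def add_circle_def fun_eq_iff)

lemma mark_add_circle_in:
  "a \<in> C \<Longrightarrow> mark a (add_circle C \<Phi>) M = (if \<forall>c \<in># M. c \<notin> C then \<Phi> M else 0)"
proof -
  assume a: "a \<in> C"
  have "filter_mset (\<lambda>a. a \<notin> C) M = M" if "\<forall>c \<in># M. c \<notin> C"
    using that by (simp add: filter_mset_eq_conv)
  moreover have "size (filter_mset (\<lambda>a. a \<in> C) M) = 0 \<longleftrightarrow> (\<forall>c \<in># M. c \<notin> C)"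
    unfolding size_eq_0_iff_empty by auto
  ultimately show ?thesis using a by (simp add: mark_def add_circle_def)
qed

lemma add_circle_zero [simp]: "add_circle C 0 = 0"
  by (simp add: add_circle_def fun_eq_iff pointwise)

lemma add_circle_add: "add_circle C (\<Phi> + \<Psi>) = add_circle C \<Phi> + add_circle C \<Psi>"
  by (simp add: add_circle_def fun_eq_iff pointwise)

lemma add_circle_minus: "add_circle C (- \<Phi>) = - add_circle C \<Phi>"
  by (simp add: add_circle_def fun_eq_iff pointwise)

lemma compat_add_circle:
  assumes x: "extra_circle C F G" and c: "compat G \<Phi>" and p: "per F"
  shows "compat F (add_circle C \<Phi>)"
  unfolding compat_def
proof (intro conjI allI impI)
  fix a c assume F: "F a c"
  have "a \<in> C \<longleftrightarrow> c \<in> C" using x F per_sym [OF p F] unfolding extra_circle_def by blast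
  then consider "a \<in> C" "c \<in> C" | "a \<notin> C" "c \<notin> C" by blast
  then show "mark a (add_circle C \<Phi>) = mark c (add_circle C \<Phi>)"
  proof cases
    case 1
    then show ?thesis by (simp add: mark_add_circle_in fun_eq_iff)
  next
    case 2
    then have "G a c" using x F by (simp add: extra_circle_def)
    with 2 show ?thesis using compat_eq [OF c] by (simp add: mark_add_circle)
  qed
next
  fix a
  show "mark a (mark a (add_circle C \<Phi>)) = 0"
  proof (cases "a \<in> C")
    case True
    then show ?thesis by (auto simp: mark_add_circle_in mark_apply [of a "mark a (add_circle C \<Phi>)"] fun_eq_iff pointwise)
  next
    case False
    then show ?thesis using c by (simp add: mark_add_circle compat_def)
  qed
next
  fix a assume "\<not> F a a"
  then have "a \<notin> C" "\<not> G a a" using x by (auto simp: extra_circle_def)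
  then show "mark a (add_circle C \<Phi>) = 0" using compat_outside [OF c] by (simp add: mark_add_circle)
qed

lemma saddle_add_circle:
  assumes e: "edge F1 F2 x y" "edge G1 G2 x' y'"
    and m: "extra_circle C F1 G1" "extra_circle C F2 G2" and c: "compat G2 \<Phi>"
  shows "saddle F1 F2 (add_circle C \<Phi>) = add_circle C (saddle G1 G2 \<Phi>)"
proof -
  have p: "per F1" "per F2" using edge_per [OF e(1)] by auto
  \<comment> \<open>\<open>C\<close> is a full circle before and after the surgery, whereas the
    surgery changes the connection between \<open>x\<close> and \<open>y\<close>; so it does not
    touch \<open>C\<close>.\<close>
  have C: "x \<notin> C" "y \<notin> C"
  proof -
    have "F1 x y \<longleftrightarrow> \<not> F2 x y" using e(1) by (rule edge_xor)
    then show "x \<notin> C" "y \<notin> C"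
      using m per_sym [OF p(1), of x y] per_sym [OF p(2), of x y] per_sym [OF p(1), of y x] per_sym [OF p(2), of y x]
      unfolding extra_circle_def by blast+
  qed
  from e(1) show ?thesis
  proof (cases rule: edge_cases)
    case merge
    then have "G2 x y" "\<not> G1 x y" using m C by (auto simp: extra_circle_def)
    then show ?thesis using saddle_merge [OF e(1) merge(2,1)] saddle_merge [OF e(2)] by simp
  next
    case split
    then have g: "G1 x y" "\<not> G2 x y" using m C by (auto simp: extra_circle_def)
    have "compat F2 (add_circle C \<Phi>)" using compat_add_circle [OF m(2) c p(2)] .
    then show ?thesis
      using saddle_split [OF e(1) split(1,2)] saddle_split [OF e(2) g c] C
      by (simp add: mark_add_circle add_circle_add)
  qed
qed

lemma delta_add_circle:
  assumes "cubical F w ps" "cubical G w qs" "\<And>z. vertex w z \<Longrightarrow> extra_circle C (F z) (G z)"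
    and "compat_family G w \<Phi>" and "vertex w z"
  shows "delta F w (\<lambda>z. add_circle C (\<Phi> z)) z = add_circle C (delta G w \<Phi> z)"
  using assms
proof (induction w arbitrary: F G \<Phi> z ps qs)
  case (Cons c w)
  from Cons.prems(5) obtain r z' where z: "z = r # z'" "r = zero_res c \<or> r = one_res c" "vertex w z'"
    by (auto simp: vertex_Cons)
  from Cons.prems(1) obtain p q ps' where F:
    "\<And>z. vertex w z \<Longrightarrow> edge (F (zero_res c # z)) (F (one_res c # z)) p q"
    "\<And>r. r = zero_res c \<or> r = one_res c \<Longrightarrow> cubical (\<lambda>z. F (r # z)) w ps'"
    by (erule_tac cubical_ConsE) blast
  from Cons.prems(2) obtain p' q' qs' where G:
    "\<And>z. vertex w z \<Longrightarrow> edge (G (zero_res c # z)) (G (one_res c # z)) p' q'"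
    "\<And>r. r = zero_res c \<or> r = one_res c \<Longrightarrow> cubical (\<lambda>z. G (r # z)) w qs'"
    by (erule_tac cubical_ConsE) blast
  have "saddle (F (zero_res c # z')) (F (one_res c # z')) (add_circle C (\<Phi> (one_res c # z')))
      = add_circle C (saddle (G (zero_res c # z')) (G (one_res c # z')) (\<Phi> (one_res c # z')))"
    using Cons.prems(3,4) z
    by (intro saddle_add_circle [OF F(1) G(1)]) (auto simp: compat_family_def)
  moreover have "delta (\<lambda>z. F (r # z)) w (\<lambda>z. add_circle C (\<Phi> (r # z))) z'
      = add_circle C (delta (\<lambda>z. G (r # z)) w (\<lambda>z. \<Phi> (r # z)) z')"
    using Cons.prems(3,4) z
    by (intro Cons.IH [OF F(2) [OF z(2)] G(2) [OF z(2)]]) (auto simp: compat_family_Cons)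
  ultimately show ?case using z by (auto simp: add_circle_add add_circle_minus)
qed simp

lemma split_off_circle:
  assumes m: "merges F G p a" and p: "p \<in> C" "\<And>c. F p c \<longleftrightarrow> c \<in> C"
  shows "extra_circle C F G"
proof -
  have f: "per F" "G = join F p a" "\<not> F p a" using m by (auto simp: merges_def)
  have 1: "F a c \<longleftrightarrow> c \<in> C" if "a \<in> C" for a c
    using that p per_sym [OF f(1)] per_trans [OF f(1)] by metis
  moreover have "F b c \<longleftrightarrow> G b c" if "b \<notin> C" "c \<notin> C" for b c
    using that p(2) per_sym [OF f(1), of b p] unfolding f(2) join_def by blast
  ultimately show ?thesis by (simp add: extra_circle_def)
qed

text \<open>The counit law of the Frobenius algebra: comultiplying and then reading off the
  coefficient of \<open>u_minus\<close> on the new circle is the identity.\<close>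

lemma saddle_off_circle:
  assumes e: "edge G F x y" and x: "extra_circle C F G" and p: "p \<in> C" "a \<notin> C" "G p a"
    and c: "compat G \<Phi>"
  shows "saddle G F (add_circle C \<Phi>) = \<Phi>"
proof -
  have per: "per F" "per G" using edge_per [OF e] by auto
  have F: "\<not> F p a" using x p by (auto simp: extra_circle_def)
  have "saddle G F (add_circle C \<Phi>) = mark p (add_circle C \<Phi>) + mark a (add_circle C \<Phi>)"
    by (rule saddle_split [OF e p(3) F compat_add_circle [OF x c per(1)]])
  also have "\<dots> = \<Phi>"
  proof
    fix M
    define N where "N = filter_mset (\<lambda>a. a \<notin> C) M"
    define K where "K = filter_mset (\<lambda>a. a \<in> C) M"
    have M: "M = K + N" unfolding K_def N_def by (rule multiset_partition)
    have KO: "set_mset K \<subseteq> C" by (auto simp: K_def)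
    have GO: "G u v" if "u \<in> C" "v \<in> C" for u v
    proof -
      have "F u v" using that x by (simp add: extra_circle_def)
      moreover have "merges F G x y"
        using e F p(3) merges_mono [of G F x y p a] by (auto simp: edge_def)
      ultimately show ?thesis by (rule merges_mono [rotated])
    qed
    have a: "mark a (add_circle C \<Phi>) M = (if size K = 1 then \<Phi> (add_mset a N) else 0)"
      using p(2) by (simp add: mark_add_circle add_circle_def K_def N_def mark_apply)
    have b: "mark p (add_circle C \<Phi>) M = (if K = {#} then \<Phi> M else 0)"
      unfolding mark_add_circle_in [OF p(1)] K_def by auto
    \<comment> \<open>The cases count the factors on \<open>C\<close>. With none, only the mark at
      \<open>p\<close> contributes. With one, only the mark at \<open>a\<close> does, and the factor
      itself may be slid to \<open>a\<close> along the circle of \<open>G\<close>. With two, both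
      marks give 0, and so does \<open>\<Phi>\<close>, as \<open>C\<close> lies on a single circle
      of \<open>G\<close>.\<close>
    consider "K = {#}" | u where "K = {#u#}" | u v K' where "K = add_mset u (add_mset v K')"
      by (metis multiset_cases)
    then show "(mark p (add_circle C \<Phi>) + mark a (add_circle C \<Phi>)) M = \<Phi> M"
    proof cases
      case 1
      then show ?thesis unfolding plus_fun_apply a b by simp
    next
      case (2 u)
      then have "G u a" using KO GO p per_trans [OF per(2)] by (metis insert_subset set_mset_add_mset_insert)
      then have "\<Phi> (add_mset a N) = \<Phi> (add_mset u N)"
        using compat_eq [OF c] by (simp flip: mark_apply)
      then show ?thesis using 2 M unfolding plus_fun_apply a b by simp
    next
      case (3 u v K')
      then have "G u v" using KO GO by simp
      then have "\<Phi> M = 0" using compat_square [OF c, of v u] per_sym [OF per(2)] 3 M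
        by (simp add: pointwise flip: mark_apply)
      then show ?thesis using 3 by (simp add: a b pointwise)
    qed
  qed
  finally show ?thesis .
qed


section \<open>Circles of flat diagrams\<close>

lemma edge_other:
  assumes "edge E E' u v" "E x y \<longleftrightarrow> E u v" "E' x y \<longleftrightarrow> E' u v"
  shows "edge E E' x y"
  using assms(1)
proof (cases rule: edge_cases)
  case merge
  then show ?thesis using merges_other [OF merge(3), of x y] assms(2,3) by (simp add: edge_def)
next
  case split
  then show ?thesis using merges_other [OF split(3), of x y] assms(2,3) by (simp add: edge_def)
qed

section \<open>Cycles of a permutation multiplied by a transposition\<close>

definition orbits :: "'a set \<Rightarrow> ('a \<Rightarrow> 'a) \<Rightarrow> 'a \<Rightarrow> 'a \<Rightarrow> bool" where
  "orbits S \<pi> a c \<longleftrightarrow> a \<in> S \<and> c \<in> S \<and> equivclp (\<lambda>u v. u \<in> S \<and> v = \<pi> u) a c"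

lemma per_equivclp: "per (\<lambda>a c. a \<in> S \<and> c \<in> S \<and> equivclp R a c)"
  unfolding per_def
proof
  show "symp (\<lambda>a c. a \<in> S \<and> c \<in> S \<and> equivclp R a c)"
    by (rule sympI) (auto intro: equivclp_sym)
  show "transp (\<lambda>a c. a \<in> S \<and> c \<in> S \<and> equivclp R a c)"
    by (rule transpI) (auto elim: equivclp_trans)
qed

lemma per_orbits: "per (orbits S \<pi>)"
  unfolding orbits_def [abs_def] by (rule per_equivclp)

lemma orbits_refl: "a \<in> S \<Longrightarrow> orbits S \<pi> a a"
  by (simp add: orbits_def)

lemma orbits_step: "a \<in> S \<Longrightarrow> \<pi> a \<in> S \<Longrightarrow> orbits S \<pi> a (\<pi> a)"
  by (simp add: orbits_def r_into_equivclp)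

lemma orbits_le:
  assumes "per E" "\<And>a. a \<in> S \<Longrightarrow> E a a" "\<And>a. a \<in> S \<Longrightarrow> E a (\<pi> a)" "orbits S \<pi> a c"
  shows "E a c"
proof -
  from assms(4) have "equivclp (\<lambda>u v. u \<in> S \<and> v = \<pi> u) a c" "a \<in> S" by (auto simp: orbits_def)
  then show ?thesis
  proof (induction rule: equivclp_induct)
    case (step y z)
    then have "E y z" using assms(3) per_sym [OF assms(1)] by blast
    with step show ?case using per_trans [OF assms(1)] by blast
  qed (use assms(2) in simp)
qed

text \<open>On a finite set an injective map that sends \<open>D\<close> into \<open>D\<close>
  permutes \<open>D\<close>, so predecessors of points of \<open>D\<close> belong to
  \<open>D\<close> as well.\<close>

lemma orbits_closed:
  assumes "finite S" "inj_on \<pi> S" "D \<subseteq> S" "\<pi> ` D \<subseteq> D" "orbits S \<pi> a c" "a \<in> D"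
  shows "c \<in> D"
proof -
  have "finite D" using assms(1,3) finite_subset by blast
  moreover have "inj_on \<pi> D" using assms(2,3) inj_on_subset by blast
  ultimately have D: "\<pi> ` D = D" using assms(4) by (simp add: endo_inj_surj)
  from assms(5) have "equivclp (\<lambda>u v. u \<in> S \<and> v = \<pi> u) a c" by (simp add: orbits_def)
  then show ?thesis
  proof (induction rule: equivclp_induct)
    case (step y z)
    then consider "z = \<pi> y" | "z \<in> S" "y = \<pi> z" by blast
    then show ?case
    proof cases
      case 1
      then show ?thesis using D step by blast
    next
      case 2
      then obtain d where "d \<in> D" "\<pi> d = \<pi> z" using D step by (metis imageE)
      then show ?thesis using 2 assms(2,3) by (metis inj_onD subsetD)
    qed
  qed (use assms(6) in simp)
qed

text \<open>\<open>\<rho>\<close> is \<open>\<pi>\<close> composed with the transposition of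
  \<open>x\<close> and \<open>y\<close>. Such a product joins two cycles or cuts one in two, which
  is the reason why every surgery is a merge or a split.\<close>

locale turned =
  fixes S :: "'a set" and \<pi> \<rho> :: "'a \<Rightarrow> 'a" and x y :: 'a
  assumes fin: "finite S" and \<pi>: "inj_on \<pi> S" "\<pi> ` S \<subseteq> S" and \<rho>: "inj_on \<rho> S" "\<rho> ` S \<subseteq> S"
    and xy: "x \<in> S" "y \<in> S" "x \<noteq> y" "\<rho> x = \<pi> y" "\<rho> y = \<pi> x"
    and other: "\<And>u. u \<in> S \<Longrightarrow> u \<noteq> x \<Longrightarrow> u \<noteq> y \<Longrightarrow> \<rho> u = \<pi> u"
begin

lemma swap: "turned S \<rho> \<pi> x y"
  by unfold_locales (use fin \<pi> \<rho> xy other in auto)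

lemma step\<pi>: "u \<in> S \<Longrightarrow> orbits S \<pi> u (\<pi> u)" and step\<rho>: "u \<in> S \<Longrightarrow> orbits S \<rho> u (\<rho> u)"
  using \<pi> \<rho> by (auto intro: orbits_step)

text \<open>Suppose \<open>x\<close> and \<open>y\<close> were separate for \<open>\<rho>\<close>
  too. Starting from \<open>\<rho> x = \<pi> y\<close>, the two permutations then take the same
  steps along the \<open>\<pi>\<close>-cycle of \<open>y\<close>, and this cycle returns to
  \<open>y\<close>, which puts \<open>y\<close> on the \<open>\<rho>\<close>-cycle of
  \<open>x\<close>.\<close>

lemma joins_if_separate:
  assumes "\<not> orbits S \<pi> x y"
  shows "orbits S \<rho> x y"
proof (rule ccontr)
  assume n: "\<not> ?thesis"
  define D where "D = {c. orbits S \<rho> x c \<and> orbits S \<pi> y c}"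
  have D: "D \<subseteq> S" by (auto simp: D_def orbits_def)
  have "\<pi> ` D \<subseteq> D"
  proof
    fix d assume "d \<in> \<pi> ` D"
    then obtain c where c: "d = \<pi> c" "orbits S \<rho> x c" "orbits S \<pi> y c" "c \<in> S"
      using D by (auto simp: D_def)
    have "c \<noteq> x" "c \<noteq> y" using c n assms per_sym [OF per_orbits] by metis+
    then have "\<rho> c = \<pi> c" using other c by blast
    then show "d \<in> D"
      using c step\<pi> [OF c(4)] step\<rho> [OF c(4)] per_trans [OF per_orbits] unfolding D_def by fastforce
  qed
  moreover have "\<pi> y \<in> D"
    using step\<pi> [OF xy(2)] step\<rho> [OF xy(1)] xy by (simp add: D_def)
  moreover have "orbits S \<pi> (\<pi> y) y" using step\<pi> [OF xy(2)] per_sym [OF per_orbits] by metis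
  ultimately have "y \<in> D" using orbits_closed [OF fin \<pi>(1) D] by blast
  then show False using n by (simp add: D_def)
qed

text \<open>Follow \<open>\<pi>\<close> from \<open>x\<close> until it first meets \<open>y\<close>.
  The points after \<open>x\<close> up to and including \<open>y\<close> are mapped to themselves by
  \<open>\<rho>\<close>, because \<open>\<rho> y = \<pi> x\<close>; this set contains
  \<open>y\<close> but not \<open>x\<close>.\<close>

lemma separates_if_joined:
  assumes "orbits S \<pi> x y"
  shows "\<not> orbits S \<rho> x y"
proof -
  have S: "(\<pi> ^^ j) x \<in> S" for j by (induction j) (use xy \<pi> in auto)
  have "y \<in> (\<lambda>j. (\<pi> ^^ j) x) ` UNIV"
  proof (rule orbits_closed [OF fin \<pi>(1) _ _ assms])
    show "\<pi> ` range (\<lambda>j. (\<pi> ^^ j) x) \<subseteq> range (\<lambda>j. (\<pi> ^^ j) x)"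
    proof clarify
      show "\<pi> ((\<pi> ^^ j) x) \<in> range (\<lambda>j. (\<pi> ^^ j) x)" for j by (rule range_eqI [of _ _ "Suc j"]) simp
    qed
    show "x \<in> range (\<lambda>j. (\<pi> ^^ j) x)" by (rule range_eqI [of _ _ 0]) simp
  qed (use S in auto)
  then have ex: "\<exists>k. (\<pi> ^^ k) x = y" by auto
  define k where "k = (LEAST k. (\<pi> ^^ k) x = y)"
  have k: "(\<pi> ^^ k) x = y" unfolding k_def using ex by (rule LeastI_ex)
  have min: "(\<pi> ^^ j) x \<noteq> y" if "j < k" for j using that not_less_Least unfolding k_def by blast
  have k0: "k > 0" using k xy by (cases k) auto
  \<comment> \<open>An earlier return to \<open>x\<close> would shorten the way to \<open>y\<close>
    and contradict the minimality of \<open>k\<close>.\<close>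
  have nx: "(\<pi> ^^ j) x \<noteq> x" if "0 < j" "j \<le> k" for j
  proof
    assume j: "(\<pi> ^^ j) x = x"
    have "(\<pi> ^^ (k - j)) x = (\<pi> ^^ (k - j)) ((\<pi> ^^ j) x)" by (simp add: j)
    also have "\<dots> = (\<pi> ^^ k) x" using that by (simp flip: funpow_add comp_apply [of "\<pi> ^^ (k - j)"])
    finally show False using k min [of "k - j"] that by simp
  qed
  define D where "D = (\<lambda>j. (\<pi> ^^ j) x) ` {1..k}"
  have "\<rho> ` D \<subseteq> D"
  proof
    fix d assume "d \<in> \<rho> ` D"
    then obtain j where j: "1 \<le> j" "j \<le> k" "d = \<rho> ((\<pi> ^^ j) x)" by (auto simp: D_def)
    show "d \<in> D"
    proof (cases "j = k")
      case True
      then have "d = (\<pi> ^^ 1) x" using j k xy by simp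
      then show ?thesis using k0 unfolding D_def by (intro image_eqI [of _ _ 1]) auto
    next
      case False
      then have "d = (\<pi> ^^ Suc j) x" using j other [OF S] nx [of j] min [of j] by simp
      then show ?thesis using False j unfolding D_def by (intro image_eqI [of _ _ "Suc j"]) auto
    qed
  qed
  moreover have "D \<subseteq> S" unfolding D_def using S by blast
  moreover have "y \<in> D" unfolding D_def using k k0 by (intro image_eqI [of _ _ k]) simp_all
  moreover have "x \<notin> D"
  proof
    assume "x \<in> D"
    then obtain j where "j \<in> {1..k}" "x = (\<pi> ^^ j) x" unfolding D_def by (rule imageE)
    then show False using nx [of j] by simp
  qed
  ultimately have "\<not> orbits S \<rho> y x" using orbits_closed [OF fin \<rho>(1), of D y x] by blast
  then show ?thesis using per_sym [OF per_orbits, of S \<rho> x y] by (rule contrapos_nn)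
qed

lemma merges_orbits:
  assumes "\<not> orbits S \<pi> x y"
  shows "merges (orbits S \<pi>) (orbits S \<rho>) x y"
proof -
  have j: "orbits S \<rho> x y" using joins_if_separate assms .
  note sym = per_sym [OF per_orbits] and trans = per_trans [OF per_orbits]
  have a: "orbits S \<rho> u c" if "orbits S \<pi> u c" for u c
  proof (rule orbits_le [OF per_orbits _ _ that])
    fix u assume u: "u \<in> S"
    then show "orbits S \<rho> u u" by (rule orbits_refl)
    consider "u = x" | "u = y" | "u \<noteq> x" "u \<noteq> y" by blast
    then show "orbits S \<rho> u (\<pi> u)"
    proof cases
      case 1
      then show ?thesis using trans [OF j step\<rho> [OF xy(2)]] xy by simp
    next
      case 2
      then show ?thesis using trans [OF sym [OF j] step\<rho> [OF xy(1)]] xy by simp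
    next
      case 3
      then show ?thesis using step\<rho> [OF u] other [OF u] by simp
    qed
  qed
  have b: "join (orbits S \<pi>) x y u c" if "orbits S \<rho> u c" for u c
  proof (rule orbits_le [OF per_join [OF per_orbits] _ _ that])
    fix u assume u: "u \<in> S"
    then show "join (orbits S \<pi>) x y u u" by (simp add: join_def orbits_refl)
    consider "u = x" | "u = y" | "u \<noteq> x" "u \<noteq> y" by blast
    then show "join (orbits S \<pi>) x y u (\<rho> u)"
    proof cases
      case 1
      then have "orbits S \<pi> u x" "orbits S \<pi> y (\<rho> u)"
        using step\<pi> [OF xy(2)] orbits_refl [OF xy(1)] xy(4) by simp_all
      then show ?thesis by (simp add: join_def)
    next
      case 2
      then have "orbits S \<pi> u y" "orbits S \<pi> x (\<rho> u)"
        using step\<pi> [OF xy(1)] orbits_refl [OF xy(2)] xy(5) by simp_all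
      then show ?thesis by (simp add: join_def)
    next
      case 3
      then have "orbits S \<pi> u (\<rho> u)" using step\<pi> [OF u] other [OF u] by simp
      then show ?thesis by (simp add: join_def)
    qed
  qed
  have "orbits S \<rho> u c" if "join (orbits S \<pi>) x y u c" for u c
    using that unfolding join_def
  proof (elim disjE conjE)
    assume "orbits S \<pi> u x" "orbits S \<pi> y c"
    from trans [OF trans [OF a [OF this(1)] j] a [OF this(2)]] show ?thesis .
  next
    assume "orbits S \<pi> u y" "orbits S \<pi> x c"
    from trans [OF trans [OF a [OF this(1)] sym [OF j]] a [OF this(2)]] show ?thesis .
  qed (rule a)
  with b have "orbits S \<rho> = join (orbits S \<pi>) x y" by (intro ext) blast
  then show ?thesis using assms xy by (simp add: merges_def per_orbits orbits_refl)
qed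

lemma edge_orbits: "edge (orbits S \<pi>) (orbits S \<rho>) x y"
proof (cases "orbits S \<pi> x y")
  case True
  interpret s: turned S \<rho> \<pi> x y by (rule swap)
  show ?thesis using s.merges_orbits separates_if_joined [OF True] by (simp add: edge_def)
qed (simp add: edge_def merges_orbits)

end

text \<open>In a flat diagram \<open>z\<close> the point \<open>(p, l)\<close> lies on string position \<open>p\<close>, with \<open>l\<close> letters of
  \<open>z\<close> still to come.  Counting levels from the end keeps the points of \<open>z\<close> fixed
  when letters are put in front of it.\<close>

type_synonym point = "nat \<times> nat"

definition points :: "nat \<Rightarrow> nat \<Rightarrow> point set" where
  "points b n = {1..b} \<times> {0..n}"

definition flats :: "nat \<Rightarrow> flat set" where
  "flats b = {z. \<forall>i. Some i \<in> set z \<longrightarrow> 1 \<le> i \<and> i < b}"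

text \<open>A letter with \<open>l\<close> letters behind it lies between the levels
  \<open>Suc l\<close> and \<open>l\<close>. Each strand is listed in one direction only;
  \<open>conn\<close> symmetrizes.\<close>

definition letter_link :: "nat \<Rightarrow> nat option \<Rightarrow> nat \<Rightarrow> point \<Rightarrow> point \<Rightarrow> bool" where
  "letter_link b r l a c \<longleftrightarrow>
     (\<exists>p \<in> {1..b}. r \<noteq> Some p \<and> (\<forall>i. p = Suc i \<longrightarrow> r \<noteq> Some i) \<and> a = (p, Suc l) \<and> c = (p, l))
     \<or> (\<exists>i. r = Some i \<and> (a = (i, Suc l) \<and> c = (Suc i, Suc l) \<or> a = (i, l) \<and> c = (Suc i, l)))"

fun strands :: "nat \<Rightarrow> flat \<Rightarrow> point \<Rightarrow> point \<Rightarrow> bool" where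
  "strands b [] a c \<longleftrightarrow> False"
| "strands b (r # z) a c \<longleftrightarrow> letter_link b r (length z) a c \<or> strands b z a c"

definition link :: "nat \<Rightarrow> flat \<Rightarrow> point \<Rightarrow> point \<Rightarrow> bool" where
  "link b z a c \<longleftrightarrow> strands b z a c \<or> (\<exists>p \<in> {1..b}. a = (p, length z) \<and> c = (p, 0))"

definition conn :: "nat \<Rightarrow> flat \<Rightarrow> point \<Rightarrow> point \<Rightarrow> bool" where
  "conn b z a c \<longleftrightarrow> a \<in> points b (length z) \<and> c \<in> points b (length z) \<and> equivclp (link b z) a c"

lemma per_conn: "per (conn b z)"
  unfolding conn_def [abs_def] by (rule per_equivclp)

lemmas conn_sym = per_sym [OF per_conn] and conn_trans = per_trans [OF per_conn]

lemma conn_points: "conn b z a c \<Longrightarrow> a \<in> points b (length z) \<and> c \<in> points b (length z)"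
  by (simp add: conn_def)

lemma conn_refl: "a \<in> points b (length z) \<Longrightarrow> conn b z a a"
  by (simp add: conn_def)

lemma flats_Nil [simp]: "[] \<in> flats b"
  by (simp add: flats_def)

lemma flats_Cons [simp]: "r # z \<in> flats b \<longleftrightarrow> (\<forall>i. r = Some i \<longrightarrow> 1 \<le> i \<and> i < b) \<and> z \<in> flats b"
  by (auto simp: flats_def)

lemma flats_append [simp]: "y @ z \<in> flats b \<longleftrightarrow> y \<in> flats b \<and> z \<in> flats b"
  by (auto simp: flats_def)

lemma strands_nth:
  "strands b z a c \<longleftrightarrow> (\<exists>l < length z. letter_link b (rev z ! l) l a c)"
proof (induction z)
  case (Cons r z)
  have "(\<exists>l < Suc n. P l) \<longleftrightarrow> P n \<or> (\<exists>l < n. P l)" for n and P :: "nat \<Rightarrow> bool"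
    by (auto simp: less_Suc_eq)
  then show ?case
    unfolding strands.simps Cons by (auto simp: nth_append)
qed simp

lemma strands_append:
  "strands b (y @ z) a c \<longleftrightarrow>
     (\<exists>l < length y. letter_link b (rev y ! l) (length z + l) a c) \<or> strands b z a c"
proof (induction y)
  case (Cons r y)
  have "(\<exists>l < Suc n. P l) \<longleftrightarrow> P n \<or> (\<exists>l < n. P l)" for n and P :: "nat \<Rightarrow> bool"
    by (auto simp: less_Suc_eq)
  then show ?case
    unfolding append_Cons strands.simps Cons by (auto simp: nth_append add.commute)
qed simp

lemma letter_link_points:
  assumes "letter_link b r l a c" "\<And>i. r = Some i \<Longrightarrow> 1 \<le> i \<and> i < b"
  shows "a \<in> points b (Suc l) \<and> c \<in> points b (Suc l)"
  using assms unfolding letter_link_def points_def by auto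

lemma points_mono: "a \<in> points b m \<Longrightarrow> m \<le> n \<Longrightarrow> a \<in> points b n"
  by (auto simp: points_def)

lemma strands_points:
  assumes "strands b z a c" "z \<in> flats b"
  shows "a \<in> points b (length z) \<and> c \<in> points b (length z)"
  using assms
proof (induction z)
  case (Cons r z)
  then consider "letter_link b r (length z) a c" | "strands b z a c" by auto
  then show ?case
  proof cases
    case 1
    then show ?thesis using letter_link_points [OF 1] Cons.prems by simp
  next
    case 2
    then have "a \<in> points b (length z)" "c \<in> points b (length z)" using Cons by auto
    then show ?thesis using points_mono by simp
  qed
qed simp

lemma link_points:
  assumes "link b z a c" "z \<in> flats b"
  shows "a \<in> points b (length z) \<and> c \<in> points b (length z)"
  using assms(1) unfolding link_def
proof
  assume "strands b z a c"
  then show ?thesis using assms(2) by (rule strands_points)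
qed (auto simp: points_def)

lemma link_conn: "link b z a c \<Longrightarrow> z \<in> flats b \<Longrightarrow> conn b z a c"
  by (simp add: conn_def link_points r_into_equivclp)

lemma strands_conn: "strands b z a c \<Longrightarrow> z \<in> flats b \<Longrightarrow> conn b z a c"
  by (rule link_conn) (simp_all add: link_def)

lemma closing_conn: "z \<in> flats b \<Longrightarrow> p \<in> {1..b} \<Longrightarrow> conn b z (p, length z) (p, 0)"
  by (rule link_conn) (simp_all add: link_def)

lemma conn_map:
  assumes "conn b z a c" and "per E"
    and "\<And>u. u \<in> points b (length z) \<Longrightarrow> E (f u) (f u)"
    and "\<And>u v. link b z u v \<Longrightarrow> E (f u) (f v)"
  shows "E (f a) (f c)"
proof -
  from assms(1) have "equivclp (link b z) a c" "a \<in> points b (length z)" by (auto simp: conn_def)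
  then show ?thesis
  proof (induction rule: equivclp_induct)
    case (step y u)
    then have "E (f y) (f u)" using assms(4) per_sym [OF assms(2)] by blast
    with step show ?case using per_trans [OF assms(2)] by blast
  qed (use assms(3) in simp)
qed

lemma conn_closed:
  assumes "conn b z a c" "a \<in> D" "\<And>u v. link b z u v \<Longrightarrow> u \<in> D \<longleftrightarrow> v \<in> D"
  shows "c \<in> D"
proof -
  from assms(1) have "equivclp (link b z) a c" by (auto simp: conn_def)
  then show ?thesis
    by (induction rule: equivclp_induct) (use assms(2,3) in auto)
qed

text \<open>Orienting odd strings downwards and even strings upwards is compatible with every resolution,
  so the circles are the orbits of the permutation that moves every point on to the next one.\<close>

fun follow :: "bool \<Rightarrow> flat \<Rightarrow> point \<Rightarrow> point" where
  "follow down z (p, l) =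
     (if l = (if down then 0 else length z) then (p, if down then length z else 0)
      else let r = rev z ! (if down then l - 1 else l) in
        if r = Some p then (Suc p, l) else if p \<noteq> 0 \<and> r = Some (p - 1) then (p - 1, l)
        else (p, if down then l - 1 else Suc l))"

definition next_point :: "flat \<Rightarrow> point \<Rightarrow> point" where
  "next_point z a = follow (odd (fst a)) z a"

lemma rev_nth_flats: "z \<in> flats b \<Longrightarrow> l < length z \<Longrightarrow> rev z ! l = Some i \<Longrightarrow> 1 \<le> i \<and> i < b"
  unfolding flats_def by (metis (mono_tags, lifting) length_rev mem_Collect_eq nth_mem set_rev)

lemma follow_points:
  assumes "z \<in> flats b" "(p, l) \<in> points b (length z)"
  shows "follow d z (p, l) \<in> points b (length z)"
proof -
  have "rev z ! m = Some i \<Longrightarrow> m < length z \<Longrightarrow> 1 \<le> i \<and> i < b" for m i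
    using rev_nth_flats [OF assms(1)] by blast
  note f = this [of "l - 1" p] this [of "l - 1" "p - 1"] this [of l p] this [of l "p - 1"]
  have "l \<noteq> 0 \<Longrightarrow> l - 1 < length z" "l \<noteq> length z \<Longrightarrow> l < length z" using assms(2) by (auto simp: points_def)
  with f show ?thesis using assms(2) by (cases d) (auto simp: points_def Let_def)
qed

lemma follow_back:
  assumes "(p, l) \<in> points b (length z)" "follow d z (p, l) = (p', l')"
  shows "follow (if p' = p then \<not> d else d) z (p', l') = (p, l)"
  using assms by (cases d) (auto simp: points_def Let_def split: if_splits)

text \<open>A vertical step stays on its string and is undone by moving in the opposite direction. A
  turn stays on its level, consults the same letter and is undone in the same direction, but it
  changes the parity of the string. So in both cases the parity of the new string tells how to go
  back.\<close>

lemma prev_next_point: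
  assumes "a \<in> points b (length z)"
  shows "follow (even (fst (next_point z a))) z (next_point z a) = a"
proof -
  obtain p l p' l' where a: "a = (p, l)" "next_point z a = (p', l')" by (metis surj_pair)
  have "p' = p \<or> p' = Suc p \<or> p = Suc p'"
    using a unfolding next_point_def by (auto simp: Let_def split: if_splits)
  then have "(if p' = p then \<not> odd p else odd p) = even p'" by auto
  then show ?thesis
    using follow_back [of p l b z "odd p" p' l'] assms a by (simp add: next_point_def)
qed

lemma inj_on_next_point: "inj_on (next_point z) (points b (length z))"
  by (rule inj_on_inverseI [where g = "\<lambda>a. follow (even (fst a)) z a"]) (rule prev_next_point)

lemma link_next_point:
  assumes "link b z a c"
  shows "next_point z a = c \<or> next_point z c = a"
proof -
  consider l where "l < length z" "letter_link b (rev z ! l) l a c"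
    | p where "a = (p, length z)" "c = (p, 0)"
    using assms unfolding link_def strands_nth by blast
  then show ?thesis
  proof cases
    case 1
    from 1(2) show ?thesis
      unfolding letter_link_def
    proof (elim disjE bexE exE conjE)
      fix p assume p: "p \<in> {1..b}" "rev z ! l \<noteq> Some p" "\<forall>i. p = Suc i \<longrightarrow> rev z ! l \<noteq> Some i"
        and ac: "a = (p, Suc l)" "c = (p, l)"
      then have "rev z ! l \<noteq> Some (p - 1)" by auto
      then show ?thesis using 1(1) p ac by (cases "odd p") (auto simp: next_point_def)
    next
      fix i assume "rev z ! l = Some i" "a = (i, Suc l)" "c = (Suc i, Suc l)"
      then show ?thesis using 1(1) by (cases "odd i") (auto simp: next_point_def)
    next
      fix i assume "rev z ! l = Some i" "a = (i, l)" "c = (Suc i, l)"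
      then show ?thesis using 1(1) by (cases "odd i") (auto simp: next_point_def)
    qed
  next
    case 2
    then show ?thesis by (cases "odd p") (auto simp: next_point_def)
  qed
qed

lemma next_point_link:
  assumes "a \<in> points b (length z)"
  shows "link b z a (next_point z a) \<or> link b z (next_point z a) a"
proof -
  obtain p l where a: "a = (p, l)" "p \<in> {1..b}" "l \<le> length z" using assms by (auto simp: points_def)
  have i: "rev z ! m = Some (p - 1) \<Longrightarrow> p = Suc (p - 1)" for m using a by simp
  have turn: "link b z (i, m) (Suc i, m)"
    if "m' < length z" "rev z ! m' = Some i" "m = m' \<or> m = Suc m'" for m m' i
    using that unfolding link_def strands_nth letter_link_def by blast
  have straight: "link b z (p, Suc m) (p, m)"
    if "m < length z" "rev z ! m \<noteq> Some p" "rev z ! m \<noteq> Some (p - 1)" for m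
    using that a unfolding link_def strands_nth letter_link_def by force
  have closing: "link b z (p, length z) (p, 0)" using a by (auto simp: link_def)
  show ?thesis
  proof (cases "odd p")
    case True
    then show ?thesis
      using a closing turn [of "l - 1" p l] turn [of "l - 1" "p - 1" l] straight [of "l - 1"]
      by (auto simp: next_point_def Let_def split: if_splits)
  next
    case False
    then show ?thesis
      using a closing turn [of l p l] turn [of l "p - 1" l] straight [of l]
      by (auto simp: next_point_def Let_def split: if_splits)
  qed
qed

lemma next_point_points: "z \<in> flats b \<Longrightarrow> a \<in> points b (length z) \<Longrightarrow> next_point z a \<in> points b (length z)"
  unfolding next_point_def using follow_points [of z b "fst a" "snd a"] by simp

lemma conn_orbits:
  assumes "z \<in> flats b"
  shows "conn b z = orbits (points b (length z)) (next_point z)"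
proof (intro ext iffI)
  fix a c assume "conn b z a c"
  then show "orbits (points b (length z)) (next_point z) a c"
  proof (rule conn_map [where f = id, simplified, OF _ per_orbits orbits_refl])
    fix u v assume uv: "link b z u v"
    then have p: "u \<in> points b (length z)" "v \<in> points b (length z)" using link_points assms by blast+
    from link_next_point [OF uv] show "orbits (points b (length z)) (next_point z) u v"
    proof
      assume "next_point z u = v"
      then show ?thesis using orbits_step [of u "points b (length z)" "next_point z"] p by simp
    next
      assume "next_point z v = u"
      then show ?thesis
        using orbits_step [of v "points b (length z)" "next_point z"] p per_sym [OF per_orbits] by metis
    qed
  qed
next
  fix a c assume "orbits (points b (length z)) (next_point z) a c"
  then show "conn b z a c"
  proof (rule orbits_le [OF per_conn, rotated 2])
    show "conn b z u u" if "u \<in> points b (length z)" for u using that by (rule conn_refl)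
    fix u assume "u \<in> points b (length z)"
    then show "conn b z u (next_point z u)"
      using next_point_link [of u b z] link_conn [OF _ assms] conn_sym [of b z] by blast
  qed
qed

text \<open>Replacing a vertical letter by a turn alters \<open>next_point\<close> at exactly two
  points, where the two values are exchanged; this is the situation of \<open>turned\<close>.
  Afterwards the attaching points are slid along the strands to a fixed diagonal pair of ends,
  whatever the parity of \<open>i\<close>.\<close>

lemma edge_conn:
  assumes z: "y @ z \<in> flats b" and i: "1 \<le> i" "i < b"
  shows "edge (conn b (y @ None # z)) (conn b (y @ Some i # z)) (i, Suc (length z)) (Suc i, length z)"
proof -
  define n where "n = length z"
  define N where "N = y @ None # z"
  define T where "T = y @ Some i # z"
  have len: "length N = length T" by (simp add: N_def T_def)
  have n: "n < length T" by (simp add: n_def T_def)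
  have fl: "N \<in> flats b" "T \<in> flats b" using z i by (auto simp: N_def T_def)
  have revN: "rev N ! n = None" and revT: "rev T ! n = Some i"
    by (simp_all add: N_def T_def n_def nth_append)
  have rev: "rev N ! l = rev T ! l" if "l \<noteq> n" for l
    using that by (auto simp: N_def T_def n_def nth_append nth_Cons')
  have pts: "(i, Suc n) \<in> points b (length T)" "(Suc i, n) \<in> points b (length T)"
    "(i, n) \<in> points b (length T)" "(Suc i, Suc n) \<in> points b (length T)"
    using i n by (auto simp: points_def)
  have stay: "next_point T (p, l) = next_point N (p, l)"
    if "(if odd p then l - 1 \<noteq> n \<or> l = 0 else l \<noteq> n) \<or> (p \<noteq> i \<and> p \<noteq> Suc i)" for p l
  proof -
    define m where "m = (if odd p then l - 1 else l)"
    have "rev N ! m = rev T ! m \<or> m = n \<and> p \<noteq> i \<and> p \<noteq> Suc i \<or> odd p \<and> l = 0"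
      using that rev [of m] by (cases "odd p") (auto simp: m_def)
    then consider "rev N ! m = rev T ! m" | "m = n" "p \<noteq> i" "p \<noteq> Suc i" | "odd p" "l = 0"
      by blast
    then show ?thesis
      using len revN revT by cases (auto simp: next_point_def Let_def m_def split: if_splits)
  qed
  have st: "conn b N (i, Suc n) (i, n)" "conn b N (Suc i, Suc n) (Suc i, n)"
    and tt: "conn b T (i, Suc n) (Suc i, Suc n)" "conn b T (i, n) (Suc i, n)"
  proof -
    have "letter_link b (rev N ! n) n (i, Suc n) (i, n)"
      "letter_link b (rev N ! n) n (Suc i, Suc n) (Suc i, n)"
      "letter_link b (rev T ! n) n (i, Suc n) (Suc i, Suc n)"
      "letter_link b (rev T ! n) n (i, n) (Suc i, n)"
      using i by (auto simp: letter_link_def revN revT)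
    then show "conn b N (i, Suc n) (i, n)" "conn b N (Suc i, Suc n) (Suc i, n)"
      "conn b T (i, Suc n) (Suc i, Suc n)" "conn b T (i, n) (Suc i, n)"
      using strands_conn [OF _ fl(1)] strands_conn [OF _ fl(2)] n len unfolding strands_nth by metis+
  qed
  \<comment> \<open>The points through which the directed strands enter the letter: odd strings come
    from the level \<open>Suc n\<close>, even ones from the level \<open>n\<close>.\<close>
  define u v :: point where "u = (i, if odd i then Suc n else n)" and "v = (Suc i, if odd i then n else Suc n)"
  interpret turned "points b (length T)" "next_point N" "next_point T" u v
  proof
    show "finite (points b (length T))" by (simp add: points_def)
    show "inj_on (next_point N) (points b (length T))" "inj_on (next_point T) (points b (length T))"
      using inj_on_next_point [of N b] inj_on_next_point [of T b] len by simp_all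
    show "next_point N ` points b (length T) \<subseteq> points b (length T)"
      "next_point T ` points b (length T) \<subseteq> points b (length T)"
      using next_point_points [OF fl(1)] next_point_points [OF fl(2)] len by auto
    show "u \<in> points b (length T)" "v \<in> points b (length T)" "u \<noteq> v"
      using pts by (auto simp: u_def v_def)
    show "next_point T u = next_point N v" "next_point T v = next_point N u"
      using revN revT len n i by (auto simp: next_point_def u_def v_def Let_def)
    fix w assume w: "w \<in> points b (length T)" "w \<noteq> u" "w \<noteq> v"
    obtain p l where pl: "w = (p, l)" by force
    show "next_point T w = next_point N w"
      using w(2,3) unfolding pl by (intro stay) (auto simp: u_def v_def split: if_splits)
  qed
  have "edge (conn b N) (conn b T) u v"
    using edge_orbits by (simp add: conn_orbits fl len)
  then have "edge (conn b N) (conn b T) (i, Suc n) (Suc i, n)"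
  proof (rule edge_other)
    show "conn b N (i, Suc n) (Suc i, n) \<longleftrightarrow> conn b N u v"
      using st conn_sym conn_trans unfolding u_def v_def by (smt (verit))
    show "conn b T (i, Suc n) (Suc i, n) \<longleftrightarrow> conn b T u v"
      using tt conn_sym conn_trans unfolding u_def v_def by (smt (verit))
  qed
  then show ?thesis by (simp add: N_def T_def n_def)
qed


section \<open>Local moves on flat diagrams\<close>

text \<open>Diagonally opposite ends of a crossing lie on different strands in either smoothing, so
  they can serve as attaching points in both directions.\<close>

fun corners :: "braid_word \<Rightarrow> (point \<times> point) list" where
  "corners [] = []"
| "corners (c # w) = ((fst c, Suc (length w)), (Suc (fst c), length w)) # corners w"

lemma braid_words_Nil [simp]: "[] \<in> braid_words b"
  by (simp add: braid_words_def)

lemma braid_words_Cons [simp]: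
  "c # w \<in> braid_words b \<longleftrightarrow> 1 \<le> fst c \<and> fst c < b \<and> w \<in> braid_words b"
  by (cases c) (auto simp: braid_words_def)

lemma braid_words_append [simp]:
  "u @ w \<in> braid_words b \<longleftrightarrow> u \<in> braid_words b \<and> w \<in> braid_words b"
  by (auto simp: braid_words_def)

lemma vertex_flats: "vertex w z \<Longrightarrow> w \<in> braid_words b \<Longrightarrow> z \<in> flats b"
proof (induction w arbitrary: z)
  case (Cons c w)
  then show ?case by (auto simp: vertex_Cons zero_res_def one_res_def split: if_splits)
qed simp

lemma edge_conn_res:
  assumes "y @ z \<in> flats b" "1 \<le> fst c" "fst c < b"
  shows "edge (conn b (y @ zero_res c # z)) (conn b (y @ one_res c # z))
     (fst c, Suc (length z)) (Suc (fst c), length z)"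
proof -
  note e = edge_conn [OF assms]
  show ?thesis
    using e e [unfolded edge_sym [of "conn b (y @ None # z)"]]
    by (cases "snd c") (auto simp: zero_res_def one_res_def)
qed

lemma cubical_conn:
  assumes "p \<in> flats b" "w \<in> braid_words b"
  shows "cubical (\<lambda>z. conn b (p @ z)) w (corners w)"
  using assms
proof (induction w arbitrary: p)
  case (Cons c w)
  have "edge (conn b (p @ zero_res c # z)) (conn b (p @ one_res c # z))
     (fst c, Suc (length w)) (Suc (fst c), length w)" if "vertex w z" for z
    using edge_conn_res [of p z b c] Cons.prems vertex_flats [OF that] vertex_length [OF that] by auto
  moreover have "cubical (\<lambda>z. conn b (p @ r # z)) w (corners w)"
    if "r \<in> {zero_res c, one_res c}" for r
    using Cons.IH [of "p @ [r]"] Cons.prems that by (auto simp: zero_res_def one_res_def)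
  ultimately show ?case by simp
qed simp

text \<open>Equality of planar tangles as seen from outside: in front of every tail,
  \<open>y\<close> and \<open>y'\<close> connect the points of the tail alike. Closed circles inside
  \<open>y\<close> or \<open>y'\<close> are ignored.\<close>

definition agree :: "nat \<Rightarrow> flat \<Rightarrow> flat \<Rightarrow> bool" where
  "agree b y y' \<longleftrightarrow> (\<forall>z \<in> flats b. \<forall>a \<in> points b (length z). \<forall>c \<in> points b (length z).
     conn b (y @ z) a c \<longleftrightarrow> conn b (y' @ z) a c)"

text \<open>This excludes closed circles inside \<open>y\<close>: each circle passes through the
  tail.\<close>

definition reaches :: "nat \<Rightarrow> flat \<Rightarrow> bool" where
  "reaches b y \<longleftrightarrow> (\<forall>z \<in> flats b. \<forall>a \<in> points b (length (y @ z)).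
     \<exists>q \<in> points b (length z). conn b (y @ z) a q)"

lemma agree_refl: "agree b y y"
  by (simp add: agree_def)

lemma agree_sym: "agree b y y' \<Longrightarrow> agree b y' y"
  by (simp add: agree_def)

lemma agree_trans: "agree b y y' \<Longrightarrow> agree b y' y'' \<Longrightarrow> agree b y y''"
  by (simp add: agree_def)

text \<open>Only the prefix \<open>y'\<close>, to which functionals are transferred, has to be
  without closed circles. The prefix \<open>y\<close> may have some; their variables do not occur in
  the monomials that are compared.\<close>

lemma models_conn:
  assumes "agree b y y'" "reaches b y'" "z \<in> flats b"
  shows "models (points b (length z)) (\<lambda>a. a) (conn b (y @ z)) (conn b (y' @ z))"
  using assms conn_points unfolding models_def agree_def reaches_def by (fastforce simp: per_conn)

lemma agreeI:
  assumes y: "y \<in> flats b" "y' \<in> flats b"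
    and fg: "\<And>z a. z \<in> flats b \<Longrightarrow> a \<in> points b (length z) \<Longrightarrow> f z a = a \<and> g z a = a"
    and f: "\<And>z u. z \<in> flats b \<Longrightarrow> u \<in> points b (length (y @ z)) \<Longrightarrow> f z u \<in> points b (length (y' @ z))"
      "\<And>z u v. z \<in> flats b \<Longrightarrow> link b (y @ z) u v \<Longrightarrow> conn b (y' @ z) (f z u) (f z v)"
    and g: "\<And>z u. z \<in> flats b \<Longrightarrow> u \<in> points b (length (y' @ z)) \<Longrightarrow> g z u \<in> points b (length (y @ z))"
      "\<And>z u v. z \<in> flats b \<Longrightarrow> link b (y' @ z) u v \<Longrightarrow> conn b (y @ z) (g z u) (g z v)"
  shows "agree b y y'"
  unfolding agree_def
proof (intro ballI iffI)
  fix z a c assume z: "z \<in> flats b" and ac: "a \<in> points b (length z)" "c \<in> points b (length z)"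
  show "conn b (y' @ z) a c" if "conn b (y @ z) a c"
    using conn_map [OF that per_conn, of b "y' @ z" "f z"] f z fg [OF z ac(1)] fg [OF z ac(2)]
    by (simp add: conn_refl)
  show "conn b (y @ z) a c" if "conn b (y' @ z) a c"
    using conn_map [OF that per_conn, of b "y @ z" "g z"] g z fg [OF z ac(1)] fg [OF z ac(2)]
    by (simp add: conn_refl)
qed

lemma link_append:
  "link b (y @ z) u v \<longleftrightarrow>
     strands b z u v \<or> (\<exists>l < length y. letter_link b (rev y ! l) (length z + l) u v)
     \<or> (\<exists>p \<in> {1..b}. u = (p, length (y @ z)) \<and> v = (p, 0))"
  unfolding link_def strands_append by blast

lemma conn_append_strands:
  "strands b z u v \<Longrightarrow> y @ z \<in> flats b \<Longrightarrow> conn b (y @ z) u v"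
  by (rule strands_conn) (simp_all add: strands_append)

lemma conn_append_letter:
  "l < length y \<Longrightarrow> letter_link b (rev y ! l) (length z + l) u v \<Longrightarrow> y @ z \<in> flats b \<Longrightarrow> conn b (y @ z) u v"
  by (rule strands_conn) (auto simp: strands_append)

lemma conn_Cons_letter:
  "letter_link b r (length z) u v \<Longrightarrow> y @ r # z \<in> flats b \<Longrightarrow> conn b (y @ r # z) u v"
  by (rule strands_conn) (simp_all add: strands_append)

section \<open>Inserting and deleting a vertical letter\<close>

definition collapse :: "nat \<Rightarrow> point \<Rightarrow> point" where
  "collapse n a = (fst a, if snd a \<le> n then snd a else snd a - 1)"

definition expand :: "nat \<Rightarrow> point \<Rightarrow> point" where
  "expand n a = (fst a, if snd a \<le> n then snd a else Suc (snd a))"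

text \<open>A vertical letter identifies the levels \<open>Suc n\<close> and \<open>n\<close>.
  \<open>collapse\<close> and \<open>expand\<close> carry links to connections, and
  \<open>expand\<close> after \<open>collapse\<close> moves a point at most along one of these
  vertical segments.\<close>

lemma conn_remove_None:
  assumes "x @ y \<in> flats b"
  shows "conn b (x @ None # y) a c \<longleftrightarrow>
    a \<in> points b (Suc (length (x @ y))) \<and> c \<in> points b (Suc (length (x @ y))) \<and>
    conn b (x @ y) (collapse (length y) a) (collapse (length y) c)"
proof -
  define n where "n = length y"
  define up :: "point \<Rightarrow> point" where "up u = (fst u, Suc (snd u))" for u
  have fl: "x @ None # y \<in> flats b" using assms by simp
  have flx: "x \<in> flats b" "y \<in> flats b" using assms by auto
  have len: "length (x @ None # y) = Suc (length (x @ y))" by simp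
  have vert: "conn b (x @ None # y) (p, Suc n) (p, n)" if "p \<in> {1..b}" for p
    using that by (intro conn_Cons_letter [OF _ fl]) (auto simp: letter_link_def n_def)
  have col: "collapse n u \<in> points b (length (x @ y))" if "u \<in> points b (Suc (length (x @ y)))" for u
    using that by (auto simp: points_def collapse_def n_def)
  have ex: "expand n u \<in> points b (Suc (length (x @ y)))" if "u \<in> points b (length (x @ y))" for u
    using that by (auto simp: points_def expand_def)
  have low: "snd u \<le> n \<and> snd v \<le> n" if "strands b y u v" for u v
    using strands_points [OF that flx(2)] by (auto simp: points_def n_def)
  have shift: "letter_link b r l (collapse n u) (collapse n v)"
    if "letter_link b r (Suc l) u v" "n \<le> l" for r l u v
    using that unfolding letter_link_def collapse_def by fastforce
  have shift': "letter_link b r (Suc l) (up u) (up v)"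
    if "letter_link b r l u v" for r l u v
    using that unfolding letter_link_def up_def by fastforce
  have "conn b (x @ y) (collapse n a) (collapse n c)" if "conn b (x @ None # y) a c"
  proof (rule conn_map [OF that per_conn])
    show "conn b (x @ y) (collapse n u) (collapse n u)" if "u \<in> points b (length (x @ None # y))" for u
      using col that by (simp add: conn_refl)
    fix u v assume "link b (x @ None # y) u v"
    then consider "strands b y u v" | "letter_link b None n u v"
      | l where "l < length x" "letter_link b (rev x ! l) (Suc n + l) u v"
      | p where "p \<in> {1..b}" "u = (p, Suc (length (x @ y)))" "v = (p, 0)"
      unfolding link_append strands.simps n_def by auto
    then show "conn b (x @ y) (collapse n u) (collapse n v)"
    proof cases
      case 1
      then show ?thesis using low [OF 1] conn_append_strands [OF 1 assms] by (simp add: collapse_def)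
    next
      case 2
      then have "collapse n u = collapse n v" "collapse n v \<in> points b (length (x @ y))"
        by (auto simp: letter_link_def collapse_def points_def n_def)
      then show ?thesis by (simp add: conn_refl)
    next
      case 3
      then show ?thesis using shift [of _ "n + l"] conn_append_letter [OF 3(1) _ assms] by (simp add: n_def)
    next
      case 4
      then show ?thesis using closing_conn [OF assms 4(1)] by (simp add: collapse_def n_def)
    qed
  qed
  moreover have "conn b (x @ None # y) (expand n a') (expand n c')" if "conn b (x @ y) a' c'" for a' c'
  proof (rule conn_map [OF that per_conn])
    show "conn b (x @ None # y) (expand n u) (expand n u)" if "u \<in> points b (length (x @ y))" for u
      using ex that by (simp add: conn_refl)
    \<comment> \<open>Links above level \<open>n\<close> are shifted up by one, while
      \<open>expand\<close> leaves points of level \<open>n\<close> in place; the vertical segment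
      makes up for the difference.\<close>
    have up: "conn b (x @ None # y) (expand n u) (up u)"
      if "u \<in> points b (length (x @ y))" "n \<le> snd u" for u
    proof (cases "snd u = n")
      case True
      then show ?thesis using vert [of "fst u"] that conn_sym by (auto simp: expand_def up_def points_def)
    next
      case False
      then have "expand n u = up u" using that by (simp add: expand_def up_def)
      then show ?thesis using ex [OF that(1)] by (simp add: conn_refl)
    qed
    fix u v assume uv: "link b (x @ y) u v"
    then have pts: "u \<in> points b (length (x @ y))" "v \<in> points b (length (x @ y))"
      using link_points assms by blast+
    from uv consider "strands b y u v"
      | l where "l < length x" "letter_link b (rev x ! l) (n + l) u v"
      | p where "p \<in> {1..b}" "u = (p, length (x @ y))" "v = (p, 0)"
      unfolding link_append n_def by auto
    then show "conn b (x @ None # y) (expand n u) (expand n v)"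
    proof cases
      case 1
      then show ?thesis using low [OF 1] conn_append_strands [of b "None # y" u v x] fl by (simp add: expand_def)
    next
      case 2
      then have "n \<le> snd u" "n \<le> snd v" by (auto simp: letter_link_def)
      moreover have "conn b (x @ None # y) (up u) (up v)"
        using conn_append_letter [OF 2(1), of b "None # y"] shift' [OF 2(2)] fl by (simp add: n_def)
      ultimately show ?thesis using up pts conn_sym conn_trans by metis
    next
      case 3
      have "conn b (x @ None # y) (up u) v" using closing_conn [OF fl 3(1)] 3 by (simp add: up_def)
      moreover have "expand n v = v" using 3 by (simp add: expand_def)
      ultimately show ?thesis using up [OF pts(1)] 3 conn_trans by (auto simp: n_def)
    qed
  qed
  moreover have "conn b (x @ None # y) u (expand n (collapse n u))" if "u \<in> points b (Suc (length (x @ y)))" for u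
  proof (cases "snd u = Suc n")
    case True
    then show ?thesis using vert [of "fst u"] that by (auto simp: expand_def collapse_def points_def)
  next
    case False
    then have "expand n (collapse n u) = u" by (cases u) (auto simp: expand_def collapse_def)
    then show ?thesis using that by (simp add: conn_refl)
  qed
  note down = calculation(1) and up = calculation(2) and rt = this
  show ?thesis
    unfolding n_def [symmetric]
  proof (intro iffI conjI)
    assume ac: "conn b (x @ None # y) a c"
    show "a \<in> points b (Suc (length (x @ y)))" "c \<in> points b (Suc (length (x @ y)))"
      using conn_points [OF ac] by simp_all
    show "conn b (x @ y) (collapse n a) (collapse n c)" by (rule down [OF ac])
  next
    assume r: "a \<in> points b (Suc (length (x @ y))) \<and> c \<in> points b (Suc (length (x @ y))) \<and>
      conn b (x @ y) (collapse n a) (collapse n c)"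
    then show "conn b (x @ None # y) a c"
      using conn_trans [OF conn_trans [OF rt up] conn_sym [OF rt]] by blast
  qed
qed

lemma agree_remove_None:
  assumes "x @ y \<in> flats b"
  shows "agree b (x @ None # y) (x @ y)"
  unfolding agree_def
proof (intro ballI)
  fix z a c assume "z \<in> flats b" "a \<in> points b (length z)" "c \<in> points b (length z)"
  moreover from this have "collapse (length (y @ z)) a = a" "collapse (length (y @ z)) c = c"
    by (auto simp: collapse_def points_def)
  ultimately show "conn b ((x @ None # y) @ z) a c \<longleftrightarrow> conn b ((x @ y) @ z) a c"
    using conn_remove_None [of x "y @ z" b a c] assms by (auto simp: points_def)
qed

lemma reaches_add_None:
  assumes "x @ y \<in> flats b" "reaches b (x @ y)"
  shows "reaches b (x @ None # y)"
  unfolding reaches_def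
proof (intro ballI)
  fix z a assume z: "z \<in> flats b" and a: "a \<in> points b (length ((x @ None # y) @ z))"
  define n where "n = length (y @ z)"
  have "collapse n a \<in> points b (length ((x @ y) @ z))"
    using a by (auto simp: collapse_def points_def n_def)
  then obtain q where q: "q \<in> points b (length z)" "conn b ((x @ y) @ z) (collapse n a) q"
    using assms(2) z unfolding reaches_def by blast
  moreover have "collapse n q = q" "q \<in> points b (Suc (length (x @ y @ z)))"
    using q(1) by (auto simp: collapse_def points_def n_def)
  ultimately have "conn b ((x @ None # y) @ z) a q"
    using conn_remove_None [of x "y @ z" b a q] assms(1) z a by (simp add: n_def)
  with q(1) show "\<exists>q \<in> points b (length z). conn b ((x @ None # y) @ z) a q" by blast
qed

lemma reaches_Nil: "reaches b []"
  by (auto simp: reaches_def intro: conn_refl)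

text \<open>Only the levels strictly inside \<open>y\<close> need an argument, since the top level
  is closed up with level 0, which belongs to the tail.\<close>

lemma reachesI:
  assumes y: "y \<in> flats b"
    and in_between: "\<And>z p l. z \<in> flats b \<Longrightarrow> p \<in> {1..b} \<Longrightarrow> length z < l \<Longrightarrow> l < length (y @ z) \<Longrightarrow>
      \<exists>q. conn b (y @ z) (p, l) q \<and> (snd q \<le> length z \<or> snd q = length (y @ z))"
  shows "reaches b y"
  unfolding reaches_def
proof (intro ballI)
  fix z a assume z: "z \<in> flats b" and a: "a \<in> points b (length (y @ z))"
  obtain p l where pl: "a = (p, l)" by force
  have "\<exists>q. conn b (y @ z) a q \<and> (snd q \<le> length z \<or> snd q = length (y @ z))"
  proof (cases "length z < l \<and> l < length (y @ z)")
    case True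
    then show ?thesis using in_between [OF z, of p l] a pl by (auto simp: points_def)
  next
    case False
    then show ?thesis using a pl by (intro exI [of _ a] conjI conn_refl) (auto simp: points_def)
  qed
  then obtain q where q: "conn b (y @ z) a q" "snd q \<le> length z \<or> snd q = length (y @ z)" by blast
  have "fst q \<in> {1..b}" using conn_points [OF q(1)] by (auto simp: points_def)
  show "\<exists>q \<in> points b (length z). conn b (y @ z) a q"
  proof (cases "snd q \<le> length z")
    case True
    then show ?thesis using q \<open>fst q \<in> {1..b}\<close> by (intro bexI [of _ q]) (auto simp: points_def mem_Times_iff)
  next
    case False
    then have "conn b (y @ z) q (fst q, 0)"
      using closing_conn [of "y @ z" b "fst q"] q y z \<open>fst q \<in> {1..b}\<close> by (metis flats_append prod.collapse)
    then show ?thesis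
      using conn_trans [OF q(1)] \<open>fst q \<in> {1..b}\<close> by (intro bexI [of _ "(fst q, 0)"]) (auto simp: points_def)
  qed
qed

lemma reaches_turn: "1 \<le> i \<Longrightarrow> i < b \<Longrightarrow> reaches b [Some i]"
  by (rule reachesI) auto

section \<open>The relations of the Temperley-Lieb algebra\<close>

lemma letter_link_straight:
  "p \<in> {1..b} \<Longrightarrow> p \<noteq> i \<Longrightarrow> p \<noteq> Suc i \<Longrightarrow> letter_link b (Some i) l (p, Suc l) (p, l)"
  and letter_link_turn:
  "letter_link b (Some i) l (i, Suc l) (Suc i, Suc l)" "letter_link b (Some i) l (i, l) (Suc i, l)"
  by (auto simp: letter_link_def)

lemma letter_link_SomeE:
  assumes "letter_link b (Some i) l u v"
  obtains p where "p \<in> {1..b}" "p \<noteq> i" "p \<noteq> Suc i" "u = (p, Suc l)" "v = (p, l)"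
    | "u = (i, Suc l)" "v = (Suc i, Suc l)" | "u = (i, l)" "v = (Suc i, l)"
  using assms unfolding letter_link_def by (elim disjE bexE exE conjE) (use that in auto)

lemma two_letter_conn:
  assumes "[r, r'] @ z \<in> flats b"
  shows "letter_link b r (Suc (length z)) u v \<Longrightarrow> conn b ([r, r'] @ z) u v"
    and "letter_link b r' (length z) u v \<Longrightarrow> conn b ([r, r'] @ z) u v"
    and "strands b z u v \<Longrightarrow> conn b ([r, r'] @ z) u v"
  using assms by (auto intro!: strands_conn)

lemma three_letter_conn:
  assumes "[r, r', r''] @ z \<in> flats b"
  shows "letter_link b r (Suc (Suc (length z))) u v \<Longrightarrow> conn b ([r, r', r''] @ z) u v"
    and "letter_link b r' (Suc (length z)) u v \<Longrightarrow> conn b ([r, r', r''] @ z) u v"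
    and "letter_link b r'' (length z) u v \<Longrightarrow> conn b ([r, r', r''] @ z) u v"
    and "strands b z u v \<Longrightarrow> conn b ([r, r', r''] @ z) u v"
  using assms by (auto intro!: strands_conn)

lemma reaches_two_turns:
  assumes "1 \<le> i" "i < b" "1 \<le> j" "j < b" "i \<noteq> j"
  shows "reaches b [Some i, Some j]"
proof (rule reachesI)
  fix z p l assume z: "z \<in> flats b" and p: "p \<in> {1..b}"
    and l: "length z < l" "l < length ([Some i, Some j] @ z)"
  define n where "n = length z"
  have l: "l = Suc n" using l by (simp add: n_def)
  have fl: "[Some i, Some j] @ z \<in> flats b" using z assms by simp
  let ?C = "conn b ([Some i, Some j] @ z)"
  note c = two_letter_conn [OF fl, folded n_def]
  have low: "?C (q, Suc n) (q, n)" if "q \<in> {1..b}" "q \<noteq> j" "q \<noteq> Suc j" for q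
    using that by (intro c(2) letter_link_straight)
  have high: "?C (q, Suc n) (q, Suc (Suc n))" if "q \<in> {1..b}" "q \<noteq> i" "q \<noteq> Suc i" for q
    using that by (intro conn_sym [OF c(1)] letter_link_straight)
  have turn: "?C (i, Suc n) (Suc i, Suc n)" by (intro c(1) letter_link_turn)
  have "\<exists>q. ?C (p, Suc n) q \<and> (snd q \<le> n \<or> snd q = Suc (Suc n))"
  proof (cases "p \<noteq> j \<and> p \<noteq> Suc j")
    case True
    then show ?thesis using low [of p] p by force
  next
    case False
    show ?thesis
    proof (cases "p \<noteq> i \<and> p \<noteq> Suc i")
      case True
      then show ?thesis using high [of p] p by force
    next
      case ij: False
      \<comment> \<open>What is left is the position shared by adjacent turns. The upper turn leads
        from it to a string that the lower letter lets through.\<close>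
      then consider "p = i" "i = Suc j" | "p = Suc i" "j = Suc i" using False assms(5) by auto
      then show ?thesis
      proof cases
        case 1
        then show ?thesis using conn_trans [OF turn low [of "Suc i"]] assms by force
      next
        case 2
        then show ?thesis using conn_trans [OF conn_sym [OF turn] low [of i]] assms by force
      qed
    qed
  qed
  then show "\<exists>q. ?C (p, l) q \<and> (snd q \<le> length z \<or> snd q = length ([Some i, Some j] @ z))"
    by (simp add: l n_def)
qed (use assms in simp)

lemma strands_levels:
  "strands b z u v \<Longrightarrow> z \<in> flats b \<Longrightarrow> snd u \<le> length z \<and> snd v \<le> length z"
  using strands_points by (fastforce simp: points_def)

lemma link_two_letters:
  "link b ([r, r'] @ z) u v \<longleftrightarrow> letter_link b r (Suc (length z)) u v \<or> letter_link b r' (length z) u v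
    \<or> strands b z u v \<or> (\<exists>p \<in> {1..b}. u = (p, Suc (Suc (length z))) \<and> v = (p, 0))"
  by (auto simp: link_def)

lemma link_one_letter:
  "link b ([r] @ z) u v \<longleftrightarrow> letter_link b r (length z) u v
    \<or> strands b z u v \<or> (\<exists>p \<in> {1..b}. u = (p, Suc (length z)) \<and> v = (p, 0))"
  by (auto simp: link_def)

lemma link_three_letters:
  "link b ([r, r', r''] @ z) u v \<longleftrightarrow> letter_link b r (Suc (Suc (length z))) u v
    \<or> letter_link b r' (Suc (length z)) u v \<or> letter_link b r'' (length z) u v
    \<or> strands b z u v \<or> (\<exists>p \<in> {1..b}. u = (p, Suc (Suc (Suc (length z)))) \<and> v = (p, 0))"
  by (auto simp: link_def)

text \<open>Only the middle level needs care. A point there on the strings of \<open>j\<close> lies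
  just above the turn of \<open>j\<close>, and after the exchange this is the top level; a point on
  the strings of \<open>i\<close> lies just below the turn of \<open>i\<close>, which becomes the
  bottom level \<open>n\<close>.\<close>

lemma far_simulates:
  assumes i: "1 \<le> i" "i < b" "1 \<le> j" "j < b" "i + 2 \<le> j \<or> j + 2 \<le> i" and z: "z \<in> flats b"
    and uv: "link b ([Some i, Some j] @ z) u v"
  defines "f \<equiv> \<lambda>(p, l). if l = Suc (length z) then (p, if p = j \<or> p = Suc j then Suc l else length z) else (p, l)"
  shows "conn b ([Some j, Some i] @ z) (f u) (f v)"
proof -
  define n where "n = length z"
  have fl: "[Some j, Some i] @ z \<in> flats b" using z i by simp
  let ?C = "conn b ([Some j, Some i] @ z)"
  note c = two_letter_conn [OF fl, folded n_def]
  have f: "f (p, l) = (p, l)" if "l \<noteq> Suc n" for p l using that by (simp add: f_def n_def)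
  have f1: "f (p, Suc n) = (p, if p = j \<or> p = Suc j then Suc (Suc n) else n)" for p by (simp add: f_def n_def)
  have rf: "?C (p, l) (p, l)" if "p \<in> {1..b}" "l \<le> Suc (Suc n)" for p l
    using that by (intro conn_refl) (auto simp: points_def n_def)
  have low: "?C (q, Suc n) (q, n)" if "q \<in> {1..b}" "q \<noteq> i" "q \<noteq> Suc i" for q
    using that by (intro c(2) letter_link_straight)
  have high: "?C (q, Suc (Suc n)) (q, Suc n)" if "q \<in> {1..b}" "q \<noteq> j" "q \<noteq> Suc j" for q
    using that by (intro c(1) letter_link_straight)
  have tj: "?C (j, Suc (Suc n)) (Suc j, Suc (Suc n))" "?C (j, Suc n) (Suc j, Suc n)"
    by (intro c(1) letter_link_turn)+
  have ti: "?C (i, Suc n) (Suc i, Suc n)" "?C (i, n) (Suc i, n)"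
    by (intro c(2) letter_link_turn)+
  have ib: "i \<in> {1..b}" "Suc i \<in> {1..b}" "j \<in> {1..b}" "Suc j \<in> {1..b}" using i by auto
  from uv consider (i) "letter_link b (Some i) (Suc n) u v" | (j) "letter_link b (Some j) n u v"
    | (s) "strands b z u v" | (c) p where "p \<in> {1..b}" "u = (p, Suc (Suc n))" "v = (p, 0)"
    unfolding link_two_letters n_def by blast
  then show ?thesis
  proof cases
    case i
    then show ?thesis
    proof (cases rule: letter_link_SomeE)
      case (1 p)
      then show ?thesis using rf [of p] conn_trans [OF high low, of p] by (auto simp: f f1)
    next
      case 2
      have "?C (i, Suc (Suc n)) (Suc i, Suc (Suc n))"
        using conn_trans [OF conn_trans [OF high ti(1)] conn_sym [OF high]] assms(5) ib by force
      then show ?thesis using 2 by (simp add: f)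
    next
      case 3
      then show ?thesis using ti(2) assms(5) by (auto simp: f1)
    qed
  next
    case j
    then show ?thesis
    proof (cases rule: letter_link_SomeE)
      case (1 p)
      then show ?thesis using rf [of p n] by (simp add: f f1)
    next
      case 2
      then show ?thesis using tj by (simp add: f1)
    next
      case 3
      have "?C (j, n) (Suc j, n)"
        using conn_trans [OF conn_trans [OF conn_sym [OF low] tj(2)] low] assms(5) ib by force
      then show ?thesis using 3 by (simp add: f)
    qed
  next
    case s
    then have "f u = u" "f v = v" using strands_levels [OF s z] by (auto simp: f_def n_def split: prod.splits)
    then show ?thesis using c(3) [OF s] by simp
  next
    case c
    then show ?thesis using closing_conn [OF fl c(1)] by (simp add: f n_def)
  qed
qed

lemma agree_far:
  assumes i: "1 \<le> i" "i < b" "1 \<le> j" "j < b" "i + 2 \<le> j \<or> j + 2 \<le> i"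
  shows "agree b [Some i, Some j] [Some j, Some i]"
proof -
  define f :: "nat \<Rightarrow> flat \<Rightarrow> point \<Rightarrow> point" where
    "f j z = (\<lambda>(p, l). if l = Suc (length z) then (p, if p = j \<or> p = Suc j then Suc l else length z) else (p, l))" for j z
  have i': "j + 2 \<le> i \<or> i + 2 \<le> j" using i(5) by blast
  show ?thesis
    by (rule agreeI [where f = "f j" and g = "f i"])
      (use i far_simulates [OF i, folded f_def] far_simulates [OF i(3,4,1,2) i', folded f_def]
        in \<open>auto simp: f_def points_def\<close>)
qed

text \<open>The middle circle of the doubled turn has no counterpart in the single turn. The map
  \<open>f\<close> sends it to the one point \<open>(i, n)\<close>; this respects links because no
  link joins the circle to the rest.\<close>

lemma agree_double_turn:
  assumes i: "1 \<le> i" "i < b"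
  shows "agree b [Some i, Some i] [Some i]"
proof (rule agreeI)
  define f :: "flat \<Rightarrow> point \<Rightarrow> point" where
    "f z = (\<lambda>(p, l). if l \<le> length z then (p, l) else if l = Suc (length z)
       then (if p = i \<or> p = Suc i then i else p, length z) else (p, Suc (length z)))" for z
  define g :: "flat \<Rightarrow> point \<Rightarrow> point" where
    "g z = (\<lambda>(p, l). if l \<le> length z then (p, l) else (p, Suc (Suc (length z))))" for z
  show "[Some i, Some i] \<in> flats b" "[Some i] \<in> flats b" using i by auto
  show "f z a = a \<and> g z a = a" if "a \<in> points b (length z)" for z a
    using that by (auto simp: f_def g_def points_def)
  show "f z u \<in> points b (length ([Some i] @ z))" if "u \<in> points b (length ([Some i, Some i] @ z))" for z u
    using that i by (auto simp: f_def points_def split: prod.splits)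
  show "g z u \<in> points b (length ([Some i, Some i] @ z))" if "u \<in> points b (length ([Some i] @ z))" for z u
    using that by (auto simp: g_def points_def split: prod.splits)
  fix z u v assume z: "z \<in> flats b"
  define n where "n = length z"
  have fl: "[Some i] @ z \<in> flats b" "[Some i, Some i] @ z \<in> flats b" using z i by auto
  have c1: "letter_link b (Some i) n u v \<Longrightarrow> conn b ([Some i] @ z) u v"
    "strands b z u v \<Longrightarrow> conn b ([Some i] @ z) u v" for u v
    using fl(1) by (auto intro!: strands_conn simp: n_def)
  note c2 = two_letter_conn [OF fl(2), folded n_def]
  have rf: "conn b ([Some i] @ z) (p, l) (p, l)" if "p \<in> {1..b}" "l \<le> Suc n" for p l
    using that by (intro conn_refl) (auto simp: points_def n_def)
  have ib: "i \<in> {1..b}" "Suc i \<in> {1..b}" using i by auto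
  show "conn b ([Some i] @ z) (f z u) (f z v)" if uv: "link b ([Some i, Some i] @ z) u v"
  proof -
    from uv consider (h) "letter_link b (Some i) (Suc n) u v" | (l) "letter_link b (Some i) n u v"
      | (s) "strands b z u v" | (c) p where "p \<in> {1..b}" "u = (p, Suc (Suc n))" "v = (p, 0)"
      unfolding link_two_letters n_def by blast
    then show ?thesis
    proof cases
      case h
      then show ?thesis
      proof (cases rule: letter_link_SomeE)
        case (1 p)
        then show ?thesis using c1(1) [OF letter_link_straight [of p]] by (simp add: f_def n_def)
      qed (use c1(1) [OF letter_link_turn(1)] rf [OF ib(1), of n] in \<open>simp_all add: f_def n_def\<close>)
    next
      case l
      then show ?thesis
      proof (cases rule: letter_link_SomeE)
        case (1 p)
        then show ?thesis using rf [of p n] by (simp add: f_def n_def)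
      qed (use c1(1) [OF letter_link_turn(2)] rf [OF ib(1), of n] in \<open>simp_all add: f_def n_def\<close>)
    next
      case s
      then have "f z u = u" "f z v = v" using strands_levels [OF s z] by (auto simp: f_def n_def split: prod.splits)
      then show ?thesis using c1(2) [OF s] by simp
    next
      case c
      then show ?thesis using closing_conn [OF fl(1) c(1)] by (simp add: f_def n_def)
    qed
  qed
  show "conn b ([Some i, Some i] @ z) (g z u) (g z v)" if uv: "link b ([Some i] @ z) u v"
  proof -
    from uv consider (l) "letter_link b (Some i) n u v"
      | (s) "strands b z u v" | (c) p where "p \<in> {1..b}" "u = (p, Suc n)" "v = (p, 0)"
      unfolding link_one_letter n_def by blast
    then show ?thesis
    proof cases
      case l
      then show ?thesis
      proof (cases rule: letter_link_SomeE)
        case (1 p)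
        then show ?thesis
          using conn_trans [OF c2(1) [OF letter_link_straight] c2(2) [OF letter_link_straight], of p]
          by (simp add: g_def n_def)
      qed (use c2(1) [OF letter_link_turn(1)] c2(2) [OF letter_link_turn(2)] in \<open>simp_all add: g_def n_def\<close>)
    next
      case s
      then have "g z u = u" "g z v = v" using strands_levels [OF s z] by (auto simp: g_def n_def split: prod.splits)
      then show ?thesis using c2(3) [OF s] by simp
    next
      case c
      then show ?thesis using closing_conn [OF fl(2) c(1)] by (simp add: g_def n_def)
    qed
  qed
qed

text \<open>For adjacent \<open>i\<close> and \<open>j\<close> the turns of \<open>[Some i, Some j, Some i]\<close> straighten into
  a strand at the position \<open>k\<close> of the pair \<open>j, j + 1\<close> that is not one of \<open>i, i + 1\<close>;
  \<open>m\<close> is the common position.\<close>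

locale zigzag =
  fixes b i j :: nat
  assumes ij: "1 \<le> i" "i < b" "1 \<le> j" "j < b" "j = Suc i \<or> i = Suc j"
begin

definition k where "k = (if j = Suc i then Suc j else j)"
definition m where "m = (if j = Suc i then j else i)"
definition m' where "m' = (if j = Suc i then i else Suc i)"

lemma positions: "k \<in> {1..b}" "m \<in> {1..b}" "m' \<in> {1..b}" "k \<noteq> i" "k \<noteq> Suc i" "m' \<noteq> j" "m' \<noteq> Suc j"
  "p = i \<or> p = Suc i \<longleftrightarrow> p = m \<or> p = m'" "p = j \<or> p = Suc j \<longleftrightarrow> p = m \<or> p = k"
  "i \<in> {1..b}" "Suc i \<in> {1..b}"
  using ij by (auto simp: k_def m_def m'_def)

lemma in_flats: "z \<in> flats b \<Longrightarrow> [Some i, Some j, Some i] @ z \<in> flats b"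
  using ij by simp

text \<open>The strand is traced from its lower end: up along \<open>k\<close> to the turn of
  \<open>j\<close>, over \<open>m\<close> to \<open>m'\<close> by the lower turn of
  \<open>i\<close>, up through the middle letter along \<open>m'\<close>, back over \<open>m\<close>
  to \<open>k\<close> by the upper turn of \<open>i\<close> and the turn of \<open>j\<close>, and up
  along \<open>k\<close>.\<close>

lemma through:
  assumes z: "z \<in> flats b" and l: "l \<in> {length z..length z + 3}"
    and p: "p = k \<or> (p = m \<or> p = m') \<and> l \<in> {length z + 1, length z + 2}"
  shows "conn b ([Some i, Some j, Some i] @ z) (p, l) (k, length z)"
proof -
  define n where "n = length z"
  let ?C = "conn b ([Some i, Some j, Some i] @ z)"
  note c = three_letter_conn [OF in_flats [OF z], folded n_def]
  note pos = positions
  have jt: "?C (m, l) (k, l)" if "l = Suc n \<or> l = Suc (Suc n)" for l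
    using c(2) [OF letter_link_turn(1)] c(2) [OF letter_link_turn(2)] that conn_sym ij(5)
    by (auto simp: m_def k_def)
  have it: "?C (m', Suc n) (m, Suc n)" "?C (m', Suc (Suc n)) (m, Suc (Suc n))"
    using c(3) [OF letter_link_turn(1)] c(1) [OF letter_link_turn(2)] conn_sym ij(5)
    by (auto simp: m_def m'_def)
  have s0: "?C (k, Suc n) (k, n)" by (intro c(3) letter_link_straight) (use pos in auto)
  have k1: "?C (m, Suc n) (k, n)" using conn_trans [OF jt s0] by simp
  have k2: "?C (m', Suc n) (k, n)" using conn_trans [OF it(1) k1] .
  have "?C (m', Suc (Suc n)) (m', Suc n)" by (intro c(2) letter_link_straight) (use pos in auto)
  from conn_trans [OF this k2] have k3: "?C (m', Suc (Suc n)) (k, n)" .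
  from conn_trans [OF conn_sym [OF it(2)] k3] have k4: "?C (m, Suc (Suc n)) (k, n)" .
  from conn_trans [OF conn_sym [OF jt] k4] have k5: "?C (k, Suc (Suc n)) (k, n)" by simp
  have "?C (k, Suc (Suc (Suc n))) (k, Suc (Suc n))" by (intro c(1) letter_link_straight) (use pos in auto)
  from conn_trans [OF this k5] have k6: "?C (k, Suc (Suc (Suc n))) (k, n)" .
  have k0: "?C (k, n) (k, n)" using pos by (intro conn_refl) (auto simp: points_def n_def)
  have "l = n \<or> l = Suc n \<or> l = Suc (Suc n) \<or> l = Suc (Suc (Suc n))" using l by (auto simp: n_def)
  with p show ?thesis using k0 s0 k1 k2 k3 k4 k5 k6 by (auto simp: n_def)
qed

lemma beside:
  assumes z: "z \<in> flats b" and p: "p \<in> {1..b}" "p \<noteq> i" "p \<noteq> Suc i" "p \<noteq> k"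
  shows "conn b ([Some i, Some j, Some i] @ z) (p, Suc (length z)) (p, length z)"
    "conn b ([Some i, Some j, Some i] @ z) (p, Suc (Suc (length z))) (p, length z)"
    "conn b ([Some i, Some j, Some i] @ z) (p, Suc (Suc (Suc (length z)))) (p, length z)"
proof -
  note c = three_letter_conn [OF in_flats [OF z]]
  have pj: "p \<noteq> j" "p \<noteq> Suc j" using p positions(8,9) [of p] by blast+
  show 1: "conn b ([Some i, Some j, Some i] @ z) (p, Suc (length z)) (p, length z)"
    using p by (intro c(3) letter_link_straight)
  show 2: "conn b ([Some i, Some j, Some i] @ z) (p, Suc (Suc (length z))) (p, length z)"
    using p pj by (intro conn_trans [OF c(2) 1] letter_link_straight)
  show "conn b ([Some i, Some j, Some i] @ z) (p, Suc (Suc (Suc (length z)))) (p, length z)"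
    using p by (intro conn_trans [OF c(1) 2] letter_link_straight)
qed

lemma reaches_zigzag: "reaches b [Some i, Some j, Some i]"
proof (rule reachesI)
  fix z p l assume z: "z \<in> flats b" and p: "p \<in> {1..b}"
    and l: "length z < l" "l < length ([Some i, Some j, Some i] @ z)"
  then have l': "l = length z + 1 \<or> l = length z + 2" by auto
  have "conn b ([Some i, Some j, Some i] @ z) (p, l) (k, length z)" if "p = k \<or> p = m \<or> p = m'"
    using through [OF z, of l p] that l' by auto
  moreover have "conn b ([Some i, Some j, Some i] @ z) (p, l) (p, length z)" if "\<not> (p = k \<or> p = m \<or> p = m')"
    using beside(1,2) [OF z p] that l' positions(8) [of p] by auto
  ultimately show "\<exists>q. conn b ([Some i, Some j, Some i] @ z) (p, l) q
      \<and> (snd q \<le> length z \<or> snd q = length ([Some i, Some j, Some i] @ z))"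
    by (metis le_refl snd_conv)
qed (use ij in simp)

text \<open>The outer turns survive as the two sides of the single turn, and everything at the inner
  levels is part of a strand straightened onto level \<open>n\<close>: \<open>f\<close> contracts
  \<open>m\<close>, \<open>m'\<close> and \<open>k\<close> to \<open>(k, n)\<close> and moves other
  inner points straight down.\<close>

lemma agree_zigzag: "agree b [Some i, Some j, Some i] [Some i]"
proof (rule agreeI)
  define f :: "flat \<Rightarrow> point \<Rightarrow> point" where
    "f z = (\<lambda>(p, l). if l \<le> length z then (p, l) else if l = length z + 3 then (p, Suc (length z))
       else (if p = m \<or> p = m' then k else p, length z))" for z
  define g :: "flat \<Rightarrow> point \<Rightarrow> point" where
    "g z = (\<lambda>(p, l). if l \<le> length z then (p, l) else (p, Suc (Suc (Suc (length z)))))" for z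
  show "[Some i, Some j, Some i] \<in> flats b" "[Some i] \<in> flats b" using ij by auto
  show "f z a = a \<and> g z a = a" if "a \<in> points b (length z)" for z a
    using that by (auto simp: f_def g_def points_def)
  show "f z u \<in> points b (length ([Some i] @ z))" if "u \<in> points b (length ([Some i, Some j, Some i] @ z))" for z u
    using that positions(1) by (auto simp: f_def points_def split: prod.splits)
  show "g z u \<in> points b (length ([Some i, Some j, Some i] @ z))" if "u \<in> points b (length ([Some i] @ z))" for z u
    using that by (auto simp: g_def points_def split: prod.splits)
  fix z u v assume z: "z \<in> flats b"
  define n where "n = length z"
  have fl: "[Some i] @ z \<in> flats b" using z ij by auto
  have c1: "letter_link b (Some i) n u v \<Longrightarrow> conn b ([Some i] @ z) u v"
    "strands b z u v \<Longrightarrow> conn b ([Some i] @ z) u v" for u v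
    using fl(1) by (auto intro!: strands_conn simp: n_def)
  note c3 = three_letter_conn [OF in_flats [OF z], folded n_def]
  have rf: "conn b ([Some i] @ z) (p, n) (p, n)" if "p \<in> {1..b}" for p
    using that by (intro conn_refl) (auto simp: points_def n_def)
  have fk: "f z (p, l) = (k, n)" if "p = m \<or> p = m' \<or> p = k" "l = Suc n \<or> l = Suc (Suc n)" for p l
    using that by (auto simp: f_def n_def)
  have fi: "f z (i, l) = (k, n)" "f z (Suc i, l) = (k, n)" if "l = Suc n \<or> l = Suc (Suc n)" for l
    using fk [OF _ that, of i] fk [OF _ that, of "Suc i"] positions(8) [of i] positions(8) [of "Suc i"] by blast+
  have fp: "f z (p, l) = (p, n)" if "p \<noteq> m" "p \<noteq> m'" "l = Suc n \<or> l = Suc (Suc n)" for p l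
    using that by (auto simp: f_def n_def)
  have f0: "f z (p, l) = (p, l)" if "l \<le> n" for p l
    using that by (auto simp: f_def n_def)
  have f3: "f z (p, Suc (Suc (Suc n))) = (p, Suc n)" for p
    by (auto simp: f_def n_def)
  show "conn b ([Some i] @ z) (f z u) (f z v)" if uv: "link b ([Some i, Some j, Some i] @ z) u v"
  proof -
    from uv consider (h) "letter_link b (Some i) (Suc (Suc n)) u v" | (m) "letter_link b (Some j) (Suc n) u v"
      | (l) "letter_link b (Some i) n u v"
      | (s) "strands b z u v" | (c) p where "p \<in> {1..b}" "u = (p, Suc (Suc (Suc n)))" "v = (p, 0)"
      unfolding link_three_letters n_def by blast
    then show ?thesis
    proof cases
      case h
      then show ?thesis
      proof (cases rule: letter_link_SomeE)
        case (1 p)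
        then show ?thesis using c1(1) [OF letter_link_straight [of p]] positions(8) [of p] by (simp add: fp f3)
      next
        case 2
        then show ?thesis using c1(1) [OF letter_link_turn(1)] by (simp add: f3)
      next
        case 3
        then show ?thesis using rf positions(1) by (simp add: fi)
      qed
    next
      case m
      then show ?thesis
      proof (cases rule: letter_link_SomeE)
        case (1 p)
        then show ?thesis using rf [of p] rf [OF positions(1)] by (cases "p = m \<or> p = m'") (auto simp: fk fp)
      qed (use rf positions(1) positions(9) [of j] positions(9) [of "Suc j"] in \<open>auto simp: fk\<close>)
    next
      case l
      then show ?thesis
      proof (cases rule: letter_link_SomeE)
        case (1 p)
        then show ?thesis using rf [of p] positions(8) [of p] by (simp add: f0 fp)
      next
        case 2
        then show ?thesis using rf positions(1) by (simp add: fi)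
      next
        case 3
        then show ?thesis using c1(1) [OF letter_link_turn(2)] by (simp add: f0)
      qed
    next
      case s
      then have "f z u = u" "f z v = v" using strands_levels [OF s z] by (auto simp: f_def n_def split: prod.splits)
      then show ?thesis using c1(2) [OF s] by simp
    next
      case c
      then show ?thesis using closing_conn [OF fl(1) c(1)] by (simp add: f3 f0) (simp add: n_def)
    qed
  qed
  have g0: "g z (p, l) = (p, l)" if "l \<le> n" for p l
    using that by (auto simp: g_def n_def)
  have g1: "g z (p, Suc n) = (p, Suc (Suc (Suc n)))" for p
    by (auto simp: g_def n_def)
  show "conn b ([Some i, Some j, Some i] @ z) (g z u) (g z v)" if uv: "link b ([Some i] @ z) u v"
  proof -
    from uv consider (l) "letter_link b (Some i) n u v"
      | (s) "strands b z u v" | (c) p where "p \<in> {1..b}" "u = (p, Suc n)" "v = (p, 0)"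
      unfolding link_one_letter n_def by blast
    then show ?thesis
    proof cases
      case l
      then show ?thesis
      proof (cases rule: letter_link_SomeE)
        case (1 p)
        then show ?thesis
          using through [OF z, of "length z + 3" k] beside(3) [OF z 1(1-3)]
          by (cases "p = k") (simp_all add: g0 g1, simp_all add: n_def numeral_3_eq_3)
      next
        case 2
        then show ?thesis using c3(1) [OF letter_link_turn(1)] by (simp add: g1)
      next
        case 3
        then show ?thesis using c3(3) [OF letter_link_turn(2)] by (simp add: g0)
      qed
    next
      case s
      then have "g z u = u" "g z v = v" using strands_levels [OF s z] by (auto simp: g_def n_def split: prod.splits)
      then show ?thesis using c3(4) [OF s] by simp
    next
      case c
      then show ?thesis using closing_conn [OF in_flats [OF z] c(1)] by (simp add: g0 g1) (simp add: n_def)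
    qed
  qed
qed

end

section \<open>The closed circle between two equal turns\<close>

lemma island_double_turn:
  assumes "1 \<le> i" "i < b" "z \<in> flats b" and p: "p \<in> {i, Suc i} \<times> {Suc (length z)}"
  shows "conn b ([Some i, Some i] @ z) p c \<longleftrightarrow> c \<in> {i, Suc i} \<times> {Suc (length z)}"
proof
  have fl: "[Some i, Some i] @ z \<in> flats b" using assms by simp
  show "c \<in> {i, Suc i} \<times> {Suc (length z)}" if "conn b ([Some i, Some i] @ z) p c"
  proof (rule conn_closed [OF that p])
    show "u \<in> {i, Suc i} \<times> {Suc (length z)} \<longleftrightarrow> v \<in> {i, Suc i} \<times> {Suc (length z)}"
      if "link b ([Some i, Some i] @ z) u v" for u v
      using that unfolding link_two_letters
    proof (elim disjE bexE conjE)
      assume "strands b z u v"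
      from strands_levels [OF this assms(3)] show ?thesis by (auto simp: mem_Times_iff)
    qed (auto elim: letter_link_SomeE)
  qed
  have t: "conn b ([Some i, Some i] @ z) (i, Suc (length z)) (Suc i, Suc (length z))"
    by (rule two_letter_conn(1) [OF fl letter_link_turn(2)])
  show "conn b ([Some i, Some i] @ z) p c" if "c \<in> {i, Suc i} \<times> {Suc (length z)}"
    using that p t conn_sym [OF t] conn_trans [OF t conn_sym [OF t]]
      conn_trans [OF conn_sym [OF t] t] by auto
qed

text \<open>A vertical letter between the turns stretches the circle over two levels;
  \<open>collapse\<close> reduces the claim to the unstretched one.\<close>

lemma island_spaced_turn:
  assumes "1 \<le> i" "i < b" "z \<in> flats b" and p: "p \<in> {i, Suc i} \<times> {Suc (length z), Suc (Suc (length z))}"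
  shows "conn b ([Some i, None, Some i] @ z) p c \<longleftrightarrow> c \<in> {i, Suc i} \<times> {Suc (length z), Suc (Suc (length z))}"
proof -
  have "conn b ([Some i, None, Some i] @ z) p c \<longleftrightarrow>
      c \<in> points b (Suc (length ([Some i, Some i] @ z)))
      \<and> conn b ([Some i, Some i] @ z) (collapse (length ([Some i] @ z)) p) (collapse (length ([Some i] @ z)) c)"
  proof -
    have "p \<in> points b (Suc (length ([Some i, Some i] @ z)))" using p assms by (auto simp: points_def)
    moreover have "[Some i] @ [Some i] @ z \<in> flats b" using assms by simp
    ultimately show ?thesis
      using conn_remove_None [of "[Some i]" "[Some i] @ z" b p c] by (simp only: append_Cons append_Nil) simp
  qed
  also have "\<dots> \<longleftrightarrow> c \<in> points b (Suc (length ([Some i, Some i] @ z)))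
      \<and> collapse (length ([Some i] @ z)) c \<in> {i, Suc i} \<times> {Suc (length z)}"
  proof -
    have "collapse (length ([Some i] @ z)) p \<in> {i, Suc i} \<times> {Suc (length z)}"
      using p by (auto simp: collapse_def)
    from island_double_turn [OF assms(1-3) this] show ?thesis by simp
  qed
  also have "\<dots> \<longleftrightarrow> c \<in> {i, Suc i} \<times> {Suc (length z), Suc (Suc (length z))}"
  proof -
    obtain q l where "c = (q, l)" by force
    then show ?thesis using assms(1,2) by (auto simp: collapse_def points_def split: if_splits)
  qed
  finally show ?thesis .
qed

section \<open>Rotating a diagram and adding a string\<close>

lemma models_rotate:
  assumes "r # z \<in> flats b"
  shows "models (points b (Suc (length z))) (\<lambda>(p, l). (p, if l = 0 then length z else l - 1))
    (conn b (r # z)) (conn b (z @ [r]))"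
proof -
  define n where "n = length z"
  \<comment> \<open>Without the front letter every level of \<open>z\<close> counts one less. Level
    0 of the rotated diagram lies below \<open>r\<close>, and the level below \<open>r\<close> in
    \<open>r # z\<close> is \<open>n\<close>.\<close>
  define f :: "point \<Rightarrow> point" where "f = (\<lambda>(p, l). (p, if l = 0 then n else l - 1))"
  define g :: "point \<Rightarrow> point" where "g = (\<lambda>(p, l). (p, if l = Suc n then Suc 0 else Suc l))"
  have fl: "z @ [r] \<in> flats b" "z \<in> flats b" using assms by auto
  have fp: "f u \<in> points b (Suc n)" "g u \<in> points b (Suc n)" if "u \<in> points b (Suc n)" for u
    using that by (auto simp: f_def g_def points_def)
  have rf: "conn b (r # z) u u" "conn b (z @ [r]) u u" if "u \<in> points b (Suc n)" for u
    using that by (auto intro: conn_refl simp: n_def)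
  have rz: "conn b (r # z) u v" if "letter_link b r n u v \<or> (\<exists>l<n. letter_link b (rev z ! l) l u v)" for u v
    by (rule strands_conn [OF _ assms], unfold strands.simps) (use that in \<open>simp add: n_def strands_nth\<close>)
  have zr: "conn b (z @ [r]) u v" if "letter_link b r 0 u v \<or> (\<exists>l<n. letter_link b (rev z ! l) (Suc l) u v)" for u v
    by (rule strands_conn [OF _ fl(1)]) (use that in \<open>auto simp: strands_append n_def\<close>)
  have cl: "conn b (r # z) (p, Suc n) (p, 0)" "conn b (z @ [r]) (p, Suc n) (p, 0)" if "p \<in> {1..b}" for p
    using closing_conn [OF assms that] closing_conn [OF fl(1) that] by (simp_all add: n_def)
  have F: "conn b (r # z) (f a) (f c)" if "conn b (z @ [r]) a c" for a c
  proof (rule conn_map [OF that per_conn])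
    show "conn b (r # z) (f u) (f u)" if "u \<in> points b (length (z @ [r]))" for u
      using rf fp that by (simp add: n_def)
    fix u v assume uv: "link b (z @ [r]) u v"
    then consider l where "l < n" "letter_link b (rev z ! l) (Suc l) u v" | "letter_link b r 0 u v"
      | p where "p \<in> {1..b}" "u = (p, Suc n)" "v = (p, 0)"
      unfolding link_append n_def by (auto simp: link_def)
    then show "conn b (r # z) (f u) (f v)"
    proof cases
      case 1
      then have "letter_link b (rev z ! l) l (f u) (f v)" by (auto simp: letter_link_def f_def)
      then show ?thesis using rz 1 by blast
    next
      case 2
      have uv: "u \<in> points b 1" "v \<in> points b 1"
        using letter_link_points [OF 2] assms by simp_all
      \<comment> \<open>\<open>h\<close> is the literal translation of the letter \<open>r\<close>
        to the front. It differs from \<open>f\<close> at level 1 only, which goes to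
        \<open>Suc n\<close> instead of 0, and the closing arcs join these two levels.\<close>
      define h :: "point \<Rightarrow> point" where "h = (\<lambda>(p, l). (p, if l = 0 then n else Suc n))"
      have "letter_link b r n (h u) (h v)" using 2 by (auto simp: letter_link_def h_def)
      then have "conn b (r # z) (h u) (h v)" using rz by blast
      moreover have "conn b (r # z) (h w) (f w)" if "w \<in> points b 1" for w
        using that cl(1) rf(1) by (auto simp: h_def f_def points_def le_Suc_eq)
      ultimately show ?thesis using uv conn_trans conn_sym by metis
    next
      case 3
      then show ?thesis using rf(1) by (auto simp: f_def points_def)
    qed
  qed
  have G: "conn b (z @ [r]) (g a) (g c)" if "conn b (r # z) a c" for a c
  proof (rule conn_map [OF that per_conn])
    show "conn b (z @ [r]) (g u) (g u)" if "u \<in> points b (length (r # z))" for u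
      using rf fp that by (simp add: n_def)
    fix u v assume uv: "link b (r # z) u v"
    then consider l where "l < n" "letter_link b (rev z ! l) l u v" | "letter_link b r n u v"
      | p where "p \<in> {1..b}" "u = (p, Suc n)" "v = (p, 0)"
      unfolding link_def strands.simps unfolding strands_nth n_def by auto
    then show "conn b (z @ [r]) (g u) (g v)"
    proof cases
      case 1
      then have "letter_link b (rev z ! l) (Suc l) (g u) (g v)"
        unfolding letter_link_def g_def by auto
      then show ?thesis using zr 1 by blast
    next
      case 2
      have uv: "u \<in> {1..b} \<times> {n, Suc n}" "v \<in> {1..b} \<times> {n, Suc n}"
        using letter_link_points [OF 2] 2 assms by (auto simp: letter_link_def points_def)
      define h :: "point \<Rightarrow> point" where "h = (\<lambda>(p, l). (p, if l = n then 0 else Suc 0))"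
      have "letter_link b r 0 (h u) (h v)" using 2 by (auto simp: letter_link_def h_def)
      then have "conn b (z @ [r]) (h u) (h v)" using zr by blast
      moreover have "conn b (z @ [r]) (g w) (h w)" if "w \<in> {1..b} \<times> {n, Suc n}" for w
        using that cl(2) rf(2) by (auto simp: h_def g_def points_def)
      ultimately show ?thesis using uv conn_trans conn_sym by metis
    next
      case 3
      then show ?thesis using rf(2) by (auto simp: g_def points_def)
    qed
  qed
  have GF: "conn b (z @ [r]) u (g (f u))" if "u \<in> points b (Suc n)" for u
    using that cl(2) rf(2) conn_sym by (auto simp: f_def g_def points_def)
  have "conn b (z @ [r]) a c \<longleftrightarrow> conn b (r # z) (f a) (f c)"
    if "a \<in> points b (Suc n)" "c \<in> points b (Suc n)" for a c
    using F [of a c] conn_trans [OF conn_trans [OF GF [OF that(1)] G [of "f a" "f c"]] conn_sym [OF GF [OF that(2)]]]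
    by blast
  moreover have "\<exists>q \<in> points b (Suc n). conn b (z @ [r]) a q" if "conn b (z @ [r]) a a" for a
    using conn_points [OF that] that by (auto simp: n_def)
  ultimately show ?thesis unfolding models_def f_def n_def using per_conn by blast
qed

lemma strands_mono:
  assumes "z \<in> flats b"
  shows "strands (Suc b) z u v \<longleftrightarrow> strands b z u v
    \<or> (\<exists>l < length z. u = (Suc b, Suc l) \<and> v = (Suc b, l))"
proof -
  have "letter_link (Suc b) (rev z ! l) l u v \<longleftrightarrow>
      letter_link b (rev z ! l) l u v \<or> u = (Suc b, Suc l) \<and> v = (Suc b, l)" if "l < length z" for l
    using rev_nth_flats [OF assms that] unfolding letter_link_def by (fastforce simp: le_Suc_eq)
  then show ?thesis unfolding strands_nth by blast
qed

lemma extra_strand: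
  assumes z: "z \<in> flats b"
  shows "extra_circle ({Suc b} \<times> {0..length z}) (conn (Suc b) z) (conn b z)"
proof -
  define D :: "point set" where "D = {Suc b} \<times> {0..length z}"
  have z': "z \<in> flats (Suc b)" using z by (auto simp: flats_def)
  have low: "u \<notin> D \<and> v \<notin> D" if "link b z u v" for u v
    using link_points [OF that z] by (auto simp: D_def points_def)
  have link: "link (Suc b) z u v \<longleftrightarrow> link b z u v \<or> (\<exists>l < length z. u = (Suc b, Suc l) \<and> v = (Suc b, l))
     \<or> u = (Suc b, length z) \<and> v = (Suc b, 0)" for u v
    unfolding link_def strands_mono [OF z] by (auto simp: le_Suc_eq)
  have closed: "u \<in> D \<longleftrightarrow> v \<in> D" if "link (Suc b) z u v" for u v
    using that low [of u v] unfolding link by (auto simp: D_def)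
  have "conn (Suc b) z (Suc b, l) (Suc b, 0)" if "l \<le> length z" for l
    using that
  proof (induction l)
    case 0
    then show ?case by (intro conn_refl) (auto simp: points_def)
  next
    case (Suc l)
    then have "conn (Suc b) z (Suc b, Suc l) (Suc b, l)" by (intro link_conn [OF _ z']) (simp add: link)
    with Suc show ?case using conn_trans by (metis Suc_leD)
  qed
  then have "conn (Suc b) z u (Suc b, 0)" if "u \<in> D" for u
    using that by (auto simp: D_def)
  then have D: "conn (Suc b) z u v" if "u \<in> D" "v \<in> D" for u v
    using conn_trans [OF _ conn_sym] that by blast
  have "conn (Suc b) z a c \<longleftrightarrow> c \<in> D" if "a \<in> D" for a c
    using conn_closed [OF _ that closed] D that by blast
  moreover have "conn (Suc b) z a c \<longleftrightarrow> conn b z a c" if "a \<notin> D" "c \<notin> D" for a c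
  proof
    show "conn (Suc b) z a c" if "conn b z a c"
    proof (rule conn_map [OF that per_conn, where f = id, simplified])
      show "conn (Suc b) z u u" if "u \<in> points b (length z)" for u
        using that by (intro conn_refl) (auto simp: points_def)
      show "conn (Suc b) z u v" if "link b z u v" for u v
        using that by (intro link_conn [OF _ z']) (simp add: link)
    qed
    assume ac: "conn (Suc b) z a c"
    then have eq: "equivclp (link (Suc b) z) a c" and a: "a \<in> points b (length z)"
      using \<open>a \<notin> D\<close> by (auto simp: conn_def points_def D_def le_Suc_eq)
    from eq show "conn b z a c"
    proof (induction rule: equivclp_induct)
      case base
      then show ?case using a by (rule conn_refl)
    next
      case (step u v)
      then have "u \<notin> D" using conn_points [of b z a u] by (auto simp: points_def D_def)
      with step(2) have "link b z u v \<or> link b z v u" unfolding link by (auto simp: D_def)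
      then have "conn b z u v" using link_conn [OF _ z] conn_sym by blast
      with step(3) show ?case by (rule conn_trans)
    qed
  qed
  ultimately show ?thesis by (simp add: extra_circle_def D_def)
qed


section \<open>Cocycles detecting the transverse element, and Reidemeister II\<close>

text \<open>Diagrams behind a prefix \<open>p\<close> that is already resolved. A local move changes
  \<open>p\<close> only, and the cube of the remaining word is carried along.\<close>

definition fam :: "nat \<Rightarrow> flat \<Rightarrow> flat \<Rightarrow> point \<Rightarrow> point \<Rightarrow> bool" where
  "fam b p z = conn b (p @ z)"

text \<open>The monomial of psi, with one factor on each string. Its points are at level 0 because
  this level belongs to every tail, so local moves at the front leave the monomial
  unchanged.\<close>

definition strand_tops :: "nat \<Rightarrow> point multiset" where
  "strand_tops b = image_mset (\<lambda>p. (p, 0)) (mset_set {1..b})"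

definition psi_detected :: "nat \<Rightarrow> braid_word \<Rightarrow> bool" where
  "psi_detected b w \<longleftrightarrow> (\<exists>\<Phi>. compat_family (conn b) w \<Phi> \<and> (\<forall>z. vertex w z \<longrightarrow> delta (conn b) w \<Phi> z = 0)
     \<and> \<Phi> (replicate (length w) None) (strand_tops b) = 1)"

lemma psi_detectedI:
  assumes "compat_family (conn b) w \<Phi>" "\<And>z. vertex w z \<Longrightarrow> delta (conn b) w \<Phi> z = 0"
    and "\<Phi> (replicate (length w) None) (strand_tops b) = 1"
  shows "psi_detected b w"
  using assms unfolding psi_detected_def by blast

lemma psi_detectedE:
  assumes "psi_detected b w"
  obtains \<Phi> where "compat_family (conn b) w \<Phi>" "\<And>z. vertex w z \<Longrightarrow> delta (conn b) w \<Phi> z = 0"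
    "\<Phi> (replicate (length w) None) (strand_tops b) = 1"
  using assms unfolding psi_detected_def by blast

lemma vertex_oriented: "vertex w (replicate (length w) None)"
  by (induction w) (auto simp: zero_res_def one_res_def)

lemma strand_tops_points: "set_mset (strand_tops b) \<subseteq> points b n"
  by (auto simp: strand_tops_def points_def)

lemma per_fam: "per (fam b p z)"
  unfolding fam_def by (rule per_conn)

lemma fam_Nil: "fam b [] = conn b"
  by (simp add: fam_def fun_eq_iff)

lemma conn_fam1: "conn b (r # z) = fam b [r] z"
  and conn_fam2: "conn b (r # r' # z) = fam b [r, r'] z"
  and conn_fam3: "conn b (r # r' # r'' # z) = fam b [r, r', r''] z"
  by (simp_all add: fam_def)

definition turn :: "nat \<Rightarrow> nat \<Rightarrow> nat \<Rightarrow> flat \<Rightarrow> flat \<Rightarrow> bool" where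
  "turn b i k p p' \<longleftrightarrow> 1 \<le> i \<and> i < b \<and> p \<in> flats b \<and> p' \<in> flats b
     \<and> (\<exists>x y. length y = k \<and> (p = x @ None # y \<and> p' = x @ Some i # y \<or> p = x @ Some i # y \<and> p' = x @ None # y))"

lemma turnI1:
  assumes "1 \<le> i" "i < b" "x @ y \<in> flats b"
  shows "turn b i (length y) (x @ None # y) (x @ Some i # y)"
  using assms unfolding turn_def by auto

lemma turnI2:
  assumes "1 \<le> i" "i < b" "x @ y \<in> flats b"
  shows "turn b i (length y) (x @ Some i # y) (x @ None # y)"
  using assms unfolding turn_def by auto

lemma edge_turn:
  assumes "turn b i k p p'" "z \<in> flats b"
  shows "edge (fam b p z) (fam b p' z) (i, Suc (k + length z)) (Suc i, k + length z)"
proof -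
  from assms(1) obtain x y where xy: "length y = k" "x @ y @ z \<in> flats b" "1 \<le> i" "i < b"
    and p: "p = x @ None # y \<and> p' = x @ Some i # y \<or> p = x @ Some i # y \<and> p' = x @ None # y"
    using assms(2) unfolding turn_def by auto
  have "edge (conn b (x @ None # (y @ z))) (conn b (x @ Some i # (y @ z)))
      (i, Suc (length (y @ z))) (Suc i, length (y @ z))"
    using xy by (intro edge_conn)
  with p show ?thesis
  proof (elim disjE conjE)
    assume e: "edge (conn b (x @ None # (y @ z))) (conn b (x @ Some i # (y @ z)))
      (i, Suc (length (y @ z))) (Suc i, length (y @ z))"
    { assume "p = x @ None # y" "p' = x @ Some i # y"
      with e xy(1) show ?thesis by (simp add: fam_def) }
    { assume "p = x @ Some i # y" "p' = x @ None # y"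
      with e xy(1) show ?thesis by (subst edge_sym) (simp add: fam_def) }
  qed
qed

lemma turns2:
  assumes "1 \<le> i" "i < b" "r \<in> {None, Some i}"
  shows "turn b i 1 [None, r] [Some i, r]" "turn b i 1 [Some i, r] [None, r]"
    "turn b i 0 [r, None] [r, Some i]" "turn b i 0 [r, Some i] [r, None]"
  using assms turnI1 [of i b "[]" "[r]"] turnI2 [of i b "[]" "[r]"]
    turnI1 [of i b "[r]" "[]"] turnI2 [of i b "[r]" "[]"] by auto

lemma turns3:
  assumes "1 \<le> i" "i < b" "[r, r'] \<in> flats b"
  shows "turn b i 2 [None, r, r'] [Some i, r, r']" "turn b i 2 [Some i, r, r'] [None, r, r']"
    "turn b i 1 [r, None, r'] [r, Some i, r']" "turn b i 1 [r, Some i, r'] [r, None, r']"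
    "turn b i 0 [r, r', None] [r, r', Some i]" "turn b i 0 [r, r', Some i] [r, r', None]"
  using assms turnI1 [of i b "[]" "[r, r']"] turnI2 [of i b "[]" "[r, r']"]
    turnI1 [of i b "[r]" "[r']"] turnI2 [of i b "[r]" "[r']"]
    turnI1 [of i b "[r, r']" "[]"] turnI2 [of i b "[r, r']" "[]"] by (auto simp: numeral_2_eq_2)

section \<open>The oriented resolution\<close>

lemma conn_oriented:
  assumes "conn b (replicate m None) a c"
  shows "fst a = fst c"
proof -
  have "c \<in> {c. fst c = fst a}"
  proof (rule conn_closed [OF assms])
    show "u \<in> {c. fst c = fst a} \<longleftrightarrow> v \<in> {c. fst c = fst a}" if "link b (replicate m None) u v" for u v
      using that unfolding link_def strands_nth letter_link_def by auto
  qed simp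
  then show ?thesis by simp
qed

lemma oriented_conn:
  assumes "p \<in> {1..b}" "l \<le> m"
  shows "conn b (replicate m None) (p, l) (p, 0)"
  using assms(2)
proof (induction l)
  case 0
  then show ?case using assms by (intro conn_refl) (auto simp: points_def)
next
  case (Suc l)
  then have "conn b (replicate m None) (p, Suc l) (p, l)"
    using assms by (intro strands_conn, unfold strands_nth, intro exI [of _ l]) (auto simp: letter_link_def flats_def)
  with Suc show ?case using conn_trans by (metis Suc_leD)
qed

lemma strand_tops_double:
  assumes "compat E \<Psi>" "E (p, 0) (q, 0)" "p \<noteq> q" "p \<in> {1..b}" "q \<in> {1..b}"
  shows "\<Psi> (strand_tops b) = 0"
proof -
  have "mset_set {1..b} = add_mset p (add_mset q (mset_set ({1..b} - {p} - {q})))"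
    using mset_set.remove [of "{1..b}" p] mset_set.remove [of "{1..b} - {p}" q] assms(3-5) by auto
  then show ?thesis
    using compat_square [OF assms(1,2)]
    by (simp add: strand_tops_def mark_def fun_eq_iff pointwise add_mset_commute)
qed

text \<open>Turning one letter of the oriented resolution fuses two strings, so the monomial of psi
  acquires a square and is killed. Hence a correction that comes from a neighbouring vertex does not
  alter the value on psi.\<close>

lemma saddle_oriented:
  assumes "turn b i k (replicate m None) p'" "compat (fam b p' (replicate n None)) \<Psi>"
  shows "saddle (fam b (replicate m None) (replicate n None)) (fam b p' (replicate n None)) \<Psi> (strand_tops b) = 0"
proof -
  let ?z = "replicate n None"
  have e: "edge (fam b (replicate m None) ?z) (fam b p' ?z) (i, Suc (k + n)) (Suc i, k + n)"
    using edge_turn [OF assms(1), of ?z] by (simp add: flats_def)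
  have F: "fam b (replicate m None) ?z = conn b (replicate (m + n) None)"
    by (simp add: fam_def replicate_add)
  have k: "k < m" "1 \<le> i" "i < b"
  proof -
    from assms(1) obtain x y where "length y = k" "replicate m None = x @ None # y \<or> replicate m None = x @ Some i # y"
      unfolding turn_def by metis
    then have "m = length x + Suc k" by (metis length_append length_Cons length_replicate)
    then show "k < m" by simp
    show "1 \<le> i" "i < b" using assms(1) by (auto simp: turn_def)
  qed
  have "\<not> fam b (replicate m None) ?z (i, Suc (k + n)) (Suc i, k + n)"
    unfolding F using conn_oriented by fastforce
  with e have m: "merges (fam b (replicate m None) ?z) (fam b p' ?z) (i, Suc (k + n)) (Suc i, k + n)"
    and n: "fam b p' ?z (i, Suc (k + n)) (Suc i, k + n)"
    by (auto elim: edge_cases)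
  have s: "saddle (fam b (replicate m None) ?z) (fam b p' ?z) \<Psi> = \<Psi>"
    by (rule saddle_merge [OF e n]) fact
  have "fam b p' ?z (i, Suc (k + n)) (i, 0)" "fam b p' ?z (Suc i, k + n) (Suc i, 0)"
    using k by (auto intro!: merges_mono [OF m] simp: F oriented_conn)
  then have "fam b p' ?z (i, 0) (Suc i, 0)"
    using n conn_trans [OF conn_trans [OF conn_sym]] unfolding fam_def by blast
  with s show ?thesis using strand_tops_double [OF assms(2)] k by auto
qed

text \<open>In the abbreviations, \<open>S\<close> is the saddle that pulls cochains from the prefix
  \<open>p'\<close> back to \<open>p\<close>, and \<open>T\<close> is the transfer to a new prefix
  along the points of the tail. \<open>T\<close> names the new prefix only, because its source
  enters through the functional alone.\<close>

locale word =
  fixes b :: nat and w :: braid_word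
  assumes w: "w \<in> braid_words b"
begin

abbreviation "d p \<Phi> z \<equiv> delta (fam b p) w \<Phi> z"
abbreviation "S p p' z \<Psi> \<equiv> saddle (fam b p z) (fam b p' z) \<Psi>"
abbreviation "T p z \<Psi> \<equiv> transfer (fam b p z) (points b (length w)) (\<lambda>a. a) \<Psi>"
abbreviation "cf p \<Phi> \<equiv> compat_family (fam b p) w \<Phi>"

lemma vf: "vertex w z \<Longrightarrow> z \<in> flats b"
  using vertex_flats w by blast

lemma cub: "p \<in> flats b \<Longrightarrow> cubical (fam b p) w (corners w)"
  unfolding fam_def [abs_def] using cubical_conn w by blast

lemma edge: "turn b i k p p' \<Longrightarrow> vertex w z \<Longrightarrow>
    edge (fam b p z) (fam b p' z) (i, Suc (k + length w)) (Suc i, k + length w)"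
  using edge_turn [of b i k p p' z] by (simp add: vf vertex_length)

lemma cfD: "cf p \<Phi> \<Longrightarrow> vertex w z \<Longrightarrow> compat (fam b p z) (\<Phi> z)"
  by (simp add: compat_family_def)

lemma cfI: "(\<And>z. vertex w z \<Longrightarrow> compat (fam b p z) (\<Phi> z)) \<Longrightarrow> cf p \<Phi>"
  by (simp add: compat_family_def)

lemma cS: "turn b i k p p' \<Longrightarrow> vertex w z \<Longrightarrow> compat (fam b p' z) \<Psi> \<Longrightarrow> compat (fam b p z) (S p p' z \<Psi>)"
  using compat_saddle edge by metis

lemma mod: "agree b p p' \<Longrightarrow> reaches b p' \<Longrightarrow> vertex w z \<Longrightarrow>
    models (points b (length w)) (\<lambda>a. a) (fam b p z) (fam b p' z)"
  using models_conn [of b p p' z] vf vertex_length unfolding fam_def by metis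

lemma cT: "agree b p p' \<Longrightarrow> reaches b p' \<Longrightarrow> vertex w z \<Longrightarrow> compat (fam b p z) \<Psi> \<Longrightarrow> compat (fam b p' z) (T p' z \<Psi>)"
  using compat_transfer mod by metis

lemma d_S:
  assumes "turn b i k p p'" "cf p' \<Phi>" "vertex w z"
  shows "d p (\<lambda>z. S p p' z (\<Phi> z)) z = S p p' z (d p' \<Phi> z)"
  by (rule delta_saddle [OF cub cub edge [OF assms(1)] assms(2,3)])
    (use assms(1) in \<open>auto simp: turn_def\<close>)

lemma d_T:
  assumes "agree b p p'" "reaches b p'" "p \<in> flats b" "p' \<in> flats b" "cf p \<Phi>" "vertex w z"
  shows "d p' (\<lambda>z. T p' z (\<Phi> z)) z = T p' z (d p \<Phi> z)"
  by (rule delta_transfer [OF cub cub mod]) (use assms in auto)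

lemma S_T:
  assumes "turn b i k p q" "turn b i' k' p' q'" "agree b p p'" "agree b q q'" "reaches b p'" "reaches b q'"
    and "compat (fam b q z) \<Psi>" "vertex w z"
  shows "S p' q' z (T q' z \<Psi>) = T p' z (S p q z \<Psi>)"
  by (rule saddle_transfer [OF edge edge mod mod]) (use assms in auto)

lemma T_self:
  assumes "reaches b p" "compat (fam b p z) \<Psi>" "vertex w z"
  shows "T p z \<Psi> = \<Psi>"
  by (rule transfer_unique [OF mod]) (use assms in \<open>auto simp: agrees_def agree_refl\<close>)

lemma T_agrees:
  assumes "agree b p p'" "reaches b p'" "compat (fam b p z) \<Psi>" "vertex w z"
    and "set_mset M \<subseteq> points b (length w)"
  shows "T p' z \<Psi> M = \<Psi> M"
  using agrees_transfer [OF mod [OF assms(1,2,4)] assms(3)] assms(5) by (simp add: agrees_def)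

lemma T_tops:
  "agree b p p' \<Longrightarrow> reaches b p' \<Longrightarrow> compat (fam b p z) \<Psi> \<Longrightarrow> vertex w z \<Longrightarrow>
    T p' z \<Psi> (strand_tops b) = \<Psi> (strand_tops b)"
  by (rule T_agrees) (simp_all add: strand_tops_points)

lemma T_unique:
  assumes "agree b p p'" "reaches b p'" "compat (fam b p z) \<Psi>" "compat (fam b p' z) \<Theta>" "vertex w z"
    and "\<And>M. set_mset M \<subseteq> points b (length w) \<Longrightarrow> \<Theta> M = \<Psi> M"
  shows "T p' z \<Psi> = \<Theta>"
  by (rule transfer_unique [OF mod]) (use assms in \<open>auto simp: agrees_def\<close>)

lemma T_T:
  assumes "agree b p p'" "reaches b p'" "agree b p' p''" "reaches b p''"
    and "compat (fam b p z) \<Psi>" "vertex w z"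
  shows "T p'' z (T p' z \<Psi>) = T p'' z \<Psi>"
  using assms
  by (intro T_unique [of p' p''] cT [of p p''] cT [of p p'])
    (auto simp: T_agrees [of p p'] T_agrees [of p p''] agree_trans [of b p p' p''])

lemma S_S:
  assumes "turn b i k p00 p10" "turn b i k p01 p11" "turn b i' k' p00 p01" "turn b i' k' p10 p11"
    and "compat (fam b p11 z) \<Psi>" "vertex w z"
  shows "S p00 p10 z (S p10 p11 z \<Psi>) = S p00 p01 z (S p01 p11 z \<Psi>)"
  by (rule saddle_commute [OF edge edge edge edge]) (use assms in auto)

section \<open>Fusing and splitting off a closed circle\<close>

lemma island_turn:
  assumes t: "turn b i k p q" and v: "vertex w z" and D: "\<And>u c. u \<in> D \<Longrightarrow> fam b p z u c \<longleftrightarrow> c \<in> D"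
    and x: "(i, Suc (k + length w)) \<in> D \<longleftrightarrow> (Suc i, k + length w) \<notin> D"
  shows "extra_circle D (fam b p z) (fam b q z)" "fam b q z (i, Suc (k + length w)) (Suc i, k + length w)"
proof -
  have e: "edge (fam b p z) (fam b q z) (i, Suc (k + length w)) (Suc i, k + length w)" using edge [OF t v] .
  have n: "\<not> fam b p z (i, Suc (k + length w)) (Suc i, k + length w)"
    using D x per_conn unfolding fam_def by (metis per_sym)
  with e have m: "merges (fam b p z) (fam b q z) (i, Suc (k + length w)) (Suc i, k + length w)"
    and "fam b q z (i, Suc (k + length w)) (Suc i, k + length w)"
    by (auto elim: edge_cases)
  then show "fam b q z (i, Suc (k + length w)) (Suc i, k + length w)" by blast
  show "extra_circle D (fam b p z) (fam b q z)"
  proof (cases "(i, Suc (k + length w)) \<in> D")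
    case True
    then show ?thesis using split_off_circle [OF m, of D] D by blast
  next
    case False
    then have "(Suc i, k + length w) \<in> D" using x by blast
    moreover have "merges (fam b p z) (fam b q z) (Suc i, k + length w) (i, Suc (k + length w))"
      using m join_commute per_conn unfolding merges_def fam_def by (metis per_sym)
    ultimately show ?thesis using split_off_circle D by metis
  qed
qed

text \<open>\<open>p\<close> contains the closed circle \<open>D\<close>, and in \<open>q\<close> it
  is fused with another strand. The first claim is the counit law for splitting \<open>D\<close>
  off; the second says that a merge is the identity on polynomials.\<close>

lemma island_saddle:
  assumes t: "turn b i k p q" "turn b i k q p" and v: "vertex w z"
    and D: "\<And>u c. u \<in> D \<Longrightarrow> fam b p z u c \<longleftrightarrow> c \<in> D"
    and x: "(i, Suc (k + length w)) \<in> D \<longleftrightarrow> (Suc i, k + length w) \<notin> D" and c: "compat (fam b q z) \<Psi>"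
  shows "S q p z (add_circle D \<Psi>) = \<Psi>" "S p q z \<Psi> = \<Psi>" "compat (fam b p z) (add_circle D \<Psi>)"
proof -
  note ex = island_turn [OF t(1) v D x]
  have sym: "fam b q z (Suc i, k + length w) (i, Suc (k + length w))"
    using ex(2) unfolding fam_def by (rule conn_sym)
  show "S q p z (add_circle D \<Psi>) = \<Psi>"
  proof (cases "(i, Suc (k + length w)) \<in> D")
    case True
    then show ?thesis using saddle_off_circle [OF edge [OF t(2) v] ex(1) True _ ex(2) c] x by blast
  next
    case False
    then show ?thesis using saddle_off_circle [OF edge [OF t(2) v] ex(1) _ False sym c] x by blast
  qed
  have "\<not> fam b p z (i, Suc (k + length w)) (Suc i, k + length w)"
    using D x conn_sym unfolding fam_def by metis
  then show "S p q z \<Psi> = \<Psi>" using saddle_merge [OF edge [OF t(1) v] ex(2)] by blast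
  show "compat (fam b p z) (add_circle D \<Psi>)"
    by (rule compat_add_circle [OF ex(1) c]) (simp_all add: per_fam)
qed

lemma island2:
  assumes "1 \<le> i" "i < b" "vertex w z" "u \<in> {i, Suc i} \<times> {Suc (length w)}"
  shows "fam b [Some i, Some i] z u c \<longleftrightarrow> c \<in> {i, Suc i} \<times> {Suc (length w)}"
  using island_double_turn [OF assms(1,2) vf [OF assms(3)], of u c] assms(4) vertex_length [OF assms(3)]
  by (simp add: fam_def)

lemma island3:
  assumes "1 \<le> i" "i < b" "vertex w z" "u \<in> {i, Suc i} \<times> {Suc (length w), Suc (Suc (length w))}"
  shows "fam b [Some i, None, Some i] z u c \<longleftrightarrow> c \<in> {i, Suc i} \<times> {Suc (length w), Suc (Suc (length w))}"
  using island_spaced_turn [OF assms(1,2) vf [OF assms(3)], of u c] assms(4) vertex_length [OF assms(3)]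
  by (simp add: fam_def)

section \<open>Inserting a positive letter\<close>

lemma detected_insert:
  assumes i: "1 \<le> i" "i < b" and "psi_detected b w"
  shows "psi_detected b ((i, True) # w)"
proof -
  from assms(3) obtain \<Phi> where \<Phi>: "cf [] \<Phi>" "\<And>z. vertex w z \<Longrightarrow> d [] \<Phi> z = 0"
    "\<Phi> (replicate (length w) None) (strand_tops b) = 1"
    by (elim psi_detectedE) (auto simp: fam_Nil)
  have a: "agree b [] [None]" using agree_sym [OF agree_remove_None [of "[]" "[]" b]] by simp
  have r: "reaches b [None]" using reaches_add_None [of "[]" "[]" b] reaches_Nil by simp
  \<comment> \<open>Extension by 0: the turned resolution is the 1-resolution of a positive letter,
    so the only saddle term in the new coboundary is applied to 0. For a negative letter the given
    cocycle would itself be subjected to that saddle.\<close>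
  define \<Phi>' where "\<Phi>' zz = (if hd zz = None then T [None] (tl zz) (\<Phi> (tl zz)) else 0)" for zz
  show ?thesis
  proof (rule psi_detectedI)
    show "compat_family (conn b) ((i, True) # w) \<Phi>'"
      using cT [OF a r _ cfD [OF \<Phi>(1)]] unfolding compat_family_Cons
      by (auto simp: compat_family_def zero_res_def one_res_def \<Phi>'_def conn_fam1)
    fix zz assume "vertex ((i, True) # w) zz"
    then obtain z where z: "vertex w z" "zz = None # z \<or> zz = Some i # z"
      by (auto simp: vertex_Cons zero_res_def one_res_def)
    have "d [None] (\<lambda>z. T [None] z (\<Phi> z)) z = 0"
      using d_T [OF a r _ _ \<Phi>(1) z(1)] \<Phi>(2) [OF z(1)] by simp
    then show "delta (conn b) ((i, True) # w) \<Phi>' zz = 0"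
      using z(2) by (auto simp: zero_res_def one_res_def \<Phi>'_def conn_fam1 delta_zero)
  next
    show "\<Phi>' (replicate (length ((i, True) # w)) None) (strand_tops b) = 1"
      using T_tops [OF a r cfD [OF \<Phi>(1) vertex_oriented] vertex_oriented] \<Phi>(3) by (simp add: \<Phi>'_def)
  qed
qed

section \<open>Cubes over two letters and Reidemeister II\<close>

lemma detected2I:
  assumes cf: "\<And>r r'. r \<in> {zero_res c, one_res c} \<Longrightarrow> r' \<in> {zero_res c', one_res c'} \<Longrightarrow> cf [r, r'] (\<phi> [r, r'])"
    and e00: "\<And>z. vertex w z \<Longrightarrow>
      S [zero_res c, zero_res c'] [one_res c, zero_res c'] z (\<phi> [one_res c, zero_res c'] z)
      + (S [zero_res c, zero_res c'] [zero_res c, one_res c'] z (\<phi> [zero_res c, one_res c'] z)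
      + d [zero_res c, zero_res c'] (\<phi> [zero_res c, zero_res c']) z) = 0"
    and e10: "\<And>z. vertex w z \<Longrightarrow>
      S [one_res c, zero_res c'] [one_res c, one_res c'] z (\<phi> [one_res c, one_res c'] z)
      + d [one_res c, zero_res c'] (\<phi> [one_res c, zero_res c']) z = 0"
    and e01: "\<And>z. vertex w z \<Longrightarrow>
      S [zero_res c, one_res c'] [one_res c, one_res c'] z (\<phi> [one_res c, one_res c'] z)
      - d [zero_res c, one_res c'] (\<phi> [zero_res c, one_res c']) z = 0"
    and e11: "\<And>z. vertex w z \<Longrightarrow> d [one_res c, one_res c'] (\<phi> [one_res c, one_res c']) z = 0"
    and psi: "\<phi> [None, None] (replicate (length w) None) (strand_tops b) = 1"
  shows "psi_detected b (c # c' # w)"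
proof -
  define \<Phi> where "\<Phi> zz = \<phi> (take 2 zz) (drop 2 zz)" for zz
  have \<Phi>: "\<Phi> (r # r' # z) = \<phi> [r, r'] z" for r r' z by (simp add: \<Phi>_def numeral_2_eq_2)
  have eta: "(\<lambda>z. fam b p z) = fam b p" "(\<lambda>z. \<phi> p z) = \<phi> p" for p by simp_all
  show ?thesis
  proof (rule psi_detectedI)
    show "compat_family (conn b) (c # c' # w) \<Phi>"
      using cf unfolding compat_family_Cons by (simp add: \<Phi> conn_fam2)
    fix zz assume "vertex (c # c' # w) zz"
    then obtain r r' z where zz: "zz = r # r' # z" "r = zero_res c \<or> r = one_res c"
      "r' = zero_res c' \<or> r' = one_res c'" "vertex w z"
      by (auto simp: vertex_Cons)
    from zz(2,3) e00 [OF zz(4)] e10 [OF zz(4)] e01 [OF zz(4)] e11 [OF zz(4)]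
    show "delta (conn b) (c # c' # w) \<Phi> zz = 0"
      unfolding zz(1) by (elim disjE) (simp_all add: \<Phi> conn_fam2 algebra_simps)
  next
    show "\<Phi> (replicate (length (c # c' # w)) None) (strand_tops b) = 1"
      using psi by (simp add: \<Phi>)
  qed
qed

lemma detected2E:
  assumes "psi_detected b (c # c' # w)"
  obtains \<phi> where "\<And>r r'. r \<in> {zero_res c, one_res c} \<Longrightarrow> r' \<in> {zero_res c', one_res c'} \<Longrightarrow> cf [r, r'] (\<phi> [r, r'])"
    "\<And>z. vertex w z \<Longrightarrow>
      S [zero_res c, zero_res c'] [one_res c, zero_res c'] z (\<phi> [one_res c, zero_res c'] z)
      + (S [zero_res c, zero_res c'] [zero_res c, one_res c'] z (\<phi> [zero_res c, one_res c'] z)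
      + d [zero_res c, zero_res c'] (\<phi> [zero_res c, zero_res c']) z) = 0"
    "\<And>z. vertex w z \<Longrightarrow>
      S [one_res c, zero_res c'] [one_res c, one_res c'] z (\<phi> [one_res c, one_res c'] z)
      + d [one_res c, zero_res c'] (\<phi> [one_res c, zero_res c']) z = 0"
    "\<And>z. vertex w z \<Longrightarrow>
      S [zero_res c, one_res c'] [one_res c, one_res c'] z (\<phi> [one_res c, one_res c'] z)
      - d [zero_res c, one_res c'] (\<phi> [zero_res c, one_res c']) z = 0"
    "\<And>z. vertex w z \<Longrightarrow> d [one_res c, one_res c'] (\<phi> [one_res c, one_res c']) z = 0"
    "\<phi> [None, None] (replicate (length w) None) (strand_tops b) = 1"
proof -
  from assms obtain \<Phi> where \<Phi>: "compat_family (conn b) (c # c' # w) \<Phi>"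
    "\<And>z. vertex (c # c' # w) z \<Longrightarrow> delta (conn b) (c # c' # w) \<Phi> z = 0"
    "\<Phi> (replicate (length (c # c' # w)) None) (strand_tops b) = 1"
    by (elim psi_detectedE) blast
  define \<phi> where "\<phi> p z = \<Phi> (p @ z)" for p z
  have \<phi>: "\<Phi> (r # r' # z) = \<phi> [r, r'] z" for r r' z by (simp add: \<phi>_def)
  note \<Phi>' = \<Phi>(1) [unfolded compat_family_Cons] and e = \<Phi>(2) [of "r # r' # z" for r r' z]
  show thesis
  proof (rule that [of \<phi>])
    show "cf [r, r'] (\<phi> [r, r'])" if "r \<in> {zero_res c, one_res c}" "r' \<in> {zero_res c', one_res c'}" for r r'
      using \<Phi>' that by (auto simp: \<phi> conn_fam2)
    show "S [zero_res c, zero_res c'] [one_res c, zero_res c'] z (\<phi> [one_res c, zero_res c'] z)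
      + (S [zero_res c, zero_res c'] [zero_res c, one_res c'] z (\<phi> [zero_res c, one_res c'] z)
      + d [zero_res c, zero_res c'] (\<phi> [zero_res c, zero_res c']) z) = 0" if "vertex w z" for z
      using e [of "zero_res c" "zero_res c'" z] that by (simp add: \<phi> conn_fam2)
    show "d [one_res c, one_res c'] (\<phi> [one_res c, one_res c']) z = 0" if "vertex w z" for z
      using e [of "one_res c" "one_res c'" z] that by (simp add: \<phi> conn_fam2)
    show "S [one_res c, zero_res c'] [one_res c, one_res c'] z (\<phi> [one_res c, one_res c'] z)
      + d [one_res c, zero_res c'] (\<phi> [one_res c, zero_res c']) z = 0" if "vertex w z" for z
      using e [of "one_res c" "zero_res c'" z] that by (simp add: \<phi> conn_fam2 add_eq_0_iff)
    show "S [zero_res c, one_res c'] [one_res c, one_res c'] z (\<phi> [one_res c, one_res c'] z)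
      - d [zero_res c, one_res c'] (\<phi> [zero_res c, one_res c']) z = 0" if "vertex w z" for z
      using e [of "zero_res c" "one_res c'" z] that by (simp add: \<phi> conn_fam2)
    show "\<phi> [None, None] (replicate (length w) None) (strand_tops b) = 1"
      using \<Phi>(3) by (simp add: \<phi>)
  qed
qed

lemma agree_double:
  assumes i: "1 \<le> i" "i < b"
  shows "reaches b [None, None]" "reaches b [None, Some i]" "reaches b [Some i, None]"
    "agree b [] [None, None]" "agree b [None, None] []"
    "agree b [Some i, Some i] [None, Some i]" "agree b [Some i, Some i] [Some i, None]"
proof -
  have 1: "reaches b [None]" using reaches_add_None [of "[]" "[]" b] reaches_Nil by simp
  show "reaches b [None, None]" using reaches_add_None [of "[]" "[None]" b] 1 by simp
  show "reaches b [None, Some i]" using reaches_add_None [of "[]" "[Some i]" b] reaches_turn [OF i] i by simp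
  show "reaches b [Some i, None]" using reaches_add_None [of "[Some i]" "[]" b] reaches_turn [OF i] i by simp
  show n: "agree b [None, None] []"
    using agree_trans [OF agree_remove_None [of "[]" "[None]" b] agree_remove_None [of "[]" "[]" b]] by simp
  then show "agree b [] [None, None]" by (rule agree_sym)
  show "agree b [Some i, Some i] [None, Some i]"
    using agree_trans [OF agree_double_turn [OF i] agree_sym] agree_remove_None [of "[]" "[Some i]" b] i by simp
  show "agree b [Some i, Some i] [Some i, None]"
    using agree_trans [OF agree_double_turn [OF i] agree_sym] agree_remove_None [of "[Some i]" "[]" b] i by simp
qed

text \<open>For either sign \<open>A\<close> is the 00 vertex of the two crossings, while
  \<open>N\<close> and the resolution with the closed circle are the two middle vertices. The given
  cocycle is placed on \<open>N\<close>, and its saddle image \<open>\<theta>\<close> at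
  \<open>A\<close> has to be cancelled from the other middle vertex. There \<open>add_circle\<close>
  supplies a preimage of \<open>\<theta>\<close> under the transposed split.\<close>

lemma detected_cancel1:
  assumes i: "1 \<le> i" "i < b" and "psi_detected b w"
  shows "psi_detected b ((i, s) # (i, \<not> s) # w)"
proof -
  from assms(3) obtain \<Phi> where \<Phi>: "cf [] \<Phi>" "\<And>z. vertex w z \<Longrightarrow> d [] \<Phi> z = 0"
    "\<Phi> (replicate (length w) None) (strand_tops b) = 1"
    by (elim psi_detectedE) (auto simp: fam_Nil)
  note ag = agree_double [OF i]
  define A where "A = (if s then [None, Some i] else [Some i, None])"
  define k :: nat where "k = (if s then 1 else 0)"
  define k' :: nat where "k' = (if s then 0 else 1)"
  define N :: flat where "N = [None, None]"
  define D where "D = {i, Suc i} \<times> {Suc (length w)}"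
  have t: "turn b i k [Some i, Some i] A" "turn b i k A [Some i, Some i]" "turn b i k' A N"
    using turns2 [OF i] i by (auto simp: A_def k_def k'_def N_def)
  define \<theta> where "\<theta> z = S A N z (T N z (\<Phi> z))" for z
  have cN: "cf N (\<lambda>z. T N z (\<Phi> z))"
    using cT [OF ag(4,1)] cfD [OF \<Phi>(1)] by (auto simp: N_def intro!: cfI)
  have dN: "d N (\<lambda>z. T N z (\<Phi> z)) z = 0" if "vertex w z" for z
    using d_T [OF ag(4,1) _ _ \<Phi>(1) that] \<Phi>(2) [OF that] by (simp add: N_def)
  have c\<theta>: "cf A \<theta>" using cS [OF t(3)] cfD [OF cN] by (auto simp: \<theta>_def intro!: cfI)
  have d\<theta>: "d A \<theta> z = 0" if "vertex w z" for z
    unfolding \<theta>_def [abs_def] using d_S [OF t(3) cN that] dN [OF that] by simp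
  have isl: "\<And>z u c. vertex w z \<Longrightarrow> u \<in> D \<Longrightarrow> fam b [Some i, Some i] z u c \<longleftrightarrow> c \<in> D"
    unfolding D_def using island2 [OF i] by blast
  have x: "(i, Suc (k + length w)) \<in> D \<longleftrightarrow> (Suc i, k + length w) \<notin> D" by (simp add: D_def k_def)
  note ac = island_saddle [OF t(1,2) _ isl x cfD [OF c\<theta>]]
  have dC: "d [Some i, Some i] (\<lambda>z. add_circle D (\<theta> z)) z = 0" if "vertex w z" for z
  proof -
    have "d [Some i, Some i] (\<lambda>z. add_circle D (\<theta> z)) z = add_circle D (d A \<theta> z)"
      by (rule delta_add_circle [OF cub cub island_turn(1) [OF t(1) _ isl x] c\<theta> that]) (use t in \<open>auto simp: turn_def\<close>)
    with d\<theta> [OF that] show ?thesis by simp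
  qed
  \<comment> \<open>The minus sign produces the cancellation at \<open>A\<close>; both vertices with
    a single turn carry 0.\<close>
  define \<phi> where "\<phi> p z = (if p = N then T N z (\<Phi> z) else if p = [Some i, Some i] then - add_circle D (\<theta> z) else 0)" for p z
  have \<phi>: "\<phi> N = (\<lambda>z. T N z (\<Phi> z))" "\<phi> [Some i, Some i] = (\<lambda>z. - add_circle D (\<theta> z))"
    "\<phi> [None, Some i] = (\<lambda>z. 0)" "\<phi> [Some i, None] = (\<lambda>z. 0)"
    by (simp_all add: \<phi>_def fun_eq_iff N_def)
  have c\<phi>: "cf N (\<phi> N)" "cf [Some i, Some i] (\<phi> [Some i, Some i])"
    "cf [None, Some i] (\<phi> [None, Some i])" "cf [Some i, None] (\<phi> [Some i, None])"
    unfolding \<phi> using cN ac(3) by (auto intro!: cfI compat_minus)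
  have main: "S A [Some i, Some i] z (\<phi> [Some i, Some i] z) + S A N z (\<phi> N z) = 0" if "vertex w z" for z
    unfolding \<phi> using ac(1) [OF that that] that by (simp add: saddle_minus \<theta>_def)
  have dd: "d N (\<phi> N) z = 0" "d [Some i, Some i] (\<phi> [Some i, Some i]) z = 0" if "vertex w z" for z
    unfolding \<phi> using dN dC that by (simp_all add: delta_minus)
  have psi: "\<phi> [None, None] (replicate (length w) None) (strand_tops b) = 1"
    using T_tops [OF ag(4,1) cfD [OF \<Phi>(1) vertex_oriented] vertex_oriented] \<Phi>(3) \<phi>(1) by (simp add: N_def)
  show ?thesis
  proof (rule detected2I [where \<phi> = \<phi>])
    show "\<phi> [None, None] (replicate (length w) None) (strand_tops b) = 1" by (rule psi)
  qed (use c\<phi> main dd in \<open>cases s; auto simp: zero_res_def one_res_def N_def A_def \<phi>(3,4) delta_zero add_ac\<close>)+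
qed

text \<open>Here \<open>B\<close> is the 11 vertex. The saddle from \<open>C\<close> to
  \<open>B\<close> merges the closed circle and is the identity on cochains, so the equation at
  \<open>C\<close> says that the value at \<open>B\<close> is, up to sign, the coboundary of
  \<open>\<theta>\<close>, the value at \<open>C\<close> with the closed circle forgotten. Adding
  the saddle image of \<open>\<theta>\<close> therefore makes the value at \<open>N\<close>
  closed.\<close>

lemma detected_cancel2:
  assumes i: "1 \<le> i" "i < b" and "psi_detected b ((i, s) # (i, \<not> s) # w)"
  shows "psi_detected b w"
proof -
  define A where "A = (if s then [None, Some i] else [Some i, None])"
  define B where "B = (if s then [Some i, None] else [None, Some i])"
  define k :: nat where "k = (if s then 0 else 1)"
  define k' :: nat where "k' = (if s then 1 else 0)"
  define N :: flat where "N = [None, None]"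
  define C where "C = [Some i, Some i]"
  \<comment> \<open>The sign depends on which of \<open>C\<close> and \<open>N\<close> is the vertex
    10 and which is 01; \<open>sg\<close> treats both orders of the two letters at once.\<close>
  define sg :: "point functional \<Rightarrow> point functional" where "sg x = (if s then x else - x)" for x
  obtain \<phi> where c: "cf N (\<phi> N)" "cf C (\<phi> C)" "cf B (\<phi> B)"
    and e: "\<And>z. vertex w z \<Longrightarrow> S C B z (\<phi> B z) = - sg (d C (\<phi> C) z)"
    "\<And>z. vertex w z \<Longrightarrow> S N B z (\<phi> B z) = sg (d N (\<phi> N) z)"
    and psi: "\<phi> N (replicate (length w) None) (strand_tops b) = 1"
  proof (rule detected2E [OF assms(3)], goal_cases)
    case (1 \<phi>)
    show ?case
    proof (rule 1(1) [of \<phi>])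
      show "cf N (\<phi> N)" "cf C (\<phi> C)" "cf B (\<phi> B)"
        using 1(2) [of None None] 1(2) [of "Some i" "Some i"] 1(2) [of None "Some i"] 1(2) [of "Some i" None]
        by (cases s; simp add: zero_res_def one_res_def N_def C_def B_def)+
      show "S C B z (\<phi> B z) = - sg (d C (\<phi> C) z)" "S N B z (\<phi> B z) = sg (d N (\<phi> N) z)" if "vertex w z" for z
        using 1(4) [OF that] 1(5) [OF that]
        by (cases s; simp add: zero_res_def one_res_def N_def C_def B_def sg_def add_eq_0_iff2)+
      show "\<phi> N (replicate (length w) None) (strand_tops b) = 1" using 1(7) by (simp add: N_def)
    qed
  qed
  note ag = agree_double [OF i]
  have rB: "reaches b B" and aB: "agree b C B" using ag by (auto simp: B_def C_def)
  have fl: "N \<in> flats b" "B \<in> flats b" "C \<in> flats b" using i by (auto simp: N_def B_def C_def)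
  have t: "turn b i k C B" "turn b i k B C" "turn b i k' N B"
    using turns2 [OF i] i by (auto simp: B_def C_def k_def k'_def N_def)
  define D where "D = {i, Suc i} \<times> {Suc (length w)}"
  have isl: "\<And>z u c. vertex w z \<Longrightarrow> u \<in> D \<Longrightarrow> fam b C z u c \<longleftrightarrow> c \<in> D"
    unfolding D_def C_def using island2 [OF i] by blast
  have x: "(i, Suc (k + length w)) \<in> D \<longleftrightarrow> (Suc i, k + length w) \<notin> D" by (simp add: D_def k_def)
  define \<theta> where "\<theta> z = T B z (\<phi> C z)" for z
  have c\<theta>: "cf B \<theta>" unfolding \<theta>_def using cT [OF aB rB] cfD [OF c(2)] by (auto intro!: cfI)
  have sgT: "T p z (sg \<Psi>) = sg (T p z \<Psi>)" for p z \<Psi> by (simp add: sg_def transfer_minus)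
  have sgS: "S p q z (sg \<Psi>) = sg (S p q z \<Psi>)" for p q z \<Psi> by (simp add: sg_def saddle_minus)
  have d\<theta>: "sg (d B \<theta> z) = - \<phi> B z" if z: "vertex w z" for z
  proof -
    have "sg (d B \<theta> z) = T B z (sg (d C (\<phi> C) z))"
      unfolding \<theta>_def using d_T [OF aB rB fl(3,2) c(2) z] by (simp add: sgT)
    also have "sg (d C (\<phi> C) z) = - S C B z (\<phi> B z)" using e(1) [OF z] by simp
    also have "S C B z (\<phi> B z) = \<phi> B z"
      using island_saddle(2) [OF t(1,2) z isl [OF z] x cfD [OF c(3) z]] by simp
    finally show ?thesis using T_self [OF rB cfD [OF c(3) z] z] by (simp add: transfer_minus)
  qed
  define \<chi> where "\<chi> z = \<phi> N z + S N B z (\<theta> z)" for z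
  have c\<chi>: "cf N \<chi>"
    using cfD [OF c(1)] cS [OF t(3)] cfD [OF c\<theta>] by (auto simp: \<chi>_def intro!: cfI compat_add)
  have d\<chi>: "d N \<chi> z = 0" if z: "vertex w z" for z
  proof -
    have "sg (d N \<chi> z) = sg (d N (\<phi> N) z) + S N B z (sg (d B \<theta> z))"
      unfolding \<chi>_def delta_add d_S [OF t(3) c\<theta> z] by (simp add: sg_def saddle_minus)
    also have "\<dots> = 0" using e(2) [OF z] d\<theta> [OF z] by (simp add: saddle_minus)
    finally show ?thesis by (simp add: sg_def split: if_splits)
  qed
  show ?thesis
  proof (rule psi_detectedI)
    show "compat_family (conn b) w (\<lambda>z. T [] z (\<chi> z))"
      using cT [OF ag(5) reaches_Nil] cfD [OF c\<chi>] unfolding fam_Nil [symmetric] N_def by (auto intro!: cfI)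
    show "delta (conn b) w (\<lambda>z. T [] z (\<chi> z)) z = 0" if z: "vertex w z" for z
      using d_T [OF ag(5) reaches_Nil _ _ c\<chi> [unfolded N_def] z] d\<chi> [OF z]
      by (simp add: fam_Nil N_def)
    let ?z = "replicate (length w) None"
    have "T [] ?z (\<chi> ?z) (strand_tops b) = \<chi> ?z (strand_tops b)"
      using T_tops [OF ag(5) reaches_Nil cfD [OF c\<chi> [unfolded N_def] vertex_oriented] vertex_oriented] .
    also have "\<dots> = 1"
      \<comment> \<open>The correction is a saddle image at the oriented vertex, so it vanishes on
        the monomial of psi.\<close>
      using psi saddle_oriented [of b i k' 2 B "length w" "\<theta> ?z"] t(3) cfD [OF c\<theta> vertex_oriented]
      by (simp add: \<chi>_def pointwise N_def numeral_2_eq_2)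
    finally show "T [] ?z (\<chi> ?z) (strand_tops b) = 1" .
  qed
qed

end


section \<open>Reidemeister III, rotation and stabilization\<close>

context word
begin

section \<open>Cubes over three letters, far commutation and Reidemeister III\<close>

lemma detected3I:
  assumes cf: "\<And>r r' r''. r \<in> {None, Some i} \<Longrightarrow> r' \<in> {None, Some j} \<Longrightarrow>
      r'' \<in> {None, Some k} \<Longrightarrow> cf [r, r', r''] (\<phi> [r, r', r''])"
    and e: "\<And>z. vertex w z \<Longrightarrow> S [None, None, None] [Some i, None, None] z (\<phi> [Some i, None, None] z)
      + S [None, None, None] [None, Some j, None] z (\<phi> [None, Some j, None] z)
      + S [None, None, None] [None, None, Some k] z (\<phi> [None, None, Some k] z)
      + d [None, None, None] (\<phi> [None, None, None]) z = 0"
    "\<And>z. vertex w z \<Longrightarrow> S [None, None, Some k] [Some i, None, Some k] z (\<phi> [Some i, None, Some k] z)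
      + S [None, None, Some k] [None, Some j, Some k] z (\<phi> [None, Some j, Some k] z)
      - d [None, None, Some k] (\<phi> [None, None, Some k]) z = 0"
    "\<And>z. vertex w z \<Longrightarrow> S [None, Some j, None] [Some i, Some j, None] z (\<phi> [Some i, Some j, None] z)
      - S [None, Some j, None] [None, Some j, Some k] z (\<phi> [None, Some j, Some k] z)
      - d [None, Some j, None] (\<phi> [None, Some j, None]) z = 0"
    "\<And>z. vertex w z \<Longrightarrow> S [None, Some j, Some k] [Some i, Some j, Some k] z (\<phi> [Some i, Some j, Some k] z)
      + d [None, Some j, Some k] (\<phi> [None, Some j, Some k]) z = 0"
    "\<And>z. vertex w z \<Longrightarrow> S [Some i, None, None] [Some i, Some j, None] z (\<phi> [Some i, Some j, None] z)
      + S [Some i, None, None] [Some i, None, Some k] z (\<phi> [Some i, None, Some k] z)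
      + d [Some i, None, None] (\<phi> [Some i, None, None]) z = 0"
    "\<And>z. vertex w z \<Longrightarrow> S [Some i, None, Some k] [Some i, Some j, Some k] z (\<phi> [Some i, Some j, Some k] z)
      - d [Some i, None, Some k] (\<phi> [Some i, None, Some k]) z = 0"
    "\<And>z. vertex w z \<Longrightarrow> S [Some i, Some j, None] [Some i, Some j, Some k] z (\<phi> [Some i, Some j, Some k] z)
      + d [Some i, Some j, None] (\<phi> [Some i, Some j, None]) z = 0"
    "\<And>z. vertex w z \<Longrightarrow> d [Some i, Some j, Some k] (\<phi> [Some i, Some j, Some k]) z = 0"
    and psi: "\<phi> [None, None, None] (replicate (length w) None) (strand_tops b) = 1"
  shows "psi_detected b ((i, True) # (j, True) # (k, True) # w)"
proof -
  define \<Phi> where "\<Phi> zz = \<phi> (take 3 zz) (drop 3 zz)" for zz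
  have \<Phi>: "\<Phi> (r # r' # r'' # z) = \<phi> [r, r', r''] z" for r r' r'' z by (simp add: \<Phi>_def numeral_3_eq_3)
  show ?thesis
  proof (rule psi_detectedI)
    show "compat_family (conn b) ((i, True) # (j, True) # (k, True) # w) \<Phi>"
      using cf unfolding compat_family_Cons by (simp add: \<Phi> conn_fam3 zero_res_def one_res_def)
    fix zz assume "vertex ((i, True) # (j, True) # (k, True) # w) zz"
    then obtain r r' r'' z where zz: "zz = r # r' # r'' # z" "r = None \<or> r = Some i"
      "r' = None \<or> r' = Some j" "r'' = None \<or> r'' = Some k" "vertex w z"
      by (auto simp: vertex_Cons zero_res_def one_res_def)
    from zz(2-4) e [OF zz(5)]
    show "delta (conn b) ((i, True) # (j, True) # (k, True) # w) \<Phi> zz = 0"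
      unfolding zz(1) by (elim disjE) (simp_all add: \<Phi> conn_fam3 zero_res_def one_res_def algebra_simps)
  next
    show "\<Phi> (replicate (length ((i, True) # (j, True) # (k, True) # w)) None) (strand_tops b) = 1"
      using psi by (simp add: \<Phi>)
  qed
qed

lemma detected3E:
  assumes "psi_detected b ((i, True) # (j, True) # (k, True) # w)"
  obtains \<phi> where "\<And>r r' r''. r \<in> {None, Some i} \<Longrightarrow> r' \<in> {None, Some j} \<Longrightarrow>
      r'' \<in> {None, Some k} \<Longrightarrow> cf [r, r', r''] (\<phi> [r, r', r''])"
    "\<And>z. vertex w z \<Longrightarrow> S [None, None, None] [Some i, None, None] z (\<phi> [Some i, None, None] z)
      + S [None, None, None] [None, Some j, None] z (\<phi> [None, Some j, None] z)
      + S [None, None, None] [None, None, Some k] z (\<phi> [None, None, Some k] z)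
      + d [None, None, None] (\<phi> [None, None, None]) z = 0"
    "\<And>z. vertex w z \<Longrightarrow> S [None, None, Some k] [Some i, None, Some k] z (\<phi> [Some i, None, Some k] z)
      + S [None, None, Some k] [None, Some j, Some k] z (\<phi> [None, Some j, Some k] z)
      - d [None, None, Some k] (\<phi> [None, None, Some k]) z = 0"
    "\<And>z. vertex w z \<Longrightarrow> S [None, Some j, None] [Some i, Some j, None] z (\<phi> [Some i, Some j, None] z)
      - S [None, Some j, None] [None, Some j, Some k] z (\<phi> [None, Some j, Some k] z)
      - d [None, Some j, None] (\<phi> [None, Some j, None]) z = 0"
    "\<And>z. vertex w z \<Longrightarrow> S [None, Some j, Some k] [Some i, Some j, Some k] z (\<phi> [Some i, Some j, Some k] z)
      + d [None, Some j, Some k] (\<phi> [None, Some j, Some k]) z = 0"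
    "\<And>z. vertex w z \<Longrightarrow> S [Some i, None, None] [Some i, Some j, None] z (\<phi> [Some i, Some j, None] z)
      + S [Some i, None, None] [Some i, None, Some k] z (\<phi> [Some i, None, Some k] z)
      + d [Some i, None, None] (\<phi> [Some i, None, None]) z = 0"
    "\<And>z. vertex w z \<Longrightarrow> S [Some i, None, Some k] [Some i, Some j, Some k] z (\<phi> [Some i, Some j, Some k] z)
      - d [Some i, None, Some k] (\<phi> [Some i, None, Some k]) z = 0"
    "\<And>z. vertex w z \<Longrightarrow> S [Some i, Some j, None] [Some i, Some j, Some k] z (\<phi> [Some i, Some j, Some k] z)
      + d [Some i, Some j, None] (\<phi> [Some i, Some j, None]) z = 0"
    "\<And>z. vertex w z \<Longrightarrow> d [Some i, Some j, Some k] (\<phi> [Some i, Some j, Some k]) z = 0"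
    "\<phi> [None, None, None] (replicate (length w) None) (strand_tops b) = 1"
proof -
  from assms obtain \<Phi> where \<Phi>: "compat_family (conn b) ((i, True) # (j, True) # (k, True) # w) \<Phi>"
    "\<And>z. vertex ((i, True) # (j, True) # (k, True) # w) z \<Longrightarrow> delta (conn b) ((i, True) # (j, True) # (k, True) # w) \<Phi> z = 0"
    "\<Phi> (replicate (length ((i, True) # (j, True) # (k, True) # w)) None) (strand_tops b) = 1"
    by (elim psi_detectedE) blast
  define \<phi> where "\<phi> p z = \<Phi> (p @ z)" for p z
  have \<phi>: "\<Phi> (r # r' # r'' # z) = \<phi> [r, r', r''] z" for r r' r'' z by (simp add: \<phi>_def)
  note \<Phi>' = \<Phi>(1) [unfolded compat_family_Cons] and e = \<Phi>(2) [of "r # r' # r'' # z" for r r' r'' z]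
  show thesis
  proof (rule that [of \<phi>])
    show "cf [r, r', r''] (\<phi> [r, r', r''])" if "r \<in> {None, Some i}" "r' \<in> {None, Some j}"
      "r'' \<in> {None, Some k}" for r r' r''
      using \<Phi>' that by (auto simp: \<phi> conn_fam3 zero_res_def one_res_def)
    show \<open>\<phi> [None, None, None] (replicate (length w) None) (strand_tops b) = 1\<close>
      using \<Phi>(3) by (simp add: \<phi>)
    fix z assume z: "vertex w z"
    show "S [None, None, None] [Some i, None, None] z (\<phi> [Some i, None, None] z)
      + S [None, None, None] [None, Some j, None] z (\<phi> [None, Some j, None] z)
      + S [None, None, None] [None, None, Some k] z (\<phi> [None, None, Some k] z)
      + d [None, None, None] (\<phi> [None, None, None]) z = 0"
      using e [of None None None z] z by (simp add: \<phi> conn_fam3 zero_res_def one_res_def algebra_simps)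
    show "S [None, None, Some k] [Some i, None, Some k] z (\<phi> [Some i, None, Some k] z)
      + S [None, None, Some k] [None, Some j, Some k] z (\<phi> [None, Some j, Some k] z)
      - d [None, None, Some k] (\<phi> [None, None, Some k]) z = 0"
      using e [of None None "Some k" z] z by (simp add: \<phi> conn_fam3 zero_res_def one_res_def algebra_simps)
    show "S [None, Some j, None] [Some i, Some j, None] z (\<phi> [Some i, Some j, None] z)
      - S [None, Some j, None] [None, Some j, Some k] z (\<phi> [None, Some j, Some k] z)
      - d [None, Some j, None] (\<phi> [None, Some j, None]) z = 0"
      using e [of None "Some j" None z] z by (simp add: \<phi> conn_fam3 zero_res_def one_res_def algebra_simps)
    show "S [None, Some j, Some k] [Some i, Some j, Some k] z (\<phi> [Some i, Some j, Some k] z)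
      + d [None, Some j, Some k] (\<phi> [None, Some j, Some k]) z = 0"
      using e [of None "Some j" "Some k" z] z by (simp add: \<phi> conn_fam3 zero_res_def one_res_def algebra_simps)
    show "S [Some i, None, None] [Some i, Some j, None] z (\<phi> [Some i, Some j, None] z)
      + S [Some i, None, None] [Some i, None, Some k] z (\<phi> [Some i, None, Some k] z)
      + d [Some i, None, None] (\<phi> [Some i, None, None]) z = 0"
      using arg_cong [OF e, of "Some i" None None z uminus] z by (simp add: \<phi> conn_fam3 zero_res_def one_res_def add_ac)
    show "S [Some i, None, Some k] [Some i, Some j, Some k] z (\<phi> [Some i, Some j, Some k] z)
      - d [Some i, None, Some k] (\<phi> [Some i, None, Some k]) z = 0"
      using e [of "Some i" None "Some k" z] z by (simp add: \<phi> conn_fam3 zero_res_def one_res_def algebra_simps)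
    show "S [Some i, Some j, None] [Some i, Some j, Some k] z (\<phi> [Some i, Some j, Some k] z)
      + d [Some i, Some j, None] (\<phi> [Some i, Some j, None]) z = 0"
      using e [of "Some i" "Some j" None z] z by (simp add: \<phi> conn_fam3 zero_res_def one_res_def algebra_simps)
    show "d [Some i, Some j, Some k] (\<phi> [Some i, Some j, Some k]) z = 0"
      using e [of "Some i" "Some j" "Some k" z] z by (simp add: \<phi> conn_fam3 zero_res_def one_res_def algebra_simps)
  qed
qed

lemma agree_drop_None3:
  assumes "[r, r'] \<in> flats b"
  shows "agree b [None, r, r'] [r, r']" "agree b [r, None, r'] [r, r']" "agree b [r, r', None] [r, r']"
  using agree_remove_None [of "[]" "[r, r']" b] agree_remove_None [of "[r]" "[r']" b]
    agree_remove_None [of "[r, r']" "[]" b] assms by simp_all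

lemma agree_drop_None2:
  assumes "[r] \<in> flats b"
  shows "agree b [None, r] [r]" "agree b [r, None] [r]"
  using agree_remove_None [of "[]" "[r]" b] agree_remove_None [of "[r]" "[]" b] assms by simp_all

lemma reaches_add_None3:
  assumes "[r, r'] \<in> flats b" "reaches b [r, r']"
  shows "reaches b [None, r, r']" "reaches b [r, None, r']" "reaches b [r, r', None]"
  using reaches_add_None [of "[]" "[r, r']" b] reaches_add_None [of "[r]" "[r']" b]
    reaches_add_None [of "[r, r']" "[]" b] assms by simp_all

lemma agree_one_of_three:
  assumes "1 \<le> i" "i < b" "p \<in> {[Some i, None, None], [None, Some i, None], [None, None, Some i]}"
  shows "agree b p [Some i]" "reaches b p"
proof -
  have fl: "[Some i] \<in> flats b" using assms by simp
  note a = agree_drop_None2 [OF fl]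
  have b: "agree b [None, None, Some i] [None, Some i]" "agree b [None, Some i, None] [None, Some i]"
    "agree b [Some i, None, None] [Some i, None]"
    using agree_drop_None3(2) [of None "Some i"] agree_drop_None3(3) [of None "Some i"]
      agree_drop_None3(2) [of "Some i" None] assms by simp_all
  show "agree b p [Some i]"
    using assms(3) agree_trans [OF b(1) a(1)] agree_trans [OF b(2) a(1)] agree_trans [OF b(3) a(2)] by blast
  note r = agree_double(2,3) [OF assms(1,2)]
  show "reaches b p"
    using assms r reaches_add_None3 [of None "Some i"] reaches_add_None3 [of "Some i" None] by auto
qed

lemma agree_one_of_three':
  assumes "1 \<le> i" "i < b" "p \<in> {[Some i, None, None], [None, Some i, None], [None, None, Some i]}"
    "q \<in> {[Some i, None, None], [None, Some i, None], [None, None, Some i]}"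
  shows "agree b p q"
  using agree_trans [OF agree_one_of_three(1) agree_sym [OF agree_one_of_three(1)]] assms by metis

lemma agree_two_of_three:
  assumes "1 \<le> i" "i < b" "1 \<le> j" "j < b" "i \<noteq> j"
    "p \<in> {[Some i, Some j, None], [Some i, None, Some j], [None, Some i, Some j]}"
    "q \<in> {[Some i, Some j, None], [Some i, None, Some j], [None, Some i, Some j]}"
  shows "agree b p q" "reaches b p"
proof -
  have fl: "[Some i, Some j] \<in> flats b" using assms by simp
  have a: "agree b p [Some i, Some j]"
    if "p \<in> {[Some i, Some j, None], [Some i, None, Some j], [None, Some i, Some j]}" for p
    using that agree_drop_None3 [OF fl] by auto
  show "agree b p q" using agree_trans [OF a agree_sym [OF a]] assms by blast
  show "reaches b p"
    using reaches_add_None3 [OF fl reaches_two_turns] assms by auto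
qed

text \<open>One attaching point lies on the closed circle, and the other one can be taken in the
  tail: for the lower turn it is there already, for the upper turn it is at the top level and is
  closed up with level 0.\<close>

lemma spaced_island_split:
  assumes i: "1 \<le> i" "i < b" and z: "vertex w z" and q: "q = [Some i, None, None] \<or> q = [None, None, Some i]"
  defines "D \<equiv> {i, Suc i} \<times> {Suc (length w), Suc (Suc (length w))}"
  shows "\<exists>a \<in> points b (length w). \<forall>\<Psi>. compat (fam b [Some i, None, Some i] z) \<Psi> \<longrightarrow>
     (\<forall>u \<in> D. S q [Some i, None, Some i] z \<Psi> = mark u \<Psi> + mark a \<Psi>)"
proof -
  let ?p = "[Some i, None, Some i]"
  define k :: nat where "k = (if q = [Some i, None, None] then 0 else 2)"
  have t: "turn b i k q ?p" "turn b i k ?p q"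
    using q turns3 [OF i, of "Some i" None] turns3 [OF i, of None "Some i"] i by (auto simp: k_def)
  have isl: "\<And>u c. u \<in> D \<Longrightarrow> fam b ?p z u c \<longleftrightarrow> c \<in> D"
    unfolding D_def using island3 [OF i z] by blast
  have x: "(i, Suc (k + length w)) \<in> D \<longleftrightarrow> (Suc i, k + length w) \<notin> D"
    by (simp add: D_def k_def)
  note ex = island_turn(2) [OF t(2) z isl x]
  have n: "\<not> fam b ?p z (i, Suc (k + length w)) (Suc i, k + length w)"
    using isl x conn_sym unfolding fam_def by metis
  have split: "S q ?p z \<Psi> = mark (i, Suc (k + length w)) \<Psi> + mark (Suc i, k + length w) \<Psi>"
    if "compat (fam b ?p z) \<Psi>" for \<Psi>
    by (rule saddle_split [OF edge [OF t(1) z] _ n that]) (use ex in simp)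
  have inD: "mark u \<Psi> = mark v \<Psi>" if "u \<in> D" "v \<in> D" "compat (fam b ?p z) \<Psi>" for u v \<Psi>
    using compat_eq [OF that(3)] isl that by blast
  show ?thesis
  proof (cases "k = 0")
    case True
    then have D: "(i, Suc (k + length w)) \<in> D" by (simp add: D_def)
    show ?thesis
      using split inD [OF _ D] i True
      by (intro bexI [of _ "(Suc i, length w)"]) (auto simp: points_def)
  next
    case False
    then have k: "k = 2" by (simp add: k_def split: if_splits)
    then have D: "(Suc i, k + length w) \<in> D" by (simp add: D_def)
    have "fam b ?p z (i, Suc (k + length w)) (i, 0)"
      using closing_conn [of "?p @ z" b i] i vf [OF z] vertex_length [OF z] by (simp add: fam_def k)
    then have "mark (i, Suc (k + length w)) \<Psi> = mark (i, 0) \<Psi>" if "compat (fam b ?p z) \<Psi>" for \<Psi>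
      by (rule compat_eq [OF that])
    then show ?thesis
      using split inD [OF _ D] i
      by (intro bexI [of _ "(i, 0)"]) (auto simp: points_def add.commute)
  qed
qed

text \<open>The resolutions of both words agree pairwise as flat diagrams, so all four values are
  transported; only the order of the two letters in the sign rule differs.\<close>

lemma detected_far:
  assumes ij: "1 \<le> i" "i < b" "1 \<le> j" "j < b" "i + 2 \<le> j \<or> j + 2 \<le> i"
    and "psi_detected b ((i, True) # (j, True) # w)"
  shows "psi_detected b ((j, True) # (i, True) # w)"
proof -
  let ?I = "Some i" and ?J = "Some j"
  have res: "zero_res (k, True) = None" "one_res (k, True) = Some k" for k
    by (simp_all add: zero_res_def one_res_def)
  obtain \<phi> where c: "\<And>r r'. r \<in> {None, ?I} \<Longrightarrow> r' \<in> {None, ?J} \<Longrightarrow> cf [r, r'] (\<phi> [r, r'])"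
    and e: "\<And>z. vertex w z \<Longrightarrow> S [None, None] [?I, None] z (\<phi> [?I, None] z)
        + (S [None, None] [None, ?J] z (\<phi> [None, ?J] z) + d [None, None] (\<phi> [None, None]) z) = 0"
      "\<And>z. vertex w z \<Longrightarrow> S [?I, None] [?I, ?J] z (\<phi> [?I, ?J] z) + d [?I, None] (\<phi> [?I, None]) z = 0"
      "\<And>z. vertex w z \<Longrightarrow> S [None, ?J] [?I, ?J] z (\<phi> [?I, ?J] z) - d [None, ?J] (\<phi> [None, ?J]) z = 0"
      "\<And>z. vertex w z \<Longrightarrow> d [?I, ?J] (\<phi> [?I, ?J]) z = 0"
    and psi: "\<phi> [None, None] (replicate (length w) None) (strand_tops b) = 1"
    by (rule detected2E [OF assms(6)]) (simp only: res, blast)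
  have fl: "[None, None] \<in> flats b" "[?I, None] \<in> flats b" "[None, ?I] \<in> flats b" "[?J, None] \<in> flats b"
    "[None, ?J] \<in> flats b" "[?I, ?J] \<in> flats b" "[?J, ?I] \<in> flats b"
    using ij by auto
  have aI: "agree b [?I, None] [None, ?I]" and aJ: "agree b [None, ?J] [?J, None]"
    using agree_trans [OF agree_drop_None2(2) agree_sym [OF agree_drop_None2(1)], of ?I]
      agree_trans [OF agree_drop_None2(1) agree_sym [OF agree_drop_None2(2)], of ?J] ij by auto
  have aIJ: "agree b [?I, ?J] [?J, ?I]" using agree_far ij by blast
  have r: "reaches b [None, None]" "reaches b [None, ?I]" "reaches b [?J, None]" "reaches b [?J, ?I]"
    using agree_double [of i] agree_double [of j] reaches_two_turns [of j b i] ij by auto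
  have t: "turn b j 0 [None, None] [None, ?J]" "turn b j 1 [None, None] [?J, None]"
    "turn b i 1 [None, None] [?I, None]" "turn b i 0 [None, None] [None, ?I]"
    "turn b i 1 [None, ?J] [?I, ?J]" "turn b i 0 [?J, None] [?J, ?I]"
    "turn b j 0 [?I, None] [?I, ?J]" "turn b j 1 [None, ?I] [?J, ?I]"
    using turnI1 [of i b "[]" "[?J]"] turnI1 [of i b "[?J]" "[]"] turnI1 [of j b "[?I]" "[]"]
      turnI1 [of j b "[]" "[?I]"] turns2 [of i b None] turns2 [of j b None] ij by auto
  \<comment> \<open>Exchanging two letters that are both 1-resolved reverses the sign at their
    common vertex.\<close>
  define \<theta> where "\<theta> p z = (if p = [None, None] then \<phi> [None, None] z
     else if p = [?J, None] then T [?J, None] z (\<phi> [None, ?J] z)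
     else if p = [None, ?I] then T [None, ?I] z (\<phi> [?I, None] z)
     else - T [?J, ?I] z (\<phi> [?I, ?J] z))" for p z
  have \<theta>: "\<theta> [None, None] = \<phi> [None, None]" "\<theta> [?J, None] = (\<lambda>z. T [?J, None] z (\<phi> [None, ?J] z))"
    "\<theta> [None, ?I] = (\<lambda>z. T [None, ?I] z (\<phi> [?I, None] z))"
    "\<theta> [?J, ?I] = (\<lambda>z. - T [?J, ?I] z (\<phi> [?I, ?J] z))"
    by (simp_all add: \<theta>_def fun_eq_iff)
  have cc: "compat (fam b [r, r'] z) (\<phi> [r, r'] z)" if "r \<in> {None, ?I}" "r' \<in> {None, ?J}" "vertex w z" for r r' z
    using cfD [OF c that(3)] that by blast
  show ?thesis
  proof (rule detected2I [where \<phi> = \<theta>], unfold res)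
    show "cf [r, r'] (\<theta> [r, r'])" if "r \<in> {None, ?J}" "r' \<in> {None, ?I}" for r r'
      using that c [of None None] cT [OF aJ r(3)] cT [OF aI r(2)] cT [OF aIJ r(4)] cc
      by (elim insertE emptyE) (auto simp: \<theta> intro!: cfI compat_minus)
    fix z assume z: "vertex w z"
    show "S [None, None] [?J, None] z (\<theta> [?J, None] z)
        + (S [None, None] [None, ?I] z (\<theta> [None, ?I] z) + d [None, None] (\<theta> [None, None]) z) = 0"
    proof -
      have "S [None, None] [?J, None] z (\<theta> [?J, None] z) = S [None, None] [None, ?J] z (\<phi> [None, ?J] z)"
        unfolding \<theta> using S_T [OF t(1,2) agree_refl aJ r(1,3) cc z] z
          T_self [OF r(1) cS [OF t(1) z cc] z] by simp
      moreover have "S [None, None] [None, ?I] z (\<theta> [None, ?I] z) = S [None, None] [?I, None] z (\<phi> [?I, None] z)"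
        unfolding \<theta> using S_T [OF t(3,4) agree_refl aI r(1,2) cc z] z
          T_self [OF r(1) cS [OF t(3) z cc] z] by simp
      ultimately show ?thesis using e(1) [OF z] by (simp add: \<theta> add_ac)
    qed
    show "S [?J, None] [?J, ?I] z (\<theta> [?J, ?I] z) + d [?J, None] (\<theta> [?J, None]) z = 0"
      unfolding \<theta> using S_T [OF t(5,6) aJ aIJ r(3,4) cc z] d_T [OF aJ r(3) fl(5,4) c z] z e(3) [OF z]
      by (simp add: saddle_minus)
    show "S [None, ?I] [?J, ?I] z (\<theta> [?J, ?I] z) - d [None, ?I] (\<theta> [None, ?I]) z = 0"
      unfolding \<theta> using S_T [OF t(7,8) aI aIJ r(2,4) cc z] d_T [OF aI r(2) fl(2,3) c z] z e(2) [OF z]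
      by (simp add: saddle_minus add_eq_0_iff transfer_minus)
    show "d [?J, ?I] (\<theta> [?J, ?I]) z = 0"
      unfolding \<theta> using d_T [OF aIJ r(4) fl(6,7) c z] z e(4) [OF z] by (simp add: delta_minus)
  next
    show "\<theta> [None, None] (replicate (length w) None) (strand_tops b) = 1" using psi by (simp add: \<theta>)
  qed
qed

text \<open>The closed circle can be split off at either turn. At the lower one this is the counit
  law; at the upper one the result is compared on tail monomials. These have no factor on
  \<open>D\<close>, so of the two marks only the one on \<open>D\<close> contributes.\<close>

lemma spaced_island_circle:
  assumes i: "1 \<le> i" "i < b" and z: "vertex w z" and c: "compat (fam b [Some i, None, None] z) \<Psi>"
  defines "D \<equiv> {i, Suc i} \<times> {Suc (length w), Suc (Suc (length w))}"
  shows "compat (fam b [Some i, None, Some i] z) (add_circle D \<Psi>)"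
    and "S [Some i, None, None] [Some i, None, Some i] z (add_circle D \<Psi>) = \<Psi>"
    and "S [None, None, Some i] [Some i, None, Some i] z (add_circle D \<Psi>) = T [None, None, Some i] z \<Psi>"
    and "extra_circle D (fam b [Some i, None, Some i] z) (fam b [Some i, None, None] z)"
proof -
  let ?p = "[Some i, None, Some i]"
  have t: "turn b i 0 ?p [Some i, None, None]" "turn b i 0 [Some i, None, None] ?p"
    "turn b i 2 [None, None, Some i] ?p"
    using turns3 [OF i, of "Some i" None] turns3 [OF i, of None "Some i"] i by auto
  have isl: "\<And>u c. u \<in> D \<Longrightarrow> fam b ?p z u c \<longleftrightarrow> c \<in> D"
    unfolding D_def using island3 [OF i z] by blast
  have x: "(i, Suc (0 + length w)) \<in> D \<longleftrightarrow> (Suc i, 0 + length w) \<notin> D" by (simp add: D_def)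
  note isd = island_saddle [OF t(1,2) z isl x c]
  show cc: "compat (fam b ?p z) (add_circle D \<Psi>)" by (rule isd(3))
  show "S [Some i, None, None] ?p z (add_circle D \<Psi>) = \<Psi>" by (rule isd(1))
  show "extra_circle D (fam b ?p z) (fam b [Some i, None, None] z)"
    by (rule island_turn(1) [OF t(1) z isl x])
  have u: "(i, Suc (length w)) \<in> D" by (simp add: D_def)
  from spaced_island_split [OF i z, of "[None, None, Some i]"] cc u
  obtain a where a: "a \<in> points b (length w)" and split: "S [None, None, Some i] ?p z (add_circle D \<Psi>)
      = mark (i, Suc (length w)) (add_circle D \<Psi>) + mark a (add_circle D \<Psi>)"
    unfolding D_def by blast
  have out: "q \<notin> D" if "q \<in> points b (length w)" for q
    using that by (auto simp: D_def points_def)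
  note one = agree_one_of_three [OF i] and one' = agree_one_of_three' [OF i]
  show "S [None, None, Some i] ?p z (add_circle D \<Psi>) = T [None, None, Some i] z \<Psi>"
  proof (rule sym, rule T_unique [of "[Some i, None, None]"])
    show "agree b [Some i, None, None] [None, None, Some i]" by (rule one') simp_all
    show "reaches b [None, None, Some i]" by (rule one(2)) simp
    show "compat (fam b [None, None, Some i] z) (S [None, None, Some i] ?p z (add_circle D \<Psi>))"
      by (rule cS [OF t(3) z cc])
    fix M assume M: "set_mset M \<subseteq> points b (length w)"
    then have all: "\<forall>c \<in># M. c \<notin> D" using out by blast
    then have none: "filter_mset (\<lambda>a. a \<in> D) M = {#}" by auto
    from all show "S [None, None, Some i] ?p z (add_circle D \<Psi>) M = \<Psi> M"
      unfolding split plus_fun_apply mark_add_circle_in [OF u] mark_add_circle [OF out [OF a]]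
      unfolding add_circle_def none by simp
  qed (use c z in auto)
qed

text \<open>On tail monomials both saddles reduce to the mark at a point of the closed circle: the
  second mark is at a tail point, where \<open>\<Delta>\<close> vanishes.\<close>

lemma spaced_island_vanish:
  assumes i: "1 \<le> i" "i < b" and z: "vertex w z" and c: "compat (fam b [Some i, None, Some i] z) \<Delta>"
    and \<Delta>: "\<And>M. set_mset M \<subseteq> points b (length w) \<Longrightarrow> \<Delta> M = 0"
  shows "T [None, Some i, None] z (S [Some i, None, None] [Some i, None, Some i] z \<Delta>)
    = T [None, Some i, None] z (S [None, None, Some i] [Some i, None, Some i] z \<Delta>)"
proof -
  let ?p = "[Some i, None, Some i]"
  have t: "turn b i 0 [Some i, None, None] ?p" "turn b i 2 [None, None, Some i] ?p"
    using turns3 [OF i, of "Some i" None] turns3 [OF i, of None "Some i"] i by auto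
  define u where "u = (i, Suc (length w))"
  have *: "S q ?p z \<Delta> M = mark u \<Delta> M"
    if "set_mset M \<subseteq> points b (length w)" "q = [Some i, None, None] \<or> q = [None, None, Some i]" for q M
  proof -
    from spaced_island_split [OF i z that(2)] obtain a where a: "a \<in> points b (length w)"
      and s: "\<forall>\<Psi>. compat (fam b ?p z) \<Psi> \<longrightarrow> (\<forall>u \<in> {i, Suc i} \<times> {Suc (length w), Suc (Suc (length w))}.
        S q ?p z \<Psi> = mark u \<Psi> + mark a \<Psi>)" by blast
    have "S q ?p z \<Delta> = mark u \<Delta> + mark a \<Delta>" using s c unfolding u_def by blast
    moreover have "mark a \<Delta> M = 0" using \<Delta> [of "add_mset a M"] a that(1) by (simp add: mark_def)
    ultimately show ?thesis by (simp add: pointwise)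
  qed
  note one = agree_one_of_three [OF i] and one' = agree_one_of_three' [OF i]
  have ag: "agree b [Some i, None, None] [None, Some i, None]" "agree b [None, None, Some i] [None, Some i, None]"
    and r: "reaches b [None, Some i, None]"
    by (rule one', simp, simp)+ (rule one(2), simp)
  have cs: "compat (fam b [Some i, None, None] z) (S [Some i, None, None] ?p z \<Delta>)"
    "compat (fam b [None, None, Some i] z) (S [None, None, Some i] ?p z \<Delta>)"
    using cS [OF t(1) z c] cS [OF t(2) z c] .
  show ?thesis
    by (rule T_unique [OF ag(1) r cs(1) cT [OF ag(2) r z cs(2)] z])
      (simp add: T_agrees [OF ag(2) r cs(2) z] *)
qed

text \<open>The given cocycle is first changed by the coboundary of the cochain with value
  \<open>\<Psi>\<close> at \<open>[Some i, Some j, Some i]\<close>. This turns its values at the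
  vertices with two turns into \<open>A\<close>, \<open>B\<close> and \<open>\<Delta>\<close>, and
  its value at the last vertex into 0. The rest is carried over through equal flat diagrams; the two
  single turns at \<open>i\<close> become one vertex, so their values are added, and the new closed
  circle receives a value that balances its neighbours.\<close>

lemma detected_braid_relation:
  assumes "zigzag b i j" and "psi_detected b ((i, True) # (j, True) # (i, True) # w)"
  shows "psi_detected b ((j, True) # (i, True) # (j, True) # w)"
proof -
  interpret zz: zigzag b i j by fact
  note ij = zz.ij
  have i: "1 \<le> i" "i < b" and j: "1 \<le> j" "j < b" and ne: "i \<noteq> j" using ij by auto
  let ?I = "Some i" and ?J = "Some j"
  obtain \<phi> where c: "\<And>r r' r''. r \<in> {None, ?I} \<Longrightarrow> r' \<in> {None, ?J} \<Longrightarrow> r'' \<in> {None, ?I} \<Longrightarrow> cf [r, r', r''] (\<phi> [r, r', r''])"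
    and e000: "\<And>z. vertex w z \<Longrightarrow> S [None, None, None] [?I, None, None] z (\<phi> [?I, None, None] z)
      + S [None, None, None] [None, ?J, None] z (\<phi> [None, ?J, None] z)
      + S [None, None, None] [None, None, ?I] z (\<phi> [None, None, ?I] z)
      + d [None, None, None] (\<phi> [None, None, None]) z = 0"
    and e001: "\<And>z. vertex w z \<Longrightarrow> S [None, None, ?I] [?I, None, ?I] z (\<phi> [?I, None, ?I] z)
      + S [None, None, ?I] [None, ?J, ?I] z (\<phi> [None, ?J, ?I] z) - d [None, None, ?I] (\<phi> [None, None, ?I]) z = 0"
    and e010: "\<And>z. vertex w z \<Longrightarrow> S [None, ?J, None] [?I, ?J, None] z (\<phi> [?I, ?J, None] z)
      - S [None, ?J, None] [None, ?J, ?I] z (\<phi> [None, ?J, ?I] z) - d [None, ?J, None] (\<phi> [None, ?J, None]) z = 0"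
    and e011: "\<And>z. vertex w z \<Longrightarrow> S [None, ?J, ?I] [?I, ?J, ?I] z (\<phi> [?I, ?J, ?I] z)
      + d [None, ?J, ?I] (\<phi> [None, ?J, ?I]) z = 0"
    and e100: "\<And>z. vertex w z \<Longrightarrow> S [?I, None, None] [?I, ?J, None] z (\<phi> [?I, ?J, None] z)
      + S [?I, None, None] [?I, None, ?I] z (\<phi> [?I, None, ?I] z) + d [?I, None, None] (\<phi> [?I, None, None]) z = 0"
    and e101: "\<And>z. vertex w z \<Longrightarrow> S [?I, None, ?I] [?I, ?J, ?I] z (\<phi> [?I, ?J, ?I] z)
      - d [?I, None, ?I] (\<phi> [?I, None, ?I]) z = 0"
    and e110: "\<And>z. vertex w z \<Longrightarrow> S [?I, ?J, None] [?I, ?J, ?I] z (\<phi> [?I, ?J, ?I] z)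
      + d [?I, ?J, None] (\<phi> [?I, ?J, None]) z = 0"
    and psi: "\<phi> [None, None, None] (replicate (length w) None) (strand_tops b) = 1"
    by (rule detected3E [OF assms(2)]) blast
  have cc: "compat (fam b [r, r', r''] z) (\<phi> [r, r', r''] z)"
    if "r \<in> {None, ?I}" "r' \<in> {None, ?J}" "r'' \<in> {None, ?I}" "vertex w z" for r r' r'' z
    using cfD [OF c that(4)] that by blast
  have fl: "[r, r', r''] \<in> flats b" if "{r, r', r''} \<subseteq> {None, ?I, ?J}" for r r' r''
    using that ij by auto
  have ti: "turn b i 2 [None, r, r'] [?I, r, r']" "turn b i 2 [?I, r, r'] [None, r, r']"
    "turn b i 1 [r, None, r'] [r, ?I, r']" "turn b i 1 [r, ?I, r'] [r, None, r']"
    "turn b i 0 [r, r', None] [r, r', ?I]" "turn b i 0 [r, r', ?I] [r, r', None]"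
    and tj: "turn b j 2 [None, r, r'] [?J, r, r']" "turn b j 2 [?J, r, r'] [None, r, r']"
    "turn b j 1 [r, None, r'] [r, ?J, r']" "turn b j 1 [r, ?J, r'] [r, None, r']"
    "turn b j 0 [r, r', None] [r, r', ?J]" "turn b j 0 [r, r', ?J] [r, r', None]"
    if "{r, r'} \<subseteq> {None, ?I, ?J}" for r r'
  proof -
    have "[r, r'] \<in> flats b" using that ij by auto
    note turns3 [OF i this] turns3 [OF j this]
    then show "turn b i 2 [None, r, r'] [?I, r, r']" "turn b i 2 [?I, r, r'] [None, r, r']"
      "turn b i 1 [r, None, r'] [r, ?I, r']" "turn b i 1 [r, ?I, r'] [r, None, r']"
      "turn b i 0 [r, r', None] [r, r', ?I]" "turn b i 0 [r, r', ?I] [r, r', None]"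
      "turn b j 2 [None, r, r'] [?J, r, r']" "turn b j 2 [?J, r, r'] [None, r, r']"
      "turn b j 1 [r, None, r'] [r, ?J, r']" "turn b j 1 [r, ?J, r'] [r, None, r']"
      "turn b j 0 [r, r', None] [r, r', ?J]" "turn b j 0 [r, r', ?J] [r, r', None]" by blast+
  qed
  note oneI = agree_one_of_three' [OF i] and oneJ = agree_one_of_three' [OF j]
    and rI = agree_one_of_three(2) [OF i] and rJ = agree_one_of_three(2) [OF j]
    and twoIJ = agree_two_of_three [OF i j ne] and twoJI = agree_two_of_three [OF j i ne [symmetric]]
  \<comment> \<open>Both prefixes reduce to the single turn at \<open>i\<close>, one as a doubled
    turn and the other as a zigzag.\<close>
  have a111: "agree b [?I, None, ?I] [?I, ?J, ?I]"
  proof -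
    have "agree b [?I, None, ?I] [?I, ?I]" using agree_drop_None3(2) [of ?I ?I] ij by simp
    from agree_trans [OF this agree_double_turn [OF i]] show ?thesis
      using agree_trans agree_sym zz.agree_zigzag by blast
  qed
  have r000: "reaches b [None, None, None]"
    using reaches_add_None3(1) [of None None] agree_double(1) [OF i] by simp
  \<comment> \<open>The value on monomials that avoid the closed circle, moved to the diagram in
    which the turn of \<open>j\<close> has absorbed this circle.\<close>
  define \<Psi> where "\<Psi> z = T [?I, ?J, ?I] z (\<phi> [?I, None, ?I] z)" for z
  define A where "A z = \<phi> [?I, ?J, None] z + S [?I, ?J, None] [?I, ?J, ?I] z (\<Psi> z)" for z
  define B where "B z = \<phi> [None, ?J, ?I] z + S [None, ?J, ?I] [?I, ?J, ?I] z (\<Psi> z)" for z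
  define \<theta> where "\<theta> z = S [None, ?J, None] [?I, ?J, None] z (A z)" for z
  define \<Theta> where "\<Theta> z = T [?J, None, None] z (\<theta> z)" for z
  define D where "D = {j, Suc j} \<times> {Suc (length w), Suc (Suc (length w))}"
  define DI where "DI = {i, Suc i} \<times> {Suc (length w), Suc (Suc (length w))}"
  \<comment> \<open>Whichever side \<open>j\<close> is on, exactly one of the two corners of its
    turn lies on the closed circle \<open>DI\<close>.\<close>
  have merge: "S [?I, None, ?I] [?I, ?J, ?I] z X = X"
    if "vertex w z" "compat (fam b [?I, ?J, ?I] z) X" for z X
  proof (rule island_saddle(2))
    show "turn b j 1 [?I, None, ?I] [?I, ?J, ?I]" "turn b j 1 [?I, ?J, ?I] [?I, None, ?I]"
      using tj by auto
    show "\<And>u c. u \<in> DI \<Longrightarrow> fam b [?I, None, ?I] z u c \<longleftrightarrow> c \<in> DI"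
      unfolding DI_def using island3 [OF i that(1)] by blast
    show "(j, Suc (1 + length w)) \<in> DI \<longleftrightarrow> (Suc j, 1 + length w) \<notin> DI"
      using ij by (auto simp: DI_def)
  qed (use that in auto)
  have c\<Psi>: "cf [?I, ?J, ?I] \<Psi>"
    unfolding \<Psi>_def using cT [OF a111 zz.reaches_zigzag] cc by (auto intro!: cfI)
  have cA: "cf [?I, ?J, None] A"
    unfolding A_def using cS [OF ti(5)] cfD [OF c\<Psi>] cc by (auto intro!: cfI compat_add)
  have cB: "cf [None, ?J, ?I] B"
    unfolding B_def using cS [OF ti(1)] cfD [OF c\<Psi>] cc by (auto intro!: cfI compat_add)
  have c\<theta>: "cf [None, ?J, None] \<theta>"
    unfolding \<theta>_def using cS [OF ti(1)] cfD [OF cA] by (auto intro!: cfI)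
  have aJ: "agree b [None, ?J, None] [?J, None, None]" and rJ': "reaches b [?J, None, None]"
    using oneJ rJ by auto
  have c\<Theta>: "cf [?J, None, None] \<Theta>"
    unfolding \<Theta>_def using cT [OF aJ rJ'] cfD [OF c\<theta>] by (auto intro!: cfI)
  have d\<Psi>: "d [?I, ?J, ?I] \<Psi> z = \<phi> [?I, ?J, ?I] z" if z: "vertex w z" for z
  proof -
    have "d [?I, ?J, ?I] \<Psi> z = T [?I, ?J, ?I] z (d [?I, None, ?I] (\<phi> [?I, None, ?I]) z)"
      unfolding \<Psi>_def by (rule d_T [OF a111 zz.reaches_zigzag fl fl c z]) auto
    also have "d [?I, None, ?I] (\<phi> [?I, None, ?I]) z = \<phi> [?I, ?J, ?I] z"
      using e101 [OF z] merge [OF z cc] z by simp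
    finally show ?thesis using T_self [OF zz.reaches_zigzag cc z] z by simp
  qed
  have dA: "d [?I, ?J, None] A z = 0" if z: "vertex w z" for z
    unfolding A_def delta_add using d_S [OF ti(5) c\<Psi> z] d\<Psi> [OF z] e110 [OF z] by (simp add: add.commute)
  have dB: "d [None, ?J, ?I] B z = 0" if z: "vertex w z" for z
    unfolding B_def delta_add using d_S [OF ti(1) c\<Psi> z] d\<Psi> [OF z] e011 [OF z] by (simp add: add.commute)
  have d\<theta>: "d [None, ?J, None] \<theta> z = 0" if z: "vertex w z" for z
    unfolding \<theta>_def using d_S [OF ti(1) cA z] dA [OF z] by simp
  have d\<Theta>: "d [?J, None, None] \<Theta> z = 0" if z: "vertex w z" for z
    unfolding \<Theta>_def using d_T [OF aJ rJ' fl fl c\<theta> z] d\<theta> [OF z] by simp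
  \<comment> \<open>The single turns at \<open>j\<close> are treated asymmetrically: the last one
    gets 0 and the first one the whole value. The value on \<open>[Some j, None, Some j]\<close>
    contributes minus \<open>\<theta>\<close> at both neighbours. At one of them it cancels the
    saddle image of \<open>A\<close>, at the other the term \<open>\<theta>\<close> of
    \<open>d010\<close>.\<close>
  define \<chi> where "\<chi> p z =
    (if p = [None, None, None] then \<phi> p z
     else if p = [?J, None, None] then T p z (\<phi> [None, ?J, None] z)
     else if p = [None, ?I, None] then T p z (\<phi> [?I, None, None] z) + T p z (\<phi> [None, None, ?I] z)
     else if p = [?J, ?I, None] then T p z (B z)
     else if p = [None, ?I, ?J] then T p z (A z)
     else if p = [?J, None, ?J] then - add_circle D (\<Theta> z) else 0)" for p z
  have \<chi>: "\<chi> [None, None, None] = \<phi> [None, None, None]"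
    "\<chi> [?J, None, None] = (\<lambda>z. T [?J, None, None] z (\<phi> [None, ?J, None] z))"
    "\<chi> [None, ?I, None] = (\<lambda>z. T [None, ?I, None] z (\<phi> [?I, None, None] z) + T [None, ?I, None] z (\<phi> [None, None, ?I] z))"
    "\<chi> [?J, ?I, None] = (\<lambda>z. T [?J, ?I, None] z (B z))" "\<chi> [None, ?I, ?J] = (\<lambda>z. T [None, ?I, ?J] z (A z))"
    "\<chi> [?J, None, ?J] = (\<lambda>z. - add_circle D (\<Theta> z))"
    "\<chi> [None, None, ?J] = (\<lambda>z. 0)" "\<chi> [?J, ?I, ?J] = (\<lambda>z. 0)"
    by (simp_all add: \<chi>_def fun_eq_iff)
  have aB: "agree b [None, ?J, ?I] [?J, ?I, None]" and rB: "reaches b [?J, ?I, None]"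
    and aA: "agree b [?I, ?J, None] [None, ?I, ?J]" and rA: "reaches b [None, ?I, ?J]"
    using twoIJ(1) twoJI(1) twoIJ(2) [of "[None, ?I, ?J]" "[None, ?I, ?J]"]
      twoJI(2) [of "[?J, ?I, None]" "[?J, ?I, None]"] by auto
  have aI: "agree b [?I, None, None] [None, ?I, None]" "agree b [None, None, ?I] [None, ?I, None]"
    and rI': "reaches b [None, ?I, None]" and rJ'': "reaches b [None, None, ?J]"
    and aJ': "agree b [None, ?J, None] [None, None, ?J]" "agree b [?J, None, None] [None, None, ?J]"
    using oneI rI oneJ rJ by auto
  note circ = spaced_island_circle [OF j _ cfD [OF c\<Theta>], folded D_def]
  have cJJ: "cf [?J, None, ?J] (\<lambda>z. add_circle D (\<Theta> z))" using circ(1) by (auto intro!: cfI)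
  have dJJ: "d [?J, None, ?J] (\<lambda>z. add_circle D (\<Theta> z)) z = 0" if z: "vertex w z" for z
  proof -
    have "d [?J, None, ?J] (\<lambda>z. add_circle D (\<Theta> z)) z = add_circle D (d [?J, None, None] \<Theta> z)"
      by (rule delta_add_circle [OF cub cub _ c\<Theta> z]) (use circ(4) j in auto)
    with d\<Theta> [OF z] show ?thesis by simp
  qed
  have SS: "S [None, ?J, None] [?I, ?J, None] z (S [?I, ?J, None] [?I, ?J, ?I] z (\<Psi> z))
      = S [None, ?J, None] [None, ?J, ?I] z (S [None, ?J, ?I] [?I, ?J, ?I] z (\<Psi> z))" if z: "vertex w z" for z
    by (rule S_S [OF ti(1) ti(1) ti(5) ti(5) cfD [OF c\<Psi> z] z]) auto
  have d010: "d [None, ?J, None] (\<phi> [None, ?J, None]) z = \<theta> z - S [None, ?J, None] [None, ?J, ?I] z (B z)"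
    if z: "vertex w z" for z
    using e010 [OF z] SS [OF z] unfolding \<theta>_def A_def B_def by (simp add: saddle_add)
  \<comment> \<open>The value left at the old closed circle after subtracting \<open>\<Psi>\<close>.
    It vanishes on tail monomials, so its two saddle images agree after transfer and drop out of the
    equation at the single turn of \<open>i\<close>.\<close>
  define \<Delta> where "\<Delta> z = \<phi> [?I, None, ?I] z - \<Psi> z" for z
  have c\<Delta>: "compat (fam b [?I, None, ?I] z) (\<Delta> z)" if z: "vertex w z" for z
  proof -
    have "compat (fam b [?I, None, ?I] z) (S [?I, None, ?I] [?I, ?J, ?I] z (\<Psi> z))"
      by (rule cS [OF tj(3) z cfD [OF c\<Psi> z]]) auto
    then show ?thesis
      using cc [of ?I None ?I z] z merge [OF z cfD [OF c\<Psi> z]] by (simp add: \<Delta>_def compat_diff)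
  qed
  have \<Delta>0: "\<Delta> z M = 0" if z: "vertex w z" and M: "set_mset M \<subseteq> points b (length w)" for z M
    using T_agrees [OF a111 zz.reaches_zigzag cc z M] z by (simp add: \<Delta>_def \<Psi>_def pointwise)
  have d100: "d [?I, None, None] (\<phi> [?I, None, None]) z
      = - S [?I, None, None] [?I, ?J, None] z (A z) - S [?I, None, None] [?I, None, ?I] z (\<Delta> z)"
    if z: "vertex w z" for z
  proof -
    have "S [?I, None, None] [?I, ?J, None] z (S [?I, ?J, None] [?I, ?J, ?I] z (\<Psi> z))
        = S [?I, None, None] [?I, None, ?I] z (S [?I, None, ?I] [?I, ?J, ?I] z (\<Psi> z))"
      by (rule S_S [OF tj(3) tj(3) ti(5) ti(5) cfD [OF c\<Psi> z] z]) auto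
    with e100 [OF z] merge [OF z cfD [OF c\<Psi> z]] show ?thesis
      unfolding A_def \<Delta>_def by (simp add: saddle_add saddle_diff algebra_simps eq_neg_iff_add_eq_0)
  qed
  have d001: "d [None, None, ?I] (\<phi> [None, None, ?I]) z
      = S [None, None, ?I] [None, ?J, ?I] z (B z) + S [None, None, ?I] [?I, None, ?I] z (\<Delta> z)"
    if z: "vertex w z" for z
  proof -
    have "S [None, None, ?I] [None, ?J, ?I] z (S [None, ?J, ?I] [?I, ?J, ?I] z (\<Psi> z))
        = S [None, None, ?I] [?I, None, ?I] z (S [?I, None, ?I] [?I, ?J, ?I] z (\<Psi> z))"
      by (rule S_S [OF tj(3) tj(3) ti(1) ti(1) cfD [OF c\<Psi> z] z]) auto
    with e001 [OF z] merge [OF z cfD [OF c\<Psi> z]] show ?thesis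
      unfolding B_def \<Delta>_def by (simp add: saddle_add saddle_diff algebra_simps)
  qed
  show ?thesis
  proof (rule detected3I [where \<phi> = \<chi>])
    fix r r' r'' assume r: "r \<in> {None, ?J}" "r' \<in> {None, ?I}" "r'' \<in> {None, ?J}"
    have "cf [None, None, None] (\<chi> [None, None, None])" using c by (simp add: \<chi>)
    moreover have "cf [?J, None, None] (\<chi> [?J, None, None])"
      unfolding \<chi> using cT [OF aJ rJ'] cc by (auto intro!: cfI)
    moreover have "cf [None, ?I, None] (\<chi> [None, ?I, None])"
      unfolding \<chi> using cT [OF aI(1) rI'] cT [OF aI(2) rI'] cc by (auto intro!: cfI compat_add)
    moreover have "cf [?J, ?I, None] (\<chi> [?J, ?I, None])"
      unfolding \<chi> using cT [OF aB rB] cfD [OF cB] by (auto intro!: cfI)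
    moreover have "cf [None, ?I, ?J] (\<chi> [None, ?I, ?J])"
      unfolding \<chi> using cT [OF aA rA] cfD [OF cA] by (auto intro!: cfI)
    moreover have "cf [?J, None, ?J] (\<chi> [?J, None, ?J])"
      unfolding \<chi> using cfD [OF cJJ] by (auto intro!: cfI compat_minus)
    moreover have "cf [None, None, ?J] (\<chi> [None, None, ?J])" "cf [?J, ?I, ?J] (\<chi> [?J, ?I, ?J])"
      unfolding \<chi> by (auto intro!: cfI)
    ultimately show "cf [r, r', r''] (\<chi> [r, r', r''])"
      using r by (elim insertE emptyE) simp_all
  next
    fix z assume z: "vertex w z"
    have "S [None, None, None] [?J, None, None] z (\<chi> [?J, None, None] z)
        = S [None, None, None] [None, ?J, None] z (\<phi> [None, ?J, None] z)"
      unfolding \<chi> using S_T [OF tj(3,1) agree_refl aJ r000 rJ' cc z] z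
        T_self [OF r000 cS [OF tj(3) z cc] z] by simp
    moreover have "S [None, None, None] [None, ?I, None] z (T [None, ?I, None] z (\<phi> [?I, None, None] z))
        = S [None, None, None] [?I, None, None] z (\<phi> [?I, None, None] z)"
      using S_T [OF ti(1,3) agree_refl aI(1) r000 rI' cc z] z
        T_self [OF r000 cS [OF ti(1) z cc] z] by simp
    moreover have "S [None, None, None] [None, ?I, None] z (T [None, ?I, None] z (\<phi> [None, None, ?I] z))
        = S [None, None, None] [None, None, ?I] z (\<phi> [None, None, ?I] z)"
      using S_T [OF ti(5,3) agree_refl aI(2) r000 rI' cc z] z
        T_self [OF r000 cS [OF ti(5) z cc] z] by simp
    ultimately show "S [None, None, None] [?J, None, None] z (\<chi> [?J, None, None] z)
        + S [None, None, None] [None, ?I, None] z (\<chi> [None, ?I, None] z)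
        + S [None, None, None] [None, None, ?J] z (\<chi> [None, None, ?J] z)
        + d [None, None, None] (\<chi> [None, None, None]) z = 0"
      using e000 [OF z] by (simp add: \<chi> saddle_add add_ac)
    have "S [None, None, ?J] [?J, None, ?J] z (add_circle D (\<Theta> z)) = T [None, None, ?J] z (\<theta> z)"
      using circ(3) [OF z z] T_T [OF aJ rJ' aJ'(2) rJ'' cfD [OF c\<theta> z] z] by (simp add: \<Theta>_def)
    moreover have "S [None, None, ?J] [None, ?I, ?J] z (T [None, ?I, ?J] z (A z)) = T [None, None, ?J] z (\<theta> z)"
      unfolding \<theta>_def using S_T [OF ti(1,3) aJ'(1) aA rJ'' rA cfD [OF cA z] z] by simp
    ultimately show "S [None, None, ?J] [?J, None, ?J] z (\<chi> [?J, None, ?J] z)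
        + S [None, None, ?J] [None, ?I, ?J] z (\<chi> [None, ?I, ?J] z)
        - d [None, None, ?J] (\<chi> [None, None, ?J]) z = 0"
      by (simp add: \<chi> saddle_minus delta_zero)
    have "S [None, ?I, None] [None, ?I, ?J] z (T [None, ?I, ?J] z (A z))
        = T [None, ?I, None] z (S [?I, None, None] [?I, ?J, None] z (A z))"
      using S_T [OF tj(3,5) aI(1) aA rI' rA cfD [OF cA z] z] by simp
    moreover have "S [None, ?I, None] [?J, ?I, None] z (T [?J, ?I, None] z (B z))
        = T [None, ?I, None] z (S [None, None, ?I] [None, ?J, ?I] z (B z))"
      using S_T [OF tj(3,1) aI(2) aB rI' rB cfD [OF cB z] z] by simp
    moreover have "d [None, ?I, None] (\<lambda>z. T [None, ?I, None] z (\<phi> [?I, None, None] z)) z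
        = T [None, ?I, None] z (d [?I, None, None] (\<phi> [?I, None, None]) z)"
      by (rule d_T [OF aI(1) rI' fl fl c z]) auto
    moreover have "d [None, ?I, None] (\<lambda>z. T [None, ?I, None] z (\<phi> [None, None, ?I] z)) z
        = T [None, ?I, None] z (d [None, None, ?I] (\<phi> [None, None, ?I]) z)"
      by (rule d_T [OF aI(2) rI' fl fl c z]) auto
    ultimately show "S [None, ?I, None] [?J, ?I, None] z (\<chi> [?J, ?I, None] z)
        - S [None, ?I, None] [None, ?I, ?J] z (\<chi> [None, ?I, ?J] z)
        - d [None, ?I, None] (\<chi> [None, ?I, None]) z = 0"
      using spaced_island_vanish [OF i z c\<Delta> [OF z] \<Delta>0 [OF z]]
      by (simp add: \<chi> delta_add d100 [OF z] d001 [OF z] transfer_add transfer_diff transfer_minus)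
    show "S [None, ?I, ?J] [?J, ?I, ?J] z (\<chi> [?J, ?I, ?J] z) + d [None, ?I, ?J] (\<chi> [None, ?I, ?J]) z = 0"
      unfolding \<chi> using d_T [OF aA rA fl fl cA z] dA [OF z] by simp
    have "S [?J, None, None] [?J, ?I, None] z (T [?J, ?I, None] z (B z))
        = T [?J, None, None] z (S [None, ?J, None] [None, ?J, ?I] z (B z))"
      using S_T [OF ti(5,3) aJ aB rJ' rB cfD [OF cB z] z] by simp
    moreover have "d [?J, None, None] (\<lambda>z. T [?J, None, None] z (\<phi> [None, ?J, None] z)) z
        = T [?J, None, None] z (d [None, ?J, None] (\<phi> [None, ?J, None]) z)"
      by (rule d_T [OF aJ rJ' fl fl c z]) auto
    ultimately show "S [?J, None, None] [?J, ?I, None] z (\<chi> [?J, ?I, None] z)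
        + S [?J, None, None] [?J, None, ?J] z (\<chi> [?J, None, ?J] z)
        + d [?J, None, None] (\<chi> [?J, None, None]) z = 0"
      using circ(2) [OF z z] by (simp add: \<chi> d010 [OF z] transfer_diff saddle_minus \<Theta>_def)
    show "S [?J, None, ?J] [?J, ?I, ?J] z (\<chi> [?J, ?I, ?J] z) - d [?J, None, ?J] (\<chi> [?J, None, ?J]) z = 0"
      unfolding \<chi> using dJJ [OF z] by (simp add: delta_minus)
    show "S [?J, ?I, None] [?J, ?I, ?J] z (\<chi> [?J, ?I, ?J] z) + d [?J, ?I, None] (\<chi> [?J, ?I, None]) z = 0"
      unfolding \<chi> using d_T [OF aB rB fl fl cB z] dB [OF z] by simp
    show "d [?J, ?I, ?J] (\<chi> [?J, ?I, ?J]) z = 0"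
      unfolding \<chi> by (simp add: delta_zero)
  next
    show "\<chi> [None, None, None] (replicate (length w) None) (strand_tops b) = 1" using psi by (simp add: \<chi>)
  qed
qed

end

section \<open>Rotation of the word\<close>

lemma psi_detectedI_sign:
  assumes "compat_family (conn b) w \<Phi>" "\<And>z. vertex w z \<Longrightarrow> delta (conn b) w \<Phi> z = 0"
    and "\<Phi> (replicate (length w) None) (strand_tops b) \<in> {1, - 1}"
  shows "psi_detected b w"
proof (cases "\<Phi> (replicate (length w) None) (strand_tops b) = 1")
  case True
  with assms(1,2) show ?thesis by (rule psi_detectedI)
next
  case False
  show ?thesis
  proof (rule psi_detectedI)
    show "compat_family (conn b) w (\<lambda>z. - \<Phi> z)"
      using assms(1) by (simp add: compat_family_def compat_minus)
    show "delta (conn b) w (\<lambda>z. - \<Phi> z) z = 0" if "vertex w z" for z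
      using assms(2) [OF that] by (simp add: delta_minus)
    show "(- \<Phi> (replicate (length w) None)) (strand_tops b) = 1"
      using assms(3) False by (simp add: pointwise)
  qed
qed

fun odd_ones :: "braid_word \<Rightarrow> flat \<Rightarrow> bool" where
  "odd_ones (c # w) (r # z) \<longleftrightarrow> (r = one_res c) \<noteq> odd_ones w z"
| "odd_ones w z \<longleftrightarrow> False"

definition sgn_if :: "bool \<Rightarrow> 'a functional \<Rightarrow> 'a functional" where
  "sgn_if o' \<Phi> = (if o' then - \<Phi> else \<Phi>)"

text \<open>Every edge of the cube changes the parity of the number of 1-resolutions, so conjugation
  with the parity sign negates each term of the coboundary.\<close>

lemma delta_sgn_if:
  "vertex w z \<Longrightarrow> delta E w (\<lambda>z. sgn_if (odd_ones w z \<noteq> q) (\<Phi> z)) z = sgn_if (odd_ones w z = q) (delta E w \<Phi> z)"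
proof (induction w arbitrary: E \<Phi> z q)
  case Nil
  then show ?case by (simp add: sgn_if_def)
next
  case (Cons c w)
  then obtain r z' where z: "z = r # z'" "r = zero_res c \<or> r = one_res c" "vertex w z'"
    by (auto simp: vertex_Cons)
  have "delta (\<lambda>z. E (r # z)) w (\<lambda>z. sgn_if (odd_ones w z \<noteq> (q \<noteq> (r = one_res c))) (\<Phi> (r # z))) z'
      = sgn_if (odd_ones w z' = (q \<noteq> (r = one_res c))) (delta (\<lambda>z. E (r # z)) w (\<lambda>z. \<Phi> (r # z)) z')"
    by (rule Cons.IH) fact
  moreover have "(((r = one_res c) \<noteq> odd_ones w z) \<noteq> q) = (odd_ones w z \<noteq> (q \<noteq> (r = one_res c)))"
    "(((r = one_res c) \<noteq> odd_ones w z) = q) = (odd_ones w z = (q \<noteq> (r = one_res c)))" for z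
    by blast+
  ultimately have IH: "delta (\<lambda>z. E (r # z)) w (\<lambda>z. sgn_if (odd_ones (c # w) (r # z) \<noteq> q) (\<Phi> (r # z))) z'
      = sgn_if (odd_ones (c # w) (r # z') = q) (delta (\<lambda>z. E (r # z)) w (\<lambda>z. \<Phi> (r # z)) z')"
    by (simp only: odd_ones.simps)
  from z(2) show ?case
  proof
    assume r: "r = zero_res c"
    with IH show ?case unfolding z(1)
      by (auto simp: sgn_if_def saddle_minus)
  next
    assume r: "r = one_res c"
    with IH show ?case unfolding z(1)
      by (auto simp: sgn_if_def)
  qed
qed

text \<open>All other letters stand in front of the last one, so its saddle carries the full parity
  of \<open>w\<close>; the signs of the letters of \<open>w\<close> are not affected by it.\<close>

lemma delta_snoc:
  "vertex w z \<Longrightarrow> delta E (w @ [c]) \<Phi> (z @ [r]) = delta (\<lambda>z. E (z @ [r])) w (\<lambda>z. \<Phi> (z @ [r])) z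
     + (if r = zero_res c then sgn_if (odd_ones w z)
          (saddle (E (z @ [zero_res c])) (E (z @ [one_res c])) (\<Phi> (z @ [one_res c]))) else 0)"
proof (induction w arbitrary: E \<Phi> z)
  case Nil
  then show ?case by (simp add: sgn_if_def)
next
  case (Cons c' w)
  then obtain r' z' where z: "z = r' # z'" "r' = zero_res c' \<or> r' = one_res c'" "vertex w z'"
    by (auto simp: vertex_Cons)
  show ?case using Cons.IH [OF z(3), of "\<lambda>z. E (r' # z)" "\<lambda>z. \<Phi> (r' # z)"] z(1,2)
    by (auto simp: sgn_if_def algebra_simps)
qed

lemma vertex_snoc: "vertex (w @ [c]) zz \<longleftrightarrow> (\<exists>z r. zz = z @ [r] \<and> vertex w z \<and> (r = zero_res c \<or> r = one_res c))"
proof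
  show "vertex (w @ [c]) zz \<Longrightarrow> \<exists>z r. zz = z @ [r] \<and> vertex w z \<and> (r = zero_res c \<or> r = one_res c)"
    unfolding vertex_def list_all2_append1 list_all2_Cons1 by auto
  show "\<exists>z r. zz = z @ [r] \<and> vertex w z \<and> (r = zero_res c \<or> r = one_res c) \<Longrightarrow> vertex (w @ [c]) zz"
    unfolding vertex_def by (auto intro!: list_all2_appendI)
qed

text \<open>A letter behind \<open>w\<close> raises all attaching points by one level.\<close>

lemma cubical_conn_snoc:
  assumes "p \<in> flats b" "[r] \<in> flats b" "w \<in> braid_words b"
  shows "\<exists>ps. cubical (\<lambda>z. conn b (p @ z @ [r])) w ps"
proof -
  define ps where "ps w = map (\<lambda>((i, l), (j, m)). ((i, Suc l), (j, Suc m))) (corners w)" for w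
  have "cubical (\<lambda>z. conn b (p @ z @ [r])) w (ps w)"
    using assms(1,3)
  proof (induction w arbitrary: p)
    case (Cons c w)
    have "edge (conn b (p @ zero_res c # z @ [r])) (conn b (p @ one_res c # z @ [r]))
       (fst c, Suc (Suc (length w))) (Suc (fst c), Suc (length w))" if "vertex w z" for z
      using edge_conn_res [of p "z @ [r]" b c] Cons.prems assms(2) vertex_flats [OF that] vertex_length [OF that] by auto
    moreover have "cubical (\<lambda>z. conn b (p @ r' # z @ [r])) w (ps w)"
      if "r' \<in> {zero_res c, one_res c}" for r'
      using Cons.IH [of "p @ [r']"] Cons.prems that by (auto simp: zero_res_def one_res_def)
    ultimately show ?case by (simp add: ps_def)
  qed (simp add: ps_def)
  then show ?thesis by blast
qed

text \<open>In front, a 1-resolved \<open>c\<close> negates the coboundary of \<open>w\<close>; at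
  the end, the saddle of \<open>c\<close> carries the parity of \<open>w\<close>. Multiplying the
  values with \<open>c\<close> 1-resolved by this parity converts one rule into the other. For a
  negative \<open>c\<close> this affects the oriented vertex, so the value on psi is only known up
  to sign.\<close>

lemma detected_rotate:
  assumes cw: "c # w \<in> braid_words b" and "psi_detected b (c # w)"
  shows "psi_detected b (w @ [c])"
proof -
  interpret word b w by unfold_locales (use cw in simp)
  from assms(2) obtain \<Phi> where \<Phi>: "compat_family (conn b) (c # w) \<Phi>"
    "\<And>z. vertex (c # w) z \<Longrightarrow> delta (conn b) (c # w) \<Phi> z = 0"
    "\<Phi> (replicate (length (c # w)) None) (strand_tops b) = 1"
    by (elim psi_detectedE) blast
  define Q where "Q = points b (Suc (length w))"
  define f :: "point \<Rightarrow> point" where "f = (\<lambda>(p, l). (p, if l = 0 then length w else l - 1))"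
  define R where "R zz \<Psi> = transfer (conn b zz) Q f \<Psi>" for zz \<Psi>
  have R_minus: "R zz (- \<Psi>) = - R zz \<Psi>" for zz \<Psi>
    by (simp add: R_def transfer_minus)
  have R_sgn: "R zz (sgn_if q \<Psi>) = sgn_if q (R zz \<Psi>)" for zz q \<Psi>
    by (simp add: R_def sgn_if_def transfer_minus)
  have res: "zero_res c # w' \<in> flats b \<longleftrightarrow> w' \<in> flats b" "one_res c # w' \<in> flats b \<longleftrightarrow> w' \<in> flats b" for w'
    using cw by (auto simp: zero_res_def one_res_def)
  have m: "models Q f (conn b (r # z)) (conn b (z @ [r]))" if "vertex w z" "r = zero_res c \<or> r = one_res c" for r z
  proof -
    have "r # z \<in> flats b" using that vf res by blast
    from models_rotate [OF this] show ?thesis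
      unfolding vertex_length [OF that(1)] Q_def f_def .
  qed
  have c\<Phi>: "compat (conn b (r # z)) (\<Phi> (r # z))" if "vertex w z" "r = zero_res c \<or> r = one_res c" for r z
    using \<Phi>(1) that by (auto simp: compat_family_def)
  define \<Phi>' where "\<Phi>' zz = R zz (sgn_if (last zz = one_res c \<and> odd_ones w (butlast zz)) (\<Phi> (last zz # butlast zz)))" for zz
  have \<Phi>': "\<Phi>' (z @ [r]) = R (z @ [r]) (sgn_if (r = one_res c \<and> odd_ones w z) (\<Phi> (r # z)))" for z r
    by (simp add: \<Phi>'_def)
  have cR: "compat (conn b (z @ [r])) (R (z @ [r]) \<Psi>)"
    if "compat (conn b (r # z)) \<Psi>" "vertex w z" "r = zero_res c \<or> r = one_res c" for r z \<Psi>
    unfolding R_def using compat_transfer [OF m] that by blast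
  have csgn: "compat E (sgn_if q \<Psi>)" if "compat E \<Psi>" for E q and \<Psi> :: "point functional"
    using that by (simp add: sgn_if_def compat_minus)
  show ?thesis
  proof (rule psi_detectedI_sign)
    show "compat_family (conn b) (w @ [c]) \<Phi>'"
      unfolding compat_family_def vertex_snoc using cR [OF csgn [OF c\<Phi>]] \<Phi>' by auto
    fix zz assume "vertex (w @ [c]) zz"
    then obtain z r where z: "zz = z @ [r]" "vertex w z" "r = zero_res c \<or> r = one_res c"
      by (auto simp: vertex_snoc)
    have fl: "[r] \<in> flats b" using z(3) res [of "[]"] by auto
    from cubical_conn_snoc [of "[]", OF _ fl w] obtain qs where qs: "cubical (\<lambda>z. conn b (z @ [r])) w qs" by auto
    have ps: "cubical (\<lambda>z. conn b (r # z)) w (corners w)" using cubical_conn [OF fl w] by simp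
    have "delta (\<lambda>z. conn b (z @ [r])) w (\<lambda>z. \<Phi>' (z @ [r])) z
        = R (z @ [r]) (delta (\<lambda>z. conn b (r # z)) w (\<lambda>z. sgn_if (r = one_res c \<and> odd_ones w z) (\<Phi> (r # z))) z)"
      unfolding \<Phi>' R_def
      by (rule delta_transfer [OF ps qs m _ z(2)]) (use z(3) c\<Phi> in \<open>auto simp: compat_family_def intro: csgn\<close>)
    moreover have "delta (conn b) (c # w) \<Phi> (r # z) = 0" by (rule \<Phi>(2)) (use z in simp)
    moreover have "sgn_if (r = one_res c \<and> odd_ones w z) \<Psi> = (if r = one_res c then sgn_if (odd_ones w z \<noteq> False) \<Psi> else \<Psi>)"
      for z and \<Psi> :: "point functional" by (simp add: sgn_if_def)
    ultimately have 1: "delta (\<lambda>z. conn b (z @ [r])) w (\<lambda>z. \<Phi>' (z @ [r])) z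
       = (if r = zero_res c then R (z @ [r]) (- saddle (conn b (zero_res c # z)) (conn b (one_res c # z)) (\<Phi> (one_res c # z)))
          else 0)"
      using z(2,3) delta_sgn_if [OF z(2), of "\<lambda>z. conn b (r # z)" False "\<lambda>z. \<Phi> (r # z)"]
      by (auto simp: R_def sgn_if_def add_eq_0_iff)
    have "saddle (conn b (z @ [zero_res c])) (conn b (z @ [one_res c])) (R (z @ [one_res c]) (\<Phi> (one_res c # z)))
        = R (z @ [zero_res c]) (saddle (conn b (zero_res c # z)) (conn b (one_res c # z)) (\<Phi> (one_res c # z)))"
      unfolding R_def
      by (rule saddle_transfer [OF edge_conn_res [of "[]" z b c, simplified] edge_conn_res [of z "[]" b c]])
        (use cw vf [OF z(2)] m z(2) c\<Phi> in auto)
    then have 2: "sgn_if (odd_ones w z) (saddle (conn b (z @ [zero_res c])) (conn b (z @ [one_res c])) (\<Phi>' (z @ [one_res c])))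
        = R (z @ [zero_res c]) (saddle (conn b (zero_res c # z)) (conn b (one_res c # z)) (\<Phi> (one_res c # z)))"
      by (simp add: \<Phi>' R_minus sgn_if_def saddle_minus)
    show "delta (conn b) (w @ [c]) \<Phi>' zz = 0"
      unfolding z(1) delta_snoc [OF z(2)] 1 using 2 by (simp add: R_def transfer_minus)
  next
    let ?z = "replicate (length w) None"
    have rep: "replicate (length (w @ [c])) None = ?z @ [None]" by (simp add: replicate_append_same)
    have nc: "None = zero_res c \<or> None = one_res c" by (auto simp: zero_res_def one_res_def)
    have "agrees Q f \<Psi> (R (?z @ [None]) \<Psi>)" if "compat (conn b (None # ?z)) \<Psi>" for \<Psi>
      unfolding R_def using agrees_transfer [OF m [OF vertex_oriented nc] that] .
    from this [OF csgn [OF c\<Phi> [OF vertex_oriented nc]]]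
    have v: "\<Phi>' (?z @ [None]) (strand_tops b)
        = sgn_if (None = one_res c \<and> odd_ones w ?z) (\<Phi> (None # ?z)) (image_mset f (strand_tops b))"
      unfolding \<Phi>' agrees_def Q_def using strand_tops_points by blast
    \<comment> \<open>Rotation moves the factors of the monomial from level 0 to level
      \<open>length w\<close>, but along the same vertical strings.\<close>
    have "\<Phi> (None # ?z) (strand_tops b) = \<Phi> (None # ?z) (image_mset f (strand_tops b))"
    proof (rule compat_image_mset [OF c\<Phi> [OF vertex_oriented nc]])
      fix a assume "a \<in># strand_tops b"
      then obtain p where p: "a = (p, 0)" "p \<in> {1..b}" by (auto simp: strand_tops_def)
      then show "conn b (None # ?z) a (f a)"
        using conn_sym [OF oriented_conn [of p b "length w" "Suc (length w)"]] by (simp add: f_def)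
    qed
    with v \<Phi>(3) show "\<Phi>' (replicate (length (w @ [c])) None) (strand_tops b) \<in> {1, - 1}"
      unfolding rep by (auto simp: sgn_if_def pointwise)
  qed
qed

section \<open>Adding and removing the last string\<close>

lemma detected_add_strand:
  assumes w: "w \<in> braid_words b" and "psi_detected b w"
  shows "psi_detected (Suc b) w"
proof -
  from assms(2) obtain \<Phi> where \<Phi>: "compat_family (conn b) w \<Phi>" "\<And>z. vertex w z \<Longrightarrow> delta (conn b) w \<Phi> z = 0"
    "\<Phi> (replicate (length w) None) (strand_tops b) = 1"
    by (elim psi_detectedE) blast
  have w': "w \<in> braid_words (Suc b)" using w by (auto simp: braid_words_def)
  define D where "D = {Suc b} \<times> {0..length w}"
  have x: "extra_circle D (conn (Suc b) z) (conn b z)" if "vertex w z" for z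
    using extra_strand [OF vertex_flats [OF that w]] vertex_length [OF that] by (simp add: D_def)
  have cub: "cubical (conn b) w (corners w)" "cubical (conn (Suc b)) w (corners w)"
    using cubical_conn [of "[]" b w] cubical_conn [of "[]" "Suc b" w] w w' by simp_all
  show ?thesis
  proof (rule psi_detectedI)
    \<comment> \<open>The new string is a separate circle in every resolution. Its label in psi is
      \<open>u_minus\<close>, and \<open>add_circle\<close> reads off precisely this
      coefficient.\<close>
    show "compat_family (conn (Suc b)) w (\<lambda>z. add_circle D (\<Phi> z))"
      using compat_add_circle [OF x _ per_conn] \<Phi>(1) by (simp add: compat_family_def)
    show "delta (conn (Suc b)) w (\<lambda>z. add_circle D (\<Phi> z)) z = 0" if "vertex w z" for z
      using delta_add_circle [OF cub(2,1) x \<Phi>(1) that] \<Phi>(2) [OF that] by simp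
    have "filter_mset (\<lambda>a. a \<in> D) (strand_tops b) = {#}" "filter_mset (\<lambda>a. a \<notin> D) (strand_tops b) = strand_tops b"
      by (auto simp: strand_tops_def D_def filter_mset_eq_conv)
    moreover have "strand_tops (Suc b) = add_mset (Suc b, 0) (strand_tops b)"
      by (simp add: strand_tops_def atLeastAtMostSuc_conv)
    moreover have "(Suc b, 0) \<in> D" by (simp add: D_def)
    ultimately show "add_circle D (\<Phi> (replicate (length w) None)) (strand_tops (Suc b)) = 1"
      using \<Phi>(3) by (simp add: add_circle_def)
  qed
qed

text \<open>The chain map of Reidemeister I: the saddle of the crossing fuses the last string,
  through \<open>o'\<close>, with the circle of \<open>a\<close>, so multiplication by the
  difference of their variables maps into its kernel. The transpose of this multiplication turns the
  value at \<open>None\<close> into a cocycle, which is then restricted to the first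
  \<open>b\<close> strings.\<close>

lemma detected_destabilize:
  assumes wb: "w \<in> braid_words b" and b: "1 \<le> b" and "psi_detected (Suc b) ((b, True) # w)"
  shows "psi_detected b w"
proof -
  have w': "w \<in> braid_words (Suc b)" using wb by (auto simp: braid_words_def)
  interpret word "Suc b" w by unfold_locales (rule w')
  from assms(3) obtain \<Phi> where \<Phi>: "compat_family (conn (Suc b)) ((b, True) # w) \<Phi>"
    "\<And>z. vertex ((b, True) # w) z \<Longrightarrow> delta (conn (Suc b)) ((b, True) # w) \<Phi> z = 0"
    "\<Phi> (replicate (length ((b, True) # w)) None) (strand_tops (Suc b)) = 1"
    by (elim psi_detectedE) blast
  define \<phi> where "\<phi> p z = \<Phi> (p @ z)" for p z
  have \<phi>: "\<Phi> (r # z) = \<phi> [r] z" for r z by (simp add: \<phi>_def)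
  have c: "cf [None] (\<phi> [None])" "cf [Some b] (\<phi> [Some b])"
    using \<Phi>(1) unfolding compat_family_Cons by (auto simp: \<phi> conn_fam1 zero_res_def one_res_def)
  have e: "S [None] [Some b] z (\<phi> [Some b] z) + d [None] (\<phi> [None]) z = 0" if "vertex w z" for z
    using \<Phi>(2) [of "None # z"] that by (simp add: \<phi> conn_fam1 zero_res_def one_res_def)
  define o' :: point where "o' = (Suc b, 0)"
  define a :: point where "a = (b, 0)"
  \<comment> \<open>The letters of \<open>w\<close> do not involve the string \<open>Suc b\<close>,
    so with the crossing resolved vertically this string is a circle by itself.\<close>
  have sep: "\<not> fam (Suc b) [None] z a o'" if z: "vertex w z" for z
  proof -
    have "extra_circle ({Suc b} \<times> {0..length (None # z)}) (conn (Suc b) (None # z)) (conn b (None # z))"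
      using vertex_flats [OF z wb] by (intro extra_strand) simp
    then have "\<not> fam (Suc b) [None] z o' a"
      unfolding extra_circle_def o'_def a_def conn_fam1 by force
    then show ?thesis using per_sym [OF per_fam, of "Suc b" "[None]" z a o'] by blast
  qed
  have con: "fam (Suc b) [Some b] z a o'" if z: "vertex w z" for z
  proof -
    have fl: "Some b # z \<in> flats (Suc b)" using vf [OF z] b by simp
    have "conn (Suc b) (Some b # z) (b, Suc (length z)) (Suc b, Suc (length z))"
      by (rule strands_conn [OF _ fl]) (simp add: letter_link_turn)
    moreover have "conn (Suc b) (Some b # z) (b, Suc (length z)) a" "conn (Suc b) (Some b # z) (Suc b, Suc (length z)) o'"
      using closing_conn [OF fl, of b] closing_conn [OF fl, of "Suc b"] b by (simp_all add: a_def o'_def)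
    ultimately show ?thesis using conn_trans conn_sym unfolding conn_fam1 [symmetric] by blast
  qed
  have t: "turn (Suc b) b 0 [None] [Some b]" using turnI1 [of b "Suc b" "[]" "[]"] b by simp
  have merge: "S [None] [Some b] z (\<phi> [Some b] z) = \<phi> [Some b] z" if z: "vertex w z" for z
    by (rule saddle_merge [OF edge [OF t z] con [OF z] sep [OF z]])
  define \<chi> where "\<chi> z = mark o' (\<phi> [None] z) - mark a (\<phi> [None] z)" for z
  have c\<chi>: "cf [None] \<chi>"
    unfolding \<chi>_def using cfD [OF c(1)] by (auto intro!: cfI compat_diff compat_mark)
  have d\<chi>: "d [None] \<chi> z = 0" if z: "vertex w z" for z
  proof -
    have "d [None] \<chi> z = mark o' (d [None] (\<phi> [None]) z) - mark a (d [None] (\<phi> [None]) z)"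
      unfolding \<chi>_def by (simp add: delta_diff delta_mark)
    also have "d [None] (\<phi> [None]) z = - \<phi> [Some b] z"
      using e [OF z] merge [OF z] by (simp add: add_eq_0_iff)
    finally show ?thesis using compat_eq [OF cfD [OF c(2) z] con [OF z]] by simp
  qed
  define Q where "Q = points b (length w)"
  have m: "models Q (\<lambda>a. a) (fam (Suc b) [None] z) (conn b z)" if z: "vertex w z" for z
  proof -
    have "conn b z u v \<longleftrightarrow> fam (Suc b) [None] z u v" if "u \<in> Q" "v \<in> Q" for u v
    proof -
      have uv: "u \<in> points b (length z)" "v \<in> points b (length z)" using that vertex_length [OF z] by (auto simp: Q_def)
      then have "u \<in> points (Suc b) (length z)" "v \<in> points (Suc b) (length z)" by (auto simp: points_def)
      then have "fam (Suc b) [None] z u v \<longleftrightarrow> conn (Suc b) z u v"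
        using agree_remove_None [of "[]" "[]" "Suc b"] vf [OF z] unfolding agree_def fam_def by simp
      also have "\<dots> \<longleftrightarrow> conn b z u v"
      proof -
        have "u \<notin> {Suc b} \<times> {0..length z}" "v \<notin> {Suc b} \<times> {0..length z}"
          using uv by (auto simp: points_def)
        then show ?thesis
          using extra_strand [OF vertex_flats [OF z wb]] unfolding extra_circle_def by blast
      qed
      finally show ?thesis ..
    qed
    moreover have "\<exists>q\<in>Q. conn b z u q" if "conn b z u u" for u
      using that conn_points [OF that] vertex_length [OF z] by (auto simp: Q_def)
    ultimately show ?thesis by (simp add: models_def per_conn per_fam)
  qed
  have cub': "cubical (conn b) w (corners w)" using cubical_conn [of "[]" b w] wb by simp
  show ?thesis
  proof (rule psi_detectedI)
    show "compat_family (conn b) w (\<lambda>z. transfer (conn b z) Q (\<lambda>a. a) (\<chi> z))"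
      using compat_transfer [OF m] cfD [OF c\<chi>] by (simp add: compat_family_def)
    show "delta (conn b) w (\<lambda>z. transfer (conn b z) Q (\<lambda>a. a) (\<chi> z)) z = 0" if z: "vertex w z" for z
      using delta_transfer [OF cub cub' m c\<chi> z] d\<chi> [OF z] by simp
    let ?z = "replicate (length w) None"
    have "strand_tops (Suc b) = add_mset o' (strand_tops b)"
      by (simp add: strand_tops_def atLeastAtMostSuc_conv o'_def)
    then have "mark o' (\<phi> [None] ?z) (strand_tops b) = 1" using \<Phi>(3) by (simp add: mark_def \<phi>)
    \<comment> \<open>The monomial already contains the variable of \<open>a\<close>, so the second
      term of the difference meets a square; the first supplies the factor on the new
      string.\<close>
    moreover have "mark a (\<phi> [None] ?z) (strand_tops b) = 0"
    proof -
      have "strand_tops b = add_mset a (image_mset (\<lambda>p. (p, 0)) (mset_set ({1..b} - {b})))"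
        using b mset_set.remove [of "{1..b}" b] by (simp add: strand_tops_def a_def)
      moreover have "mark a (mark a (\<phi> [None] ?z)) = 0"
        using cfD [OF c(1) vertex_oriented] unfolding compat_def by blast
      ultimately show ?thesis by (simp add: pointwise flip: mark_apply)
    qed
    moreover have "agrees Q (\<lambda>a. a) (\<chi> ?z) (transfer (conn b ?z) Q (\<lambda>a. a) (\<chi> ?z))"
      using agrees_transfer [OF m cfD [OF c\<chi>]] vertex_oriented by blast
    ultimately show "transfer (conn b ?z) Q (\<lambda>a. a) (\<chi> ?z) (strand_tops b) = 1"
      using strand_tops_points [of b "length w"] by (simp add: agrees_def \<chi>_def pointwise Q_def)
  qed
qed


section \<open>Transverse isotopy and quasipositivity\<close>

lemma detected_rotate_append:
  "u @ v \<in> braid_words b \<Longrightarrow> psi_detected b (u @ v) \<Longrightarrow> psi_detected b (v @ u)"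
proof (induction u arbitrary: v)
  case (Cons c u)
  then have "psi_detected b ((u @ v) @ [c])" using detected_rotate [of c "u @ v" b] by simp
  then have "psi_detected b (u @ (v @ [c]))" by simp
  with Cons show ?case using Cons.IH [of "v @ [c]"] by simp
qed simp

text \<open>Rotation brings the altered subword to the front and, after the change, back to its
  place.\<close>

lemma detected_local:
  assumes "\<And>v. v \<in> braid_words b \<Longrightarrow> psi_detected b (x @ v) \<Longrightarrow> psi_detected b (y @ v)"
    and "u \<in> braid_words b" "v \<in> braid_words b" "x \<in> braid_words b" "y \<in> braid_words b"
    and "psi_detected b (u @ x @ v)"
  shows "psi_detected b (u @ y @ v)"
proof -
  have "psi_detected b (x @ (v @ u))" using detected_rotate_append [of u "x @ v" b] assms by simp
  then have "psi_detected b (y @ (v @ u))" using assms by simp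
  then show ?thesis using detected_rotate_append [of "y @ v" u b] assms by simp
qed

lemma detected_insert_anywhere:
  assumes "u \<in> braid_words b" "v \<in> braid_words b" "1 \<le> i" "i < b" "psi_detected b (u @ v)"
  shows "psi_detected b (u @ [(i, True)] @ v)"
  by (rule detected_local [of b "[]"]) (use assms word.detected_insert word.intro in auto)

lemma detected_cancel:
  assumes "u \<in> braid_words b" "v \<in> braid_words b" "1 \<le> i" "i < b"
  shows "psi_detected b (u @ [(i, s), (i, \<not> s)] @ v) \<longleftrightarrow> psi_detected b (u @ v)"
proof
  show "psi_detected b (u @ v)" if "psi_detected b (u @ [(i, s), (i, \<not> s)] @ v)"
  proof -
    have "psi_detected b (u @ [] @ v)"
    proof (rule detected_local [of b "[(i, s), (i, \<not> s)]"])
      show "psi_detected b ([] @ v)" if "v \<in> braid_words b" "psi_detected b ([(i, s), (i, \<not> s)] @ v)" for v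
        using word.detected_cancel2 [OF word.intro [OF that(1)] assms(3,4)] that(2) by simp
    qed (use that assms in auto)
    then show ?thesis by simp
  qed
  show "psi_detected b (u @ [(i, s), (i, \<not> s)] @ v)" if "psi_detected b (u @ v)"
    by (rule detected_local [of b "[]"]) (use that assms word.detected_cancel1 [OF word.intro] in auto)
qed

lemma detected_braid_move:
  assumes "braid_move b x y"
  shows "psi_detected b x \<longleftrightarrow> psi_detected b y"
  using assms
proof cases
  case (cancel u v i s)
  then show ?thesis using detected_cancel by simp
next
  case (far_commute u v i j)
  have "psi_detected b (u @ [(j, True), (i, True)] @ v)" if "psi_detected b (u @ [(i, True), (j, True)] @ v)"
    using detected_local [of b "[(i, True), (j, True)]" "[(j, True), (i, True)]" u v] that far_commute
      word.detected_far [OF word.intro, of _ b i j] by simp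
  moreover have "psi_detected b (u @ [(i, True), (j, True)] @ v)" if "psi_detected b (u @ [(j, True), (i, True)] @ v)"
    using detected_local [of b "[(j, True), (i, True)]" "[(i, True), (j, True)]" u v] that far_commute
      word.detected_far [OF word.intro, of _ b j i] by simp
  ultimately show ?thesis using far_commute by blast
next
  case (braid_relation u v i)
  have z: "zigzag b i (i + 1)" "zigzag b (i + 1) i" using braid_relation by unfold_locales auto
  have "psi_detected b (u @ [(i + 1, True), (i, True), (i + 1, True)] @ v)"
    if "psi_detected b (u @ [(i, True), (i + 1, True), (i, True)] @ v)"
    using detected_local [of b "[(i, True), (i + 1, True), (i, True)]" "[(i + 1, True), (i, True), (i + 1, True)]" u v]
      that braid_relation word.detected_braid_relation [OF word.intro z(1)] by simp
  moreover have "psi_detected b (u @ [(i, True), (i + 1, True), (i, True)] @ v)"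
    if "psi_detected b (u @ [(i + 1, True), (i, True), (i + 1, True)] @ v)"
    using detected_local [of b "[(i + 1, True), (i, True), (i + 1, True)]" "[(i, True), (i + 1, True), (i, True)]" u v]
      that braid_relation word.detected_braid_relation [OF word.intro z(2)] by simp
  ultimately show ?thesis using braid_relation by blast
qed

lemma detected_same_braid:
  assumes "same_braid b x y"
  shows "psi_detected b x \<longleftrightarrow> psi_detected b y"
proof -
  from assms have "equivclp (braid_move b) x y" by (simp add: same_braid_def)
  then show ?thesis
    by (induction rule: equivclp_induct) (use detected_braid_move in blast)+
qed

lemma inverse_word_Nil [simp]: "inverse_word [] = []"
  by (simp add: inverse_word_def)

lemma inverse_word_snoc: "inverse_word (u @ [(i, s)]) = (i, \<not> s) # inverse_word u"
  by (simp add: inverse_word_def)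

lemma inverse_word_inverse_word: "inverse_word (inverse_word u) = u"
  by (simp add: inverse_word_def rev_map comp_def split_def)

lemma inverse_word_braid_words: "u \<in> braid_words b \<Longrightarrow> inverse_word u \<in> braid_words b"
  by (auto simp: inverse_word_def braid_words_def)

lemma detected_cancel_inverse:
  "u \<in> braid_words b \<Longrightarrow> v \<in> braid_words b \<Longrightarrow> psi_detected b (u @ inverse_word u @ v) \<longleftrightarrow> psi_detected b v"
proof (induction u rule: rev_induct)
  case (snoc c u)
  obtain i s where c: "c = (i, s)" by force
  have "psi_detected b (u @ [(i, s), (i, \<not> s)] @ (inverse_word u @ v)) \<longleftrightarrow> psi_detected b (u @ inverse_word u @ v)"
    using snoc c inverse_word_braid_words by (intro detected_cancel) auto
  with snoc show ?case by (simp add: c inverse_word_snoc)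
qed simp

text \<open>After rotation the conjugating word and its inverse are adjacent and cancel.\<close>

lemma detected_conjugate:
  assumes "w \<in> braid_words b" "u \<in> braid_words b"
  shows "psi_detected b (u @ w @ inverse_word u) \<longleftrightarrow> psi_detected b w"
proof -
  have i: "inverse_word u \<in> braid_words b" using assms inverse_word_braid_words by blast
  have "psi_detected b (u @ w @ inverse_word u) \<longleftrightarrow> psi_detected b (inverse_word u @ u @ w)"
    using detected_rotate_append [of "u @ w" "inverse_word u" b]
      detected_rotate_append [of "inverse_word u" "u @ w" b] assms i by auto
  also have "\<dots> \<longleftrightarrow> psi_detected b w"
    using detected_cancel_inverse [OF i assms(1)] by (simp add: inverse_word_inverse_word)
  finally show ?thesis .
qed

text \<open>A positive stabilization is a new separate string followed by the insertion of one
  positive letter; the converse is Reidemeister I applied after rotation.\<close>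

lemma detected_stabilize:
  assumes "1 \<le> b" "w \<in> braid_words b"
  shows "psi_detected (b + 1) (w @ [(b, True)]) \<longleftrightarrow> psi_detected b w"
proof
  have w': "w \<in> braid_words (Suc b)" using assms by (auto simp: braid_words_def)
  show "psi_detected b w" if "psi_detected (b + 1) (w @ [(b, True)])"
    using detected_rotate_append [of w "[(b, True)]" "Suc b"] that assms w'
    by (intro detected_destabilize [of w b]) auto
  show "psi_detected (b + 1) (w @ [(b, True)])" if "psi_detected b w"
  proof -
    have "psi_detected (Suc b) (w @ [(b, True)] @ [])"
      by (rule detected_insert_anywhere) (use detected_add_strand [OF assms(2) that] assms w' in auto)
    then show ?thesis by simp
  qed
qed

lemma detected_markov_move:
  assumes "markov_move D D'"
  shows "case_prod psi_detected D \<longleftrightarrow> case_prod psi_detected D'"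
  using assms
proof cases
  case (same_braid b w w')
  then show ?thesis using detected_same_braid by simp
next
  case (conjugation w b u)
  then show ?thesis using detected_conjugate by simp
next
  case (positive_stabilization b w)
  then show ?thesis using detected_stabilize by simp
qed

text \<open>Each circle of the empty word is a single point at level 0. The functional dual to the
  product of all variables works: no variable occurs twice in it, and there are no
  crossings.\<close>

lemma detected_Nil: "psi_detected b []"
proof (rule psi_detectedI)
  define \<Phi> :: "flat \<Rightarrow> point functional" where "\<Phi> z M = (if M = strand_tops b then 1 else 0)" for z M
  have cnt: "count (strand_tops b) a \<le> 1" for a
  proof -
    have "strand_tops b = mset_set ((\<lambda>p. (p, 0)) ` {1..b})"
      unfolding strand_tops_def by (intro image_mset_mset_set) (auto simp: inj_on_def)
    then show ?thesis by (simp add: count_mset_set')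
  qed
  have eq: "conn b [] a c \<Longrightarrow> a = c" for a c
    using conn_oriented [of b 0 a c] conn_points [of b "[]" a c] by (auto simp: points_def)
  have "compat (conn b []) (\<Phi> [])"
    unfolding compat_def
  proof (intro conjI allI impI)
    show "mark a (\<Phi> []) = mark c (\<Phi> [])" if "conn b [] a c" for a c using eq [OF that] by simp
    have "add_mset a (add_mset a M) \<noteq> strand_tops b" for a M
      using cnt [of a] by (metis count_add_mset add_Suc_right not_less_eq_eq One_nat_def Suc_le_mono le0 numeral_2_eq_2 plus_1_eq_Suc)
    then show "mark a (mark a (\<Phi> [])) = 0" for a
      by (simp add: mark_def \<Phi>_def fun_eq_iff pointwise)
    show "mark a (\<Phi> []) = 0" if "\<not> conn b [] a a" for a
    proof -
      have "a \<notin># strand_tops b" using that strand_tops_points [of b 0] conn_refl [of a b "[]"] by auto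
      then have "add_mset a M \<noteq> strand_tops b" for M by (metis union_single_eq_member)
      then show ?thesis by (simp add: mark_def \<Phi>_def fun_eq_iff pointwise)
    qed
  qed
  then show "compat_family (conn b) [] \<Phi>" by (simp add: compat_family_def)
  show "\<Phi> (replicate (length []) None) (strand_tops b) = 1" by (simp add: \<Phi>_def)
qed simp

text \<open>Without its positive letter each conjugate is a word followed by its inverse and
  cancels; so a product of conjugates arises from the empty word by cancelling pairs and insertions
  of positive letters.\<close>

lemma detected_quasipositive:
  assumes "quasipositive b w"
  shows "psi_detected b w"
proof -
  define pr where "pr cs = concat (map (\<lambda>(u, i). u @ [(i, True)] @ inverse_word u) cs)" for cs :: "(braid_word \<times> nat) list"
  from assms obtain cs where cs: "\<forall>(u, i) \<in> set cs. u \<in> braid_words b \<and> 1 \<le> i \<and> i < b"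
    and w: "same_braid b w (pr cs)"
    by (auto simp: quasipositive_def pr_def)
  from cs have "psi_detected b (pr cs) \<and> pr cs \<in> braid_words b"
  proof (induction cs)
    case Nil
    then show ?case by (simp add: pr_def detected_Nil)
  next
    case (Cons c cs)
    obtain u i where c: "c = (u, i)" by force
    with Cons have u: "u \<in> braid_words b" "1 \<le> i" "i < b" and IH: "psi_detected b (pr cs)" "pr cs \<in> braid_words b"
      by auto
    note i = inverse_word_braid_words [OF u(1)]
    have "psi_detected b (u @ inverse_word u @ pr cs)" using detected_cancel_inverse u IH by simp
    then have "psi_detected b (u @ [(i, True)] @ inverse_word u @ pr cs)"
      using u i IH by (intro detected_insert_anywhere) auto
    then show ?case using u i IH by (simp add: pr_def c)
  qed
  then show ?thesis using detected_same_braid [OF w] by blast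
qed

lemma detected_transverse_link:
  assumes "L \<in> transverse_links" "(b, \<beta>) \<in> L" "(c, w) \<in> L" "psi_detected b \<beta>"
  shows "psi_detected c w" "w \<in> braid_words c"
proof -
  have "((b, \<beta>), (c, w)) \<in> transverse_isotopy"
    using assms(1-3) quotient_eq_iff [OF equiv_transverse_isotopy, of L L "(b, \<beta>)" "(c, w)"]
    by (simp add: transverse_links_def)
  then have "equivclp markov_move (b, \<beta>) (c, w)" and "w \<in> braid_words c"
    by (auto simp: transverse_isotopy_def closed_braids_def)
  then show "w \<in> braid_words c" by blast
  have "case_prod psi_detected (b, \<beta>) \<longleftrightarrow> case_prod psi_detected (c, w)"
    using \<open>equivclp markov_move (b, \<beta>) (c, w)\<close>
    by (induction rule: equivclp_induct) (use detected_markov_move in blast)+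
  with assms(4) show "psi_detected c w" by simp
qed

section \<open>Detection by a cocycle on the Khovanov complex\<close>

definition resolution :: "braid_word \<Rightarrow> nat set \<Rightarrow> flat" where
  "resolution w v = map (\<lambda>t. if t \<in> v then one_res (w ! t) else zero_res (w ! t)) [0..<length w]"

lemma length_resolution [simp]: "length (resolution w v) = length w"
  by (simp add: resolution_def)

lemma nth_resolution: "t < length w \<Longrightarrow> resolution w v ! t = (if t \<in> v then one_res (w ! t) else zero_res (w ! t))"
  by (simp add: resolution_def)

lemma resolution_Cons:
  "resolution (c # w) v = (if 0 \<in> v then one_res c else zero_res c) # resolution w {t. Suc t \<in> v}"
  by (rule nth_equalityI) (auto simp: nth_resolution nth_Cons' less_Suc_eq_0_disj)

lemma vertex_resolution: "vertex w (resolution w v)"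
  by (auto simp: vertex_def list_all2_conv_all_nth nth_resolution)

lemma resolution_None: "t < length w \<Longrightarrow> resolution w v ! t = None \<longleftrightarrow> oriented_at w v t"
  by (auto simp: nth_resolution oriented_at_def zero_res_def one_res_def)

lemma resolution_Some: "t < length w \<Longrightarrow> \<not> oriented_at w v t \<Longrightarrow> resolution w v ! t = Some (fst (w ! t))"
  by (auto simp: nth_resolution oriented_at_def zero_res_def one_res_def)

lemma resolution_oriented: "resolution w (oriented_vertex w) = replicate (length w) None"
  by (rule nth_equalityI) (auto simp: resolution_None oriented_at_def oriented_vertex_def)

text \<open>Unrolling the recursion of \<open>delta\<close> collects one minus sign for every
  1-resolved letter in front of \<open>t\<close>, which is the sign of
  \<open>Kh_differential\<close>.\<close>

lemma delta_resolution:
  assumes "v \<subseteq> {..<length w}"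
  shows "delta E w \<Phi> (resolution w v) M =
    (\<Sum>t \<in> {..<length w} - v. (- 1) ^ card {s \<in> v. s < t} *
      saddle (E (resolution w v)) (E (resolution w (insert t v))) (\<Phi> (resolution w (insert t v))) M)"
  using assms
proof (induction w arbitrary: E \<Phi> v)
  case Nil
  then show ?case by (simp add: pointwise)
next
  case (Cons c w)
  define v' where "v' = {t. Suc t \<in> v}"
  define n where "n = length w"
  have v: "v' \<subseteq> {..<n}" using Cons.prems by (auto simp: v'_def n_def)
  have fin: "finite v" using Cons.prems finite_subset by blast
  let ?r = "if 0 \<in> v then one_res c else zero_res c"
  let ?E = "\<lambda>z. E (?r # z)" and ?P = "\<lambda>z. \<Phi> (?r # z)"
  let ?f = "\<lambda>t. (- 1) ^ card {s \<in> v. s < t} *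
      saddle (E (resolution (c # w) v)) (E (resolution (c # w) (insert t v))) (\<Phi> (resolution (c # w) (insert t v))) M"
  have ins: "resolution (c # w) (insert (Suc t) v) = ?r # resolution w (insert t v')" for t
  proof -
    have "{s. Suc s \<in> insert (Suc t) v} = insert t v'" by (auto simp: v'_def)
    then show ?thesis by (simp add: resolution_Cons)
  qed
  \<comment> \<open>Removing the first letter shifts positions by one; if that letter is 1-resolved,
    it precedes every \<open>Suc t\<close> and accounts for the sign in front of the recursive
    call.\<close>
  have card: "card {s \<in> v. s < Suc t} = (if 0 \<in> v then 1 else 0) + card {s \<in> v'. s < t}" for t
  proof -
    have "{s \<in> v. s < Suc t} = (if 0 \<in> v then {0} else {}) \<union> Suc ` {s \<in> v'. s < t}"
      unfolding v'_def by (auto simp: image_iff less_Suc_eq_0_disj)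
    moreover have "finite {s \<in> v'. s < t}" by simp
    ultimately show ?thesis by (auto simp: card_insert_if card_image)
  qed
  have IH: "delta ?E w ?P (resolution w v') M = (\<Sum>t \<in> {..<n} - v'. (- 1) ^ card {s \<in> v'. s < t} *
      saddle (?E (resolution w v')) (?E (resolution w (insert t v'))) (?P (resolution w (insert t v'))) M)"
    unfolding n_def by (rule Cons.IH) (use v in \<open>simp add: n_def\<close>)
  have "{..<length (c # w)} - v = (if 0 \<in> v then {} else {0}) \<union> Suc ` ({..<n} - v')"
    by (auto simp: v'_def n_def image_iff less_Suc_eq_0_disj)
  then have "(\<Sum>t \<in> {..<length (c # w)} - v. ?f t) = (if 0 \<in> v then 0 else ?f 0) + (\<Sum>t \<in> {..<n} - v'. ?f (Suc t))"
    by (simp add: sum.union_disjoint sum.reindex)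
  also have "(\<Sum>t \<in> {..<n} - v'. ?f (Suc t)) = (if 0 \<in> v then - 1 else 1) * delta ?E w ?P (resolution w v') M"
    unfolding IH card ins sum_distrib_left by (auto simp: resolution_Cons v'_def intro!: sum.cong)
  also have "(if 0 \<in> v then 0 else ?f 0) + (if 0 \<in> v then - 1 else 1) * delta ?E w ?P (resolution w v') M
      = delta E (c # w) \<Phi> (resolution (c # w) v) M"
    by (auto simp: resolution_Cons v'_def pointwise)
  finally show ?case by simp
qed

section \<open>Circles of the diagram as classes of points\<close>

definition flip :: "braid_word \<Rightarrow> arc \<Rightarrow> point" where
  "flip w a = (fst a, length w - snd a)"

definition same_circle :: "nat \<Rightarrow> braid_word \<Rightarrow> nat set \<Rightarrow> arc \<Rightarrow> arc \<Rightarrow> bool" where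
  "same_circle b w v a c \<longleftrightarrow> a \<in> arcs b w \<and> c \<in> arcs b w \<and> equivclp (joined b w v) a c"

lemma per_same_circle: "per (same_circle b w v)"
  unfolding same_circle_def [abs_def] by (rule per_equivclp)

lemma flip_points: "a \<in> arcs b w \<Longrightarrow> flip w a \<in> points b (length w)"
  by (auto simp: arcs_def points_def flip_def)

lemma flip_flip: "a \<in> arcs b w \<Longrightarrow> flip w (flip w a) = a"
  by (auto simp: arcs_def flip_def)

text \<open>Arcs count levels from the first letter and points from the last one;
  \<open>flip\<close> converts between them and turns each clause of \<open>joined\<close> into a
  link, and conversely up to direction.\<close>

lemma same_circle_conn:
  assumes w: "w \<in> braid_words b"
  shows "same_circle b w v a c \<longleftrightarrow>
    a \<in> arcs b w \<and> c \<in> arcs b w \<and> conn b (resolution w v) (flip w a) (flip w c)"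
proof -
  let ?z = "resolution w v"
  have z: "?z \<in> flats b" using vertex_flats [OF vertex_resolution w] .
  have letter: "1 \<le> fst (w ! t) \<and> fst (w ! t) < b" if "t < length w" for t
    using w that unfolding braid_words_def by (metis (mono_tags, lifting) case_prodD mem_Collect_eq nth_mem prod.collapse)
  have rev: "rev ?z ! (length w - Suc t) = ?z ! t" if "t < length w" for t
    using that by (simp add: rev_nth)
  have to: "conn b ?z (flip w x) (flip w y) \<and> x \<in> arcs b w \<and> y \<in> arcs b w" if "joined b w v x y" for x y
    using that
  proof cases
    case (closure p)
    then show ?thesis using conn_sym [OF closing_conn [OF z, of p]] by (auto simp: flip_def arcs_def)
  next
    case (straight t p)
    have "letter_link b (?z ! t) (length w - Suc t) (p, Suc (length w - Suc t)) (p, length w - Suc t)"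
      using straight resolution_None [of t w v] resolution_Some [of t w v] by (cases "oriented_at w v t") (auto simp: letter_link_def)
    then have "strands b ?z (p, Suc (length w - Suc t)) (p, length w - Suc t)"
      unfolding strands_nth using straight rev by (intro exI [of _ "length w - Suc t"]) auto
    then show ?thesis using strands_conn [OF _ z] straight by (auto simp: flip_def arcs_def Suc_diff_Suc)
  next
    case (turn_before t i)
    then have "strands b ?z (i, Suc (length w - Suc t)) (Suc i, Suc (length w - Suc t))"
      unfolding strands_nth using rev resolution_Some letter_link_turn
      by (intro exI [of _ "length w - Suc t"]) auto
    then show ?thesis using strands_conn [OF _ z] turn_before letter [of t] by (auto simp: flip_def arcs_def Suc_diff_Suc)
  next
    case (turn_after t i)
    then have "strands b ?z (i, length w - Suc t) (Suc i, length w - Suc t)"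
      unfolding strands_nth using rev resolution_Some letter_link_turn
      by (intro exI [of _ "length w - Suc t"]) auto
    then show ?thesis using strands_conn [OF _ z] turn_after letter [of t] by (auto simp: flip_def arcs_def)
  qed
  have from_link: "same_circle b w v (flip w x) (flip w y)" if xy: "link b ?z x y" for x y
  proof -
    have pts: "flip w x \<in> arcs b w" "flip w y \<in> arcs b w"
      using link_points [OF xy z] by (auto simp: points_def arcs_def flip_def)
    from xy consider l where "l < length w" "letter_link b (rev ?z ! l) l x y"
      | p where "p \<in> {1..b}" "x = (p, length w)" "y = (p, 0)"
      unfolding link_def strands_nth by auto
    then have "joined b w v (flip w x) (flip w y) \<or> joined b w v (flip w y) (flip w x)"
    proof cases
      case 1
      define t where "t = length w - Suc l"
      have t: "t < length w" "length w - l = t + 1" "length w - Suc l = t" using 1(1) by (auto simp: t_def)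
      have ll: "letter_link b (?z ! t) l x y" using 1 by (simp add: rev_nth t_def)
      show ?thesis
      proof (cases "oriented_at w v t")
        case True
        then have "?z ! t = None" using resolution_None t(1) by blast
        then obtain p where "p \<in> {1..b}" "x = (p, Suc l)" "y = (p, l)" using ll by (auto simp: letter_link_def)
        then show ?thesis using joined.straight [OF t(1), of p b v] True t by (simp add: flip_def)
      next
        case False
        then have s: "?z ! t = Some (fst (w ! t))" using resolution_Some t(1) by blast
        from ll [unfolded s] show ?thesis
        proof (cases rule: letter_link_SomeE)
          case (1 p)
          then show ?thesis using joined.straight [OF t(1), of p b v] t by (simp add: flip_def)
        next
          case 2
          then show ?thesis using joined.turn_before [OF t(1) False refl, of b] t by (simp add: flip_def)
        next
          case 3
          then show ?thesis using joined.turn_after [OF t(1) False refl, of b] t by (simp add: flip_def)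
        qed
      qed
    next
      case 2
      then show ?thesis using joined.closure [of p b w v] by (simp add: flip_def)
    qed
    then have "equivclp (joined b w v) (flip w x) (flip w y)"
      by (auto intro: r_into_equivclp converse_r_into_equivclp)
    with pts show ?thesis by (simp add: same_circle_def)
  qed
  show ?thesis
  proof (intro iffI conjI)
    assume "same_circle b w v a c"
    then have eq: "equivclp (joined b w v) a c" and a: "a \<in> arcs b w" by (auto simp: same_circle_def)
    show "a \<in> arcs b w" "c \<in> arcs b w" using \<open>same_circle b w v a c\<close> by (auto simp: same_circle_def)
    from eq show "conn b ?z (flip w a) (flip w c)"
    proof (induction rule: equivclp_induct)
      case base
      then show ?case using flip_points [OF a] by (simp add: conn_refl)
    next
      case (step x y)
      then have "conn b ?z (flip w x) (flip w y)" using to conn_sym by blast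
      with step(3) show ?case by (rule conn_trans)
    qed
  next
    assume as: "a \<in> arcs b w \<and> c \<in> arcs b w \<and> conn b ?z (flip w a) (flip w c)"
    then have c: "conn b ?z (flip w a) (flip w c)" by blast
    have "same_circle b w v (flip w (flip w a)) (flip w (flip w c))"
    proof (rule conn_map [OF c per_same_circle])
      show "same_circle b w v (flip w u) (flip w u)" if "u \<in> points b (length ?z)" for u
        using that by (auto simp: same_circle_def arcs_def points_def flip_def)
    qed (rule from_link)
    with as show "same_circle b w v a c" using flip_flip [of a b w] flip_flip [of c b w] by simp
  qed
qed

lemma circle_of_same_circle: "a \<in> arcs b w \<Longrightarrow> circle_of b w v a = {c. same_circle b w v a c}"
  by (auto simp: circle_of_def same_circle_def)

lemma models_same_circle:
  assumes "w \<in> braid_words b"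
  shows "models (arcs b w) (flip w) (conn b (resolution w v)) (same_circle b w v)"
  unfolding models_def
proof (intro conjI per_conn per_same_circle ballI allI impI)
  show "same_circle b w v a c \<longleftrightarrow> conn b (resolution w v) (flip w a) (flip w c)"
    if "a \<in> arcs b w" "c \<in> arcs b w" for a c
    using same_circle_conn [OF assms, of v a c] that by blast
  show "\<exists>q \<in> arcs b w. same_circle b w v a q" if "same_circle b w v a a" for a
    using that by (intro bexI [of _ a]) (auto simp: same_circle_def)
qed

lemma edge_pullback:
  assumes e: "edge E E' (f x) (f y)" and xy: "x \<in> Q" "y \<in> Q" and p: "per R" "per R'"
    and R: "\<And>a c. R a c \<longleftrightarrow> a \<in> Q \<and> c \<in> Q \<and> E (f a) (f c)"
    and R': "\<And>a c. R' a c \<longleftrightarrow> a \<in> Q \<and> c \<in> Q \<and> E' (f a) (f c)"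
  shows "edge R R' x y"
  using e
proof (cases rule: edge_cases)
  case merge
  then have "merges R R' x y"
    using xy p(1) unfolding merges_def join_def by (auto simp: R R' fun_eq_iff)
  then show ?thesis by (simp add: edge_def)
next
  case split
  then have "merges R' R x y"
    using xy p(2) unfolding merges_def join_def by (auto simp: R R' fun_eq_iff)
  then show ?thesis by (simp add: edge_def)
qed

lemma letter_bounds: "w \<in> braid_words b \<Longrightarrow> t < length w \<Longrightarrow> 1 \<le> fst (w ! t) \<and> fst (w ! t) < b"
  unfolding braid_words_def by (metis (mono_tags, lifting) case_prodD mem_Collect_eq nth_mem prod.collapse)

lemma edge_same_circle:
  assumes w: "w \<in> braid_words b" and t: "t < length w" "t \<notin> v"
  defines "i \<equiv> fst (w ! t)"
  shows "edge (conn b (resolution w v)) (conn b (resolution w (insert t v))) (flip w (i, t)) (flip w (i + 1, t + 1))"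
    and "edge (same_circle b w v) (same_circle b w (insert t v)) (i, t) (i + 1, t + 1)"
proof -
  define y where "y = take t (resolution w v)"
  define z where "z = drop (Suc t) (resolution w v)"
  have "resolution w v ! t = zero_res (w ! t)" using t by (simp add: nth_resolution)
  then have v: "resolution w v = y @ zero_res (w ! t) # z"
    using id_take_nth_drop [of t "resolution w v"] t by (simp add: y_def z_def)
  have "resolution w (insert t v) = (resolution w v)[t := one_res (w ! t)]"
    using t by (intro nth_equalityI) (auto simp: nth_resolution nth_list_update)
  then have v': "resolution w (insert t v) = y @ one_res (w ! t) # z"
    using t by (simp add: y_def z_def upd_conv_take_nth_drop)
  have ib: "1 \<le> i" "i < b" using letter_bounds [OF w t(1)] by (auto simp: i_def)
  have fl: "y @ z \<in> flats b"
    using vertex_flats [OF vertex_resolution w, of v] unfolding v by simp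
  have len: "length z = length w - Suc t" by (simp add: z_def)
  show 1: "edge (conn b (resolution w v)) (conn b (resolution w (insert t v))) (flip w (i, t)) (flip w (i + 1, t + 1))"
    using edge_conn_res [OF fl, of "w ! t"] ib t unfolding v v' by (simp add: flip_def i_def len Suc_diff_Suc)
  show "edge (same_circle b w v) (same_circle b w (insert t v)) (i, t) (i + 1, t + 1)"
    by (rule edge_pullback [OF 1 _ _ per_same_circle per_same_circle same_circle_conn [OF w] same_circle_conn [OF w]])
      (use ib t in \<open>auto simp: arcs_def\<close>)
qed

section \<open>Circles as sets and labellings as monomials\<close>

definition blocks :: "('a \<Rightarrow> 'a \<Rightarrow> bool) \<Rightarrow> 'a set set" where
  "blocks R = {{c. R a c} | a. R a a}"

lemma circles_blocks: "circles b w v = blocks (same_circle b w v)"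
proof -
  have "same_circle b w v a a \<longleftrightarrow> a \<in> arcs b w" for a by (auto simp: same_circle_def)
  then show ?thesis
    unfolding circles_def blocks_def by (auto simp: image_iff circle_of_same_circle)
qed

lemma finite_circles: "finite (circles b w v)"
  by (simp add: circles_def arcs_def)

lemma class_eq:
  assumes "per R" "C \<in> blocks R" "x \<in> C"
  shows "C = {c. R x c}"
proof -
  from assms(2) obtain a where a: "C = {c. R a c}" by (auto simp: blocks_def)
  with assms(3) have "R a x" by simp
  then show ?thesis
    unfolding a using per_sym [OF assms(1)] per_trans [OF assms(1)] by blast
qed

text \<open>The effect of a merge on circles as sets. The claims of non-membership ensure that
  updating a labelling at the new circle does not disturb the labels of the surviving ones; read
  backwards, this serves for splits.\<close>

lemma blocks_merge:
  assumes m: "merges R R' x y"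
  shows "{c. R x c} \<noteq> {c. R y c}" "{c. R' x c} = {c. R x c} \<union> {c. R y c}" "{c. R' y c} = {c. R' x c}"
    "{c. R x c} \<in> blocks R" "{c. R y c} \<in> blocks R"
    "{c. R' x c} \<notin> blocks R" "{c. R x c} \<notin> blocks R'" "{c. R y c} \<notin> blocks R'"
    "blocks R' = insert {c. R' x c} (blocks R - {{c. R x c}, {c. R y c}})"
proof -
  have p: "per R" "per R'" using merges_per [OF m] by auto
  have R: "R x x" "R y y" "\<not> R x y" "\<not> R y x" and R': "R' = join R x y"
    using m per_sym [OF p(1), of y x] by (auto simp: merges_def)
  have xy: "R' x y" "R' y x" using merges_new [OF m] per_sym [OF p(2)] by auto
  show "{c. R x c} \<noteq> {c. R y c}" using R by auto
  show u: "{c. R' x c} = {c. R x c} \<union> {c. R y c}" using R by (auto simp: R' join_def)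
  show "{c. R' y c} = {c. R' x c}" using xy per_trans [OF p(2)] by blast
  show "{c. R x c} \<in> blocks R" "{c. R y c} \<in> blocks R" using R unfolding blocks_def by blast+
  show "{c. R' x c} \<notin> blocks R"
  proof
    assume "{c. R' x c} \<in> blocks R"
    then have "{c. R' x c} = {c. R x c}" by (rule class_eq [OF p(1)]) (simp add: u R)
    then show False using u R by auto
  qed
  show "{c. R x c} \<notin> blocks R'"
    using class_eq [OF p(2), of "{c. R x c}" x] u R by auto
  show "{c. R y c} \<notin> blocks R'"
    using class_eq [OF p(2), of "{c. R y c}" y] R xy merges_mono [OF m] by auto
  have other: "{c. R' a c} = {c. R a c}" if "\<not> R a x" "\<not> R a y" for a
    using that by (auto simp: R' join_def)
  have cls: "{c. R a c} = {c. R b c}" if "R a b" for a b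
    using that per_sym [OF p(1)] per_trans [OF p(1)] by blast
  have cls': "{c. R' a c} = {c. R' b c}" if "R' a b" for a b
    using that per_sym [OF p(2)] per_trans [OF p(2)] by blast
  show "blocks R' = insert {c. R' x c} (blocks R - {{c. R x c}, {c. R y c}})"
  proof (intro equalityI subsetI)
    fix C assume "C \<in> blocks R'"
    then obtain a where a: "C = {c. R' a c}" "R a a" using merges_dom [OF m] by (auto simp: blocks_def)
    show "C \<in> insert {c. R' x c} (blocks R - {{c. R x c}, {c. R y c}})"
    proof (cases "R a x \<or> R a y")
      case True
      then have "R' a x" using merges_mono [OF m] xy per_trans [OF p(2)] by blast
      then show ?thesis using cls' a by blast
    next
      case False
      then have "C = {c. R a c}" using a other by blast
      moreover from this have "C \<noteq> {c. R x c}" "C \<noteq> {c. R y c}" using False R by auto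
      ultimately show ?thesis using a(2) unfolding blocks_def by blast
    qed
  next
    fix C assume "C \<in> insert {c. R' x c} (blocks R - {{c. R x c}, {c. R y c}})"
    then show "C \<in> blocks R'"
    proof
      assume "C = {c. R' x c}"
      moreover have "R' x x" using R merges_mono [OF m] by blast
      ultimately show ?thesis unfolding blocks_def by blast
    next
      assume C: "C \<in> blocks R - {{c. R x c}, {c. R y c}}"
      then obtain a where a: "C = {c. R a c}" "R a a" by (auto simp: blocks_def)
      then have "\<not> R a x" "\<not> R a y" using C cls by blast+
      then have "C = {c. R' a c}" "R' a a" using a other merges_mono [OF m] by auto
      then show ?thesis unfolding blocks_def by blast
    qed
  qed
qed

text \<open>An arbitrary point of a circle, standing for its variable; compatible functionals do not
  depend on the choice.\<close>

definition repr :: "'a set \<Rightarrow> 'a" where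
  "repr C = (SOME a. a \<in> C)"

lemma repr_in: "x \<in> C \<Longrightarrow> repr C \<in> C"
  unfolding repr_def by (rule someI)

text \<open>The monomial \<open>\<Prod> X\<^bsub>C\<^esub>\<close> over the circles labelled \<open>u_minus\<close>.\<close>

definition monomial :: "'a set set \<Rightarrow> ('a set \<Rightarrow> gen) \<Rightarrow> 'a multiset" where
  "monomial \<C> f = image_mset repr (mset_set {C \<in> \<C>. f C = u_minus})"

lemma monomial_insert:
  assumes "finite \<C>" "C \<notin> \<C>"
  shows "monomial (insert C \<C>) f = (if f C = u_minus then {#repr C#} else {#}) + monomial \<C> f"
proof -
  have "{D \<in> insert C \<C>. f D = u_minus} = (if f C = u_minus then insert C {D \<in> \<C>. f D = u_minus} else {D \<in> \<C>. f D = u_minus})"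
    by auto
  then show ?thesis using assms by (simp add: monomial_def)
qed

lemma monomial_cong: "(\<And>C. C \<in> \<C> \<Longrightarrow> f C = g C) \<Longrightarrow> monomial \<C> f = monomial \<C> g"
  unfolding monomial_def by (metis (mono_tags, lifting) Collect_cong)

text \<open>The linear extension of \<open>h\<close>. As \<open>frag_extend\<close> takes values in
  free abelian groups, the integers are realized as the free group on one generator and its
  coefficient is read off.\<close>

definition int_of_frag :: "('a \<Rightarrow> int) \<Rightarrow> ('a \<Rightarrow>\<^sub>0 int) \<Rightarrow> int" where
  "int_of_frag h x = Poly_Mapping.lookup (frag_extend (\<lambda>s. frag_cmul (h s) (frag_of ())) x) ()"

lemma int_of_frag_of [simp]: "int_of_frag h (frag_of s) = h s"
  by (simp add: int_of_frag_def)

lemma int_of_frag_zero [simp]: "int_of_frag h 0 = 0"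
  by (simp add: int_of_frag_def)

lemma int_of_frag_add: "int_of_frag h (x + y) = int_of_frag h x + int_of_frag h y"
  by (simp add: int_of_frag_def frag_extend_add lookup_add)

lemma int_of_frag_diff: "int_of_frag h (x - y) = int_of_frag h x - int_of_frag h y"
  by (simp add: int_of_frag_def frag_extend_diff lookup_minus)

lemma int_of_frag_cmul: "int_of_frag h (frag_cmul k x) = k * int_of_frag h x"
  by (simp add: int_of_frag_def frag_extend_cmul)

lemma int_of_frag_sum: "finite I \<Longrightarrow> int_of_frag h (\<Sum>i\<in>I. x i) = (\<Sum>i\<in>I. int_of_frag h (x i))"
  by (induction I rule: finite_induct) (simp_all add: int_of_frag_add)

context
  fixes b :: nat and w :: braid_word and V :: "nat set \<Rightarrow> arc functional"
  assumes w: "w \<in> braid_words b" and V: "\<And>v. compat (same_circle b w v) (V v)"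
begin

abbreviation "R v \<equiv> same_circle b w v"

definition state_value :: "state \<Rightarrow> int" where
  "state_value = (\<lambda>(v, f). V v (monomial (circles b w v) f))"

text \<open>Under a merge both representatives fall on one circle, so a pair of labels
  \<open>u_minus\<close> becomes a square, in accordance with \<open>mult_gen\<close>. Under a split
  the variable of the old circle times the sum of the two new ones leaves only the mixed product, in
  accordance with \<open>comult_gen\<close>.\<close>

lemma int_of_edge_map:
  assumes t: "t < length w" "t \<notin> v"
  shows "int_of_frag state_value (edge_map b w t (v, f))
    = saddle (R v) (R (insert t v)) (V (insert t v)) (monomial (circles b w v) f)"
proof -
  define i where "i = fst (w ! t)"
  define v' where "v' = insert t v"
  define x where "x = (i, t)"
  define y where "y = (i + 1, t + 1)"
  define g where "g = restrict f (circles b w v')"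
  define A where "A = {c. R v x c}"
  define B where "B = {c. R v y c}"
  define A' where "A' = {c. R v' x c}"
  define B' where "B' = {c. R v' y c}"
  have ib: "1 \<le> i" "i < b" using letter_bounds [OF w t(1)] by (auto simp: i_def)
  have arcs: "x \<in> arcs b w" "y \<in> arcs b w" using ib t by (auto simp: x_def y_def arcs_def)
  have e: "edge (R v) (R v') x y"
    using edge_same_circle(2) [OF w t] by (simp add: x_def y_def i_def v'_def)
  have c: "compat (R v') (V v')" by (rule V)
  have circ: "circle_of b w v x = A" "circle_of b w v y = B" "circle_of b w v' x = A'" "circle_of b w v' y = B'"
    using arcs by (simp_all add: circle_of_same_circle A_def B_def A'_def B'_def)
  have em: "edge_map b w t (v, f) = (if A \<noteq> B
        then frag_extend (\<lambda>s. frag_of (v', g(A' := s))) (mult_gen (f A, f B))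
        else frag_extend (\<lambda>(s, s'). frag_of (v', g(A' := s, B' := s'))) (comult_gen (f A)))"
    unfolding edge_map_def Let_def split_conv
    by (simp only: flip: i_def v'_def) (simp only: circ g_def flip: x_def y_def)
  have g: "g C = f C" if "C \<in> circles b w v'" for C using that by (simp add: g_def)
  from e show ?thesis
  proof (cases rule: edge_cases)
    case merge
    note m = blocks_merge [OF merge(3), folded A_def B_def A'_def B'_def circles_blocks]
    define \<C> where "\<C> = circles b w v - {A, B}"
    have fin: "finite \<C>" "finite (insert B \<C>)" by (simp_all add: \<C>_def finite_circles)
    have cv: "circles b w v = insert A (insert B \<C>)" "A \<notin> insert B \<C>" "B \<notin> \<C>"
      using m(1,4,5) by (auto simp: \<C>_def)
    have cv': "circles b w v' = insert A' \<C>" "A' \<notin> \<C>" using m(6,9) by (auto simp: \<C>_def)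
    define N where "N = monomial \<C> f"
    have mon: "monomial (circles b w v) f
        = (if f A = u_minus then {#repr A#} else {#}) + ((if f B = u_minus then {#repr B#} else {#}) + N)"
      unfolding cv(1) monomial_insert [OF fin(2) cv(2)] monomial_insert [OF fin(1) cv(3)] N_def ..
    have mon': "state_value (v', g(A' := s)) = V v' ((if s = u_minus then {#repr A'#} else {#}) + N)" for s
    proof -
      have "monomial \<C> (g(A' := s)) = N"
        unfolding N_def using cv' g by (intro monomial_cong) auto
      then show ?thesis by (simp add: state_value_def cv'(1) monomial_insert [OF fin(1) cv'(2)])
    qed
    have rep: "R v' (repr A) (repr B)" "R v' (repr A) (repr A')" "R v' (repr B) (repr A')"
    proof -
      have "x \<in> A" "y \<in> B" "x \<in> A'" using arcs by (auto simp: A_def B_def A'_def same_circle_def)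
      then have "repr A \<in> A" "repr B \<in> B" "repr A' \<in> A'" using repr_in by metis+
      then have "repr A \<in> A'" "repr B \<in> A'" "repr A' \<in> A'" by (simp_all add: m(2))
      then have r: "R v' x (repr A)" "R v' x (repr B)" "R v' x (repr A')" by (simp_all add: A'_def)
      note tr = per_trans [OF per_same_circle per_sym [OF per_same_circle]]
      show "R v' (repr A) (repr B)" "R v' (repr A) (repr A')" "R v' (repr B) (repr A')"
        using tr [OF r(1) r(2)] tr [OF r(1) r(3)] tr [OF r(2) r(3)] .
    qed
    have "saddle (R v) (R v') (V v') = V v'" using saddle_merge [OF e merge(2,1)] .
    moreover have "V v' (add_mset (repr A) (add_mset (repr B) N)) = 0"
      using compat_square [OF c per_sym [OF per_same_circle rep(1)]]
      by (simp add: pointwise flip: mark_apply)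
    moreover have "V v' (add_mset (repr A) N) = V v' (add_mset (repr A') N)"
      "V v' (add_mset (repr B) N) = V v' (add_mset (repr A') N)"
      using compat_eq [OF c rep(2)] compat_eq [OF c rep(3)] by (simp_all flip: mark_apply)
    ultimately show ?thesis
      using m(1) mon' unfolding em v'_def [symmetric] mon
      by (cases "f A"; cases "f B") (simp_all add: add_mset_commute [of "repr B" "repr A"])
  next
    case split
    note m = blocks_merge [OF split(3), folded A_def B_def A'_def B'_def circles_blocks]
    define \<C> where "\<C> = circles b w v' - {A', B'}"
    have fin: "finite \<C>" "finite (insert B' \<C>)" by (simp_all add: \<C>_def finite_circles)
    have cv': "circles b w v' = insert A' (insert B' \<C>)" "A' \<notin> insert B' \<C>" "B' \<notin> \<C>"
      using m(1,4,5) by (auto simp: \<C>_def)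
    have cv: "circles b w v = insert A \<C>" "A \<notin> \<C>" using m(6,9) by (auto simp: \<C>_def)
    define N where "N = monomial \<C> f"
    have mon: "monomial (circles b w v) f = (if f A = u_minus then {#repr A#} else {#}) + N"
      unfolding cv(1) monomial_insert [OF fin(1) cv(2)] N_def ..
    have mon': "state_value (v', g(A' := s, B' := s'))
        = V v' ((if s = u_minus then {#repr A'#} else {#}) + ((if s' = u_minus then {#repr B'#} else {#}) + N))" for s s'
    proof -
      have "monomial \<C> (g(A' := s, B' := s')) = N"
        unfolding N_def using cv' g by (intro monomial_cong) auto
      then show ?thesis
        using m(1) by (simp add: state_value_def cv'(1) monomial_insert [OF fin(2) cv'(2)] monomial_insert [OF fin(1) cv'(3)])
    qed
    have in': "x \<in> A'" "y \<in> B'" "x \<in> A" using arcs by (auto simp: A_def B'_def A'_def same_circle_def)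
    have x: "R v' x (repr A')" and y: "R v' y (repr B')"
      using repr_in [OF in'(1)] repr_in [OF in'(2)] by (auto simp: A'_def B'_def)
    have "saddle (R v) (R v') (V v') = mark x (V v') + mark y (V v')"
      using saddle_split [OF e split(1,2) c] .
    also have "\<dots> = mark (repr A') (V v') + mark (repr B') (V v')"
      using compat_eq [OF c x] compat_eq [OF c y] by simp
    finally have s: "saddle (R v) (R v') (V v') M = V v' (add_mset (repr A') M) + V v' (add_mset (repr B') M)" for M
      by (simp add: pointwise mark_apply)
    \<comment> \<open>The representative of the old circle lies on one of the new ones. The term of
      that circle is then a square, and the other term is the mixed product.\<close>
    have "repr A \<in> A' \<union> B'" using repr_in [OF in'(3)] m(2) by simp
    then have "R v' x (repr A) \<or> R v' y (repr A)" unfolding A'_def B'_def by simp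
    then have "R v' (repr A') (repr A) \<or> R v' (repr B') (repr A)"
      using per_trans [OF per_same_circle per_sym [OF per_same_circle x]]
        per_trans [OF per_same_circle per_sym [OF per_same_circle y]] by blast
    then have "V v' (add_mset (repr A') (add_mset (repr A) N)) + V v' (add_mset (repr B') (add_mset (repr A) N))
        = V v' (add_mset (repr A') (add_mset (repr B') N))"
    proof
      assume r: "R v' (repr A') (repr A)"
      have "V v' (add_mset (repr A') (add_mset (repr A) N)) = 0"
        using compat_square [OF c per_sym [OF per_same_circle r]] by (simp add: pointwise flip: mark_apply)
      moreover have "V v' (add_mset (repr A) (add_mset (repr B') N)) = V v' (add_mset (repr A') (add_mset (repr B') N))"
        using compat_eq [OF c r] by (simp flip: mark_apply)
      ultimately show ?thesis by (simp add: add_mset_commute)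
    next
      assume r: "R v' (repr B') (repr A)"
      have "V v' (add_mset (repr B') (add_mset (repr A) N)) = 0"
        using compat_square [OF c per_sym [OF per_same_circle r]] by (simp add: pointwise flip: mark_apply)
      moreover have "V v' (add_mset (repr A) (add_mset (repr A') N)) = V v' (add_mset (repr B') (add_mset (repr A') N))"
        using compat_eq [OF c r] by (simp flip: mark_apply)
      ultimately show ?thesis by (simp add: add_mset_commute)
    qed
    moreover have "A = B" using m(3) by simp
    ultimately show ?thesis
      using mon' unfolding em v'_def [symmetric] mon
      by (cases "f A") (simp_all add: int_of_frag_add frag_extend_add s add_mset_commute [of "repr B'" "repr A'"])
  qed
qed

lemma int_of_boundary:
  assumes cocycle: "\<And>v M. v \<subseteq> {..<length w} \<Longrightarrow> (\<Sum>t \<in> {..<length w} - v. (- 1) ^ card {s \<in> v. s < t} *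
      saddle (R v) (R (insert t v)) (V (insert t v)) M) = 0"
    and x: "x \<in> carrier (CKh b w)"
  shows "int_of_frag state_value (Kh_differential b w x) = 0"
proof -
  from x have "Poly_Mapping.keys x \<subseteq> states b w" by (simp add: CKh_def)
  then show ?thesis
  proof (rule free_Abelian_group_induct)
    show "int_of_frag state_value (Kh_differential b w 0) = 0"
      by (simp add: Kh_differential_def)
    show "int_of_frag state_value (Kh_differential b w (x - y)) = 0"
      if "int_of_frag state_value (Kh_differential b w x) = 0"
        "int_of_frag state_value (Kh_differential b w y) = 0" for x y
      using that by (simp add: Kh_differential_def frag_extend_diff int_of_frag_diff)
  next
    fix a assume "a \<in> states b w"
    then obtain v f where a: "a = (v, f)" "v \<subseteq> {..<length w}" by (cases a) (auto simp: states_def)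
    have "int_of_frag state_value (Kh_differential b w (frag_of a))
       = (\<Sum>t \<in> {..<length w} - v. (- 1) ^ card {s \<in> v. s < t} *
           saddle (R v) (R (insert t v)) (V (insert t v)) (monomial (circles b w v) f))"
      by (simp add: Kh_differential_def a(1) int_of_frag_sum int_of_frag_cmul int_of_edge_map)
    then show "int_of_frag state_value (Kh_differential b w (frag_of a)) = 0" using cocycle [OF a(2)] by simp
  qed
qed

end

section \<open>The cycle psi and the value of a cocycle on it\<close>

lemma psi_chain_cycle:
  assumes w: "w \<in> braid_words b"
  shows "psi_chain b w \<in> Kh_cycles b w"
proof -
  define v where "v = oriented_vertex w"
  define f where "f = (\<lambda>C \<in> circles b w v. u_minus)"
  have v: "v \<subseteq> {..<length w}" by (auto simp: v_def oriented_vertex_def)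
  have "(v, f) \<in> states b w" using v by (auto simp: states_def f_def)
  moreover have "edge_map b w t (v, f) = 0" if t: "t < length w" "t \<notin> v" for t
  proof -
    define i where "i = fst (w ! t)"
    have ib: "1 \<le> i" "i < b" using letter_bounds [OF w t(1)] by (auto simp: i_def)
    then have arcs: "(i, t) \<in> arcs b w" "(i + 1, t + 1) \<in> arcs b w" using t by (auto simp: arcs_def)
    \<comment> \<open>At the oriented vertex distinct strings lie on distinct circles, so every edge
      leaving it merges two circles labelled \<open>u_minus\<close>, and their product is 0.\<close>
    have "\<not> same_circle b w v (i, t) (i + 1, t + 1)"
      using conn_oriented [of b "length w" "flip w (i, t)" "flip w (i + 1, t + 1)"]
      unfolding same_circle_conn [OF w] v_def resolution_oriented by (auto simp: flip_def)
    moreover have "same_circle b w v (i + 1, t + 1) (i + 1, t + 1)" using arcs by (simp add: same_circle_def)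
    ultimately have ne: "circle_of b w v (i, t) \<noteq> circle_of b w v (i + 1, t + 1)"
      unfolding circle_of_same_circle [OF arcs(1)] circle_of_same_circle [OF arcs(2)] by blast
    have "f (circle_of b w v (i, t)) = u_minus" "f (circle_of b w v (i + 1, t + 1)) = u_minus"
      using arcs by (auto simp: f_def circles_def)
    then show ?thesis using ne by (simp add: edge_map_def Let_def i_def)
  qed
  then have "Kh_differential b w (frag_of (v, f)) = 0"
    by (simp add: Kh_differential_def)
  ultimately show ?thesis
    by (simp add: Kh_cycles_def kernel_def CKh_def psi_chain_def v_def f_def)
qed

text \<open>The representatives are arbitrary points of the vertical circles, one on each string.
  Compatibility permits sliding them to level 0, where \<open>strand_tops\<close> has its
  points.\<close>

lemma oriented_monomial:
  assumes w: "w \<in> braid_words b" and c: "compat (conn b (replicate (length w) None)) \<Phi>"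
  defines "v \<equiv> oriented_vertex w"
  defines "M \<equiv> monomial (circles b w v) (\<lambda>C \<in> circles b w v. u_minus)"
  shows "set_mset M \<subseteq> arcs b w" "\<Phi> (image_mset (flip w) M) = \<Phi> (strand_tops b)"
proof -
  let ?z = "replicate (length w) None"
  define K where "K p = {c. same_circle b w v (p, 0) c}" for p
  have sc: "same_circle b w v a d \<longleftrightarrow> a \<in> arcs b w \<and> d \<in> arcs b w \<and> fst a = fst d" for a d
  proof -
    have "conn b ?z (flip w a) (flip w d) \<longleftrightarrow> fst a = fst d" if "a \<in> arcs b w" "d \<in> arcs b w"
    proof
      show "fst a = fst d" if "conn b ?z (flip w a) (flip w d)"
        using conn_oriented [OF that] by (simp add: flip_def)
      assume "fst a = fst d"
      moreover have "conn b ?z (flip w u) (fst u, 0)" if "u \<in> arcs b w" for u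
        using oriented_conn [of "fst u" b "length w - snd u" "length w"] that by (auto simp: flip_def arcs_def)
      ultimately show "conn b ?z (flip w a) (flip w d)"
        using conn_trans [OF _ conn_sym] that by metis
    qed
    then show ?thesis unfolding same_circle_conn [OF w] v_def resolution_oriented by blast
  qed
  have K: "K p = {p} \<times> {0..length w}" if "p \<in> {1..b}" for p
    using that by (auto simp: K_def sc arcs_def)
  have circ: "circles b w v = K ` {1..b}"
  proof -
    have "circle_of b w v a = K (fst a)" if "a \<in> arcs b w" for a
      using that by (auto simp: circle_of_same_circle K_def sc arcs_def)
    then have "circles b w v = (\<lambda>a. K (fst a)) ` arcs b w" by (auto simp: circles_def)
    also have "\<dots> = K ` {1..b}" by (force simp: arcs_def)
    finally show ?thesis .
  qed
  have inj: "inj_on K {1..b}" by (rule inj_onI) (auto simp: K times_eq_iff)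
  have all: "{C \<in> circles b w v. (\<lambda>C \<in> circles b w v. u_minus) C = u_minus} = circles b w v" by auto
  have M: "M = image_mset (\<lambda>p. repr (K p)) (mset_set {1..b})"
    unfolding M_def monomial_def all unfolding circ image_mset_mset_set [OF inj, symmetric]
    by (simp only: image_mset.compositionality comp_def)
  have r: "repr (K p) \<in> {p} \<times> {0..length w}" if "p \<in> {1..b}" for p
    using repr_in [of "(p, 0)" "K p"] K [OF that] by auto
  then show "set_mset M \<subseteq> arcs b w" unfolding M arcs_def by fastforce
  have "\<Phi> (image_mset (flip w) M) = \<Phi> (image_mset (\<lambda>a. (fst a, 0)) (image_mset (flip w) M))"
  proof (rule compat_image_mset [OF c])
    fix a assume "a \<in># image_mset (flip w) M"
    then obtain p where p: "p \<in> {1..b}" "a = flip w (repr (K p))" by (auto simp: M)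
    then show "conn b ?z a (fst a, 0)"
      using oriented_conn [of p b "snd a" "length w"] r [OF p(1)] by (auto simp: flip_def)
  qed
  also have "image_mset (\<lambda>a. (fst a, 0)) (image_mset (flip w) M) = strand_tops b"
  proof -
    have "fst (repr (K p)) = p" if "p \<in> {1..b}" for p using r [OF that] by auto
    then show ?thesis
      unfolding M strand_tops_def image_mset.compositionality
      by (intro image_mset_cong) (simp add: flip_def)
  qed
  finally show "\<Phi> (image_mset (flip w) M) = \<Phi> (strand_tops b)" .
qed

text \<open>The detecting cocycle is transferred from points to arcs along \<open>flip\<close>,
  evaluated on the monomials of the states and extended linearly.\<close>

lemma detecting_homomorphism:
  assumes w: "w \<in> braid_words b" and "psi_detected b w"
  obtains h :: "state \<Rightarrow> int"
    where "\<And>x. x \<in> carrier (CKh b w) \<Longrightarrow> int_of_frag h (Kh_differential b w x) = 0"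
      "int_of_frag h (psi_chain b w) = 1"
proof -
  from assms(2) obtain \<Phi> where \<Phi>: "compat_family (conn b) w \<Phi>" "\<And>z. vertex w z \<Longrightarrow> delta (conn b) w \<Phi> z = 0"
    "\<Phi> (replicate (length w) None) (strand_tops b) = 1"
    by (elim psi_detectedE) blast
  define V where "V v = transfer (same_circle b w v) (arcs b w) (flip w) (\<Phi> (resolution w v))" for v
  note m = models_same_circle [OF w]
  have c: "compat (conn b (resolution w v)) (\<Phi> (resolution w v))" for v
    using \<Phi>(1) vertex_resolution by (simp add: compat_family_def)
  have V: "compat (same_circle b w v) (V v)" for v
    unfolding V_def by (rule compat_transfer [OF m c])
  have "(\<Sum>t \<in> {..<length w} - v. (- 1) ^ card {s \<in> v. s < t} *
      saddle (same_circle b w v) (same_circle b w (insert t v)) (V (insert t v)) M) = 0"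
    if v: "v \<subseteq> {..<length w}" for v M
  proof -
    have "saddle (same_circle b w v) (same_circle b w (insert t v)) (V (insert t v))
        = transfer (same_circle b w v) (arcs b w) (flip w)
            (saddle (conn b (resolution w v)) (conn b (resolution w (insert t v))) (\<Phi> (resolution w (insert t v))))"
      if "t \<in> {..<length w} - v" for t
      unfolding V_def
      by (rule saddle_transfer [OF edge_same_circle(1) edge_same_circle(2) m m c]) (use w that in auto)
    then have "(\<Sum>t \<in> {..<length w} - v. (- 1) ^ card {s \<in> v. s < t} *
        saddle (same_circle b w v) (same_circle b w (insert t v)) (V (insert t v)) M)
      = (\<Sum>t \<in> {..<length w} - v. (- 1) ^ card {s \<in> v. s < t} *
          transfer (same_circle b w v) (arcs b w) (flip w)
            (saddle (conn b (resolution w v)) (conn b (resolution w (insert t v))) (\<Phi> (resolution w (insert t v)))) M)"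
      by (intro sum.cong) simp_all
    \<comment> \<open>For a fixed \<open>M\<close> a transfer either evaluates its argument at one
      fixed monomial or is zero, so it commutes with the signed sum.\<close>
    also have "\<dots> = transfer (same_circle b w v) (arcs b w) (flip w) (delta (conn b) w \<Phi> (resolution w v)) M"
      unfolding transfer_def delta_resolution [OF v]
      by (cases "\<forall>a \<in># M. same_circle b w v a a") (simp, simp only: if_False mult_zero_right sum.neutral_const)
    also have "\<dots> = 0" using \<Phi>(2) [OF vertex_resolution] by (simp add: pointwise)
    finally show ?thesis .
  qed
  note b = int_of_boundary [of w b V, OF w V this]
  have "int_of_frag (state_value b w V) (psi_chain b w) = 1"
    using oriented_monomial [OF w, of "\<Phi> (replicate (length w) None)"] c [of "oriented_vertex w"] \<Phi>(3)
      agrees_transfer [OF m c, of "oriented_vertex w"]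
    unfolding resolution_oriented psi_chain_def
    by (simp add: state_value_def [OF w V] agrees_def V_def resolution_oriented)
  with b show thesis using that by blast
qed

section \<open>Homology classes, divisibility and torsion\<close>

lemma Kh_differential_diff: "Kh_differential b w (x - y) = Kh_differential b w x - Kh_differential b w y"
  by (simp add: Kh_differential_def frag_extend_diff)

lemma subgroup_frag:
  assumes "0 \<in> H" "\<And>x y. x \<in> H \<Longrightarrow> y \<in> H \<Longrightarrow> x - y \<in> H"
  shows "subgroup H (free_Abelian_group UNIV)"
proof -
  have m: "- y \<in> H" if "y \<in> H" for y using assms(2) [OF assms(1) that] by simp
  show ?thesis
  proof (rule group.subgroupI [OF group_free_Abelian_group])
    show "inv\<^bsub>free_Abelian_group UNIV\<^esub> x \<in> H" if "x \<in> H" for x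
      using m [OF that] by simp
    show "x \<otimes>\<^bsub>free_Abelian_group UNIV\<^esub> y \<in> H" if "x \<in> H" "y \<in> H" for x y
      using assms(2) [OF that(1) m [OF that(2)]] by simp
  qed (use assms(1) in auto)
qed

text \<open>Cosets and their sums do not mention the carrier of \<open>CKh\<close>, so homology can be computed inside
  the quotient of the free group on all states by the boundaries.\<close>

theorem corollary1:
  fixes L :: "closed_braid set" and b c :: nat and \<beta> w :: braid_word
  assumes "L \<in> transverse_links"
    and "(b, \<beta>) \<in> L" and "quasipositive b \<beta>"
    and "(c, w) \<in> L"
  shows "psi c w \<noteq> \<one>\<^bsub>Kh c w\<^esub> \<and> primitive_element (Kh c w) (psi c w) \<and> non_torsion (Kh c w) (psi c w)"
proof -
  note det = detected_transverse_link [OF assms(1,2,4) detected_quasipositive [OF assms(3)]]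
  obtain h where h: "\<And>x. x \<in> carrier (CKh c w) \<Longrightarrow> int_of_frag h (Kh_differential c w x) = 0"
    and h1: "int_of_frag h (psi_chain c w) = 1"
    by (rule detecting_homomorphism [OF det(2,1)]) blast
  define F :: "(state \<Rightarrow>\<^sub>0 int) monoid" where "F = free_Abelian_group UNIV"
  define B where "B = Kh_boundaries c w"
  define Z where "Z = Kh_cycles c w"
  define p where "p = psi_chain c w"
  define coset where "coset x = B #>\<^bsub>F\<^esub> x" for x
  have d0: "Kh_differential c w 0 = 0" by (simp add: Kh_differential_def)
  have Z: "Z = {x. Poly_Mapping.keys x \<subseteq> states c w \<and> Kh_differential c w x = 0}"
    by (auto simp: Z_def Kh_cycles_def kernel_def CKh_def)
  have carr: "x - y \<in> carrier (CKh c w)" if "x \<in> carrier (CKh c w)" "y \<in> carrier (CKh c w)" for x y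
    using that keys_diff [of x y] by (auto simp: CKh_def)
  have "subgroup B F"
    unfolding F_def
  proof (rule subgroup_frag)
    show "0 \<in> B" unfolding B_def Kh_boundaries_def by (rule image_eqI [of _ _ 0]) (simp_all add: d0 CKh_def)
    fix x y assume "x \<in> B" "y \<in> B"
    then show "x - y \<in> B"
      unfolding B_def Kh_boundaries_def using carr by (auto simp flip: Kh_differential_diff)
  qed
  have "subgroup Z F"
    unfolding F_def Z by (rule subgroup_frag) (use keys_diff in \<open>fastforce simp: d0 Kh_differential_diff\<close>)+
  interpret F: comm_group F unfolding F_def by (rule abelian_free_Abelian_group)
  interpret B: normal B F by (rule F.subgroup_imp_normal [OF \<open>subgroup B F\<close>])
  interpret Q: group "F Mod B" by (rule B.factorgroup_is_group)
  interpret q: group_hom F "F Mod B" coset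
    by unfold_locales (simp add: coset_def [abs_def] B.r_coset_hom_Mod)
  have S: "subgroup (coset ` Z) (F Mod B)" by (rule q.subgroup_img_is_subgroup) fact
  have Kh: "Kh c w = (F Mod B)\<lparr>carrier := coset ` Z\<rparr>"
    by (auto simp: Kh_def FactGroup_def RCOSETS_def r_coset_def set_mult_def CKh_def
        free_Abelian_group_def F_def coset_def B_def Z_def fun_eq_iff)
  have car: "x \<in> carrier F" for x by (simp add: F_def)
  have pow: "coset x [^]\<^bsub>Kh c w\<^esub> k = coset (frag_cmul k x)" if "x \<in> Z" for x and k :: int
  proof -
    have "coset x [^]\<^bsub>Kh c w\<^esub> k = coset x [^]\<^bsub>F Mod B\<^esub> k"
      unfolding Kh using Q.int_pow_consistent [OF S] that by simp
    also have "\<dots> = coset (x [^]\<^bsub>F\<^esub> k)" using q.hom_int_pow [OF car] by simp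
    finally show ?thesis by (simp add: F_def)
  qed
  \<comment> \<open>Since \<open>h\<close> vanishes on boundaries, its value depends only on the
    coset, so equations between homology classes can be tested on representing chains.\<close>
  have val_eq: "int_of_frag h x = int_of_frag h y" if "coset x = coset y" for x y
  proof -
    have "x \<in> B #>\<^bsub>F\<^esub> y" using F.rcos_self [OF car \<open>subgroup B F\<close>, of x] that by (simp add: coset_def)
    then obtain \<beta> where "\<beta> \<in> B" "x = \<beta> + y" by (auto simp: r_coset_def F_def)
    then show ?thesis using h by (auto simp: B_def Kh_boundaries_def int_of_frag_add)
  qed
  have psi: "psi c w = coset p"
    by (simp add: psi_def coset_def B_def p_def r_coset_def CKh_def F_def)
  have p: "p \<in> Z" using psi_chain_cycle [OF det(2)] by (simp add: p_def Z_def)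
  have one: "\<one>\<^bsub>Kh c w\<^esub> = coset 0"
    using q.hom_one by (simp add: Kh F_def)
  have carrier: "carrier (Kh c w) = coset ` Z" by (simp add: Kh)
  have torsion: "psi c w [^]\<^bsub>Kh c w\<^esub> k \<noteq> \<one>\<^bsub>Kh c w\<^esub>" if "k \<noteq> 0" for k :: int
    using val_eq [of "frag_cmul k p" 0] h1 that unfolding psi pow [OF p] one
    by (auto simp: int_of_frag_cmul p_def)
  have nontrivial: "psi c w \<noteq> \<one>\<^bsub>Kh c w\<^esub>"
    using val_eq [of p 0] h1 unfolding psi one by (auto simp: p_def)
  have divisor: "\<bar>k\<bar> = 1" if "y \<in> carrier (Kh c w)" "psi c w = y [^]\<^bsub>Kh c w\<^esub> k" for y and k :: int
  proof -
    from that(1) obtain z where z: "z \<in> Z" "y = coset z" unfolding carrier by (elim imageE) simp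
    have "coset p = coset (frag_cmul k z)"
      unfolding psi [symmetric] that(2) z(2) by (rule pow [OF z(1)])
    from val_eq [OF this] have "k * int_of_frag h z = 1" using h1 by (simp add: int_of_frag_cmul p_def)
    then have "k = 1 \<or> k = - 1" using zmult_eq_1_iff by blast
    then show ?thesis by (elim disjE) simp_all
  qed
  have psi_carrier: "psi c w \<in> carrier (Kh c w)" using p by (simp add: carrier psi)
  have "primitive_element (Kh c w) (psi c w)"
    unfolding primitive_element_def using psi_carrier divisor by (intro conjI notI) (assumption, elim bexE exE conjE, simp)
  moreover have "non_torsion (Kh c w) (psi c w)"
    using psi_carrier torsion by (simp add: non_torsion_def)
  ultimately show ?thesis using nontrivial by blast
qed

end
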